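(* Consider the sub-Riemannian system $\dot q=\sum_{i=1}^m u_iF_i(q)$, $q(0)=0$, in $\mathbb{R}^n$ ($n\ge 3$), and suppose there exists a minimizing geodesic $\gamma$ associated to a unique strictly abnormal control $u$. Let $A\in S(0,r)$ be the end-point of $\gamma$. Assume that $(\sigma(\tau))_{0<\tau\le 1}$ is a $C^1$ curve on $S(0,r)$ such that $\lim_{\tau\to 0}\sigma(\tau)=A$. Then $$\lim_{\tau\to 0}\sigma'(\tau)\in\operatorname{Im}dE(u).$$
   Context: Consider a smooth sub-Riemannian structure on $\mathbb{R}^n$ (local point of view near $0$), given by a rank $m$ distribution $\Delta=\mathrm{Span}\{F_1,\dots,F_m\}$ and a metric $g$ on $\Delta$, where $F_1,\dots,F_m$ are smooth vector fields forming a $g$-orthonormal system. The length of a trajectory of $\dot q=\sum_i u_iF_i(q)$ on $[0,T]$ is $\int_0^T(\sum_i u_i^2)^{1/2}dt$; the sub-Riemannian distance between two points is the infimum of the lengths of the trajectories joining them; $S(0,r)$ is the set of points at sub-Riemannian distance $r$ from $0$. The sub-Riemannian problem is equivalent to the time-optimal problem for the system $\dot q=\sum_i u_iF_i(q)$, $q(0)=0$, with controls satisfying $\sum_i u_i^2\le 1$. A geodesic is minimizing if its length equals the sub-Riemannian distance between its end-points; here $\gamma$ starts from $0$ and has length $r$. The end-point mapping is $E:v\mapsto q_v(r)$, where $q_v$ is the solution on $[0,r]$ of the system with control $v$ and $q_v(0)=0$; $dE(u)$ denotes its Fréchet derivative at $u$. Geodesics are the projections $q$ of the solutions of $\dot q=\partial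 H_\nu/\partial p$, $\dot p=-\partial H_\nu/\partial q$, $\partial H_\nu/\partial u=0$, where $H_\nu=\langle p,\sum_i u_iF_i(q)\rangle+\nu\sum_i u_i^2$, $(p,\nu)\neq(0,0)$, and $\nu$ is a constant equal to $0$ or $-1/2$. A geodesic is abnormal if $\nu=0$ and normal if $\nu=-1/2$. It is strict if the extended adjoint vector $(p,\nu)$ is unique up to a scalar, that is, it corresponds to a singularity of codimension one of the end-point mapping of the extended system $\dot q=\sum_i u_iF_i(q)$, $\dot q^0=\sum_i u_i^2$. A control is strictly abnormal if its trajectory is a strict abnormal geodesic. *)

theory Defs
  imports "HOL-Analysis.Analysis"
begin

(* Class C^k by recursion on k.  On a Euclidean space, f is C^(k+1) iff it is differentiable
   and all its directional derivatives are C^k. *)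
primrec Ck :: "nat \<Rightarrow> ('a::euclidean_space \<Rightarrow> 'b::real_normed_vector) \<Rightarrow> bool" where
  "Ck 0 f = continuous_on UNIV f"
| "Ck (Suc k) f = (f differentiable_on UNIV \<and> (\<forall>h. Ck k (\<lambda>x. frechet_derivative f (at x) h)))"

definition smooth :: "('a::euclidean_space \<Rightarrow> 'b::real_normed_vector) \<Rightarrow> bool" where
  "smooth f \<longleftrightarrow> (\<forall>k. Ck k f)"

(* A sub-Riemannian structure of rank CARD('m) on R^n is given by a smooth frame F.  The metric g
   is not a separate datum: it is the unique metric on Span {F_i} making the F_i orthonormal. *)
definition sub_riemannian_frame :: "('m::finite \<Rightarrow> real^'n \<Rightarrow> real^'n) \<Rightarrow> bool" where
  "sub_riemannian_frame F \<longleftrightarrow> (\<forall>i. smooth (F i)) \<and>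
     (\<forall>q. inj (\<lambda>i. F i q) \<and> independent (range (\<lambda>i. F i q)))"

definition velocity :: "('m::finite \<Rightarrow> real^'n \<Rightarrow> real^'n) \<Rightarrow> real^'m \<Rightarrow> real^'n \<Rightarrow> real^'n" where
  "velocity F w q = (\<Sum>i\<in>UNIV. (w $ i) *\<^sub>R F i q)"

(* The space L^2([0,T], R^m), represented by functions whose values outside [0,T] are
   irrelevant; functions equal almost everywhere on [0,T] are at distance 0. *)
definition controls :: "real \<Rightarrow> (real \<Rightarrow> real^'m) set" where
  "controls T = {v. v \<in> borel_measurable (lebesgue_on {0..T}) \<and>
                    (\<lambda>t. (norm (v t))\<^sup>2) integrable_on {0..T}}"

definition L2_norm :: "real \<Rightarrow> (real \<Rightarrow> real^'m) \<Rightarrow> real" where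
  "L2_norm T v = sqrt (integral {0..T} (\<lambda>t. (norm (v t))\<^sup>2))"

(* Caratheodory solutions, in integrated form; continuity of q on [0,T] is implied. *)
definition trajectory ::
  "('m::finite \<Rightarrow> real^'n \<Rightarrow> real^'n) \<Rightarrow> real \<Rightarrow> real^'n \<Rightarrow> (real \<Rightarrow> real^'m) \<Rightarrow> (real \<Rightarrow> real^'n) \<Rightarrow> bool" where
  "trajectory F T x v q \<longleftrightarrow>
     (\<forall>t\<in>{0..T}. ((\<lambda>s. velocity F (v s) (q s)) has_integral (q t - x)) {0..t})"

(* The integrand norm (v t) is the square root of the sum of the squares of the v_i(t), i.e. the
   g-norm of the velocity of the trajectory. *)
definition traj_length :: "real \<Rightarrow> (real \<Rightarrow> real^'m) \<Rightarrow> real" where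
  "traj_length T v = integral {0..T} (\<lambda>t. norm (v t))"

(* Extended-real valued: infinite if no trajectory joins x to y. *)
definition sr_dist :: "('m::finite \<Rightarrow> real^'n \<Rightarrow> real^'n) \<Rightarrow> real^'n \<Rightarrow> real^'n \<Rightarrow> ereal" where
  "sr_dist F x y = Inf {ereal (traj_length T v) | T v q.
     0 < T \<and> v \<in> controls T \<and> trajectory F T x v q \<and> q T = y}"

definition sr_sphere :: "('m::finite \<Rightarrow> real^'n \<Rightarrow> real^'n) \<Rightarrow> real^'n \<Rightarrow> real \<Rightarrow> (real^'n) set" where
  "sr_sphere F x r = {y. sr_dist F x y = ereal r}"

(* Admissible controls of the equivalent time-optimal problem. *)
definition admissible :: "real \<Rightarrow> (real \<Rightarrow> real^'m) \<Rightarrow> bool" where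
  "admissible T v \<longleftrightarrow> v \<in> controls T \<and> (AE t in lebesgue_on {0..T}. norm (v t) \<le> 1)"

definition minimizing ::
  "('m::finite \<Rightarrow> real^'n \<Rightarrow> real^'n) \<Rightarrow> real \<Rightarrow> (real \<Rightarrow> real^'m) \<Rightarrow> (real \<Rightarrow> real^'n) \<Rightarrow> bool" where
  "minimizing F T v q \<longleftrightarrow>
     trajectory F T (q 0) v q \<and> ereal (traj_length T v) = sr_dist F (q 0) (q T)"

definition hamiltonian ::
  "('m::finite \<Rightarrow> real^'n \<Rightarrow> real^'n) \<Rightarrow> real \<Rightarrow> real^'n \<Rightarrow> real^'n \<Rightarrow> real^'m \<Rightarrow> real" where
  "hamiltonian F \<nu> q p w = p \<bullet> velocity F w q + \<nu> * (\<Sum>i\<in>UNIV. (w $ i)\<^sup>2)"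

definition grad :: "('a::real_inner \<Rightarrow> real) \<Rightarrow> 'a \<Rightarrow> 'a" where
  "grad f x = (THE D. GDERIV f x :> D)"

(* (p, nu) is an extended adjoint vector along the trajectory q of the control u on [0,T]:
   dq/dt = dH/dp, dp/dt = - dH/dq (both in integrated form), dH/du = 0. *)
definition extended_adjoint ::
  "('m::finite \<Rightarrow> real^'n \<Rightarrow> real^'n) \<Rightarrow> real \<Rightarrow> (real \<Rightarrow> real^'m) \<Rightarrow> (real \<Rightarrow> real^'n)
     \<Rightarrow> (real \<Rightarrow> real^'n) \<Rightarrow> real \<Rightarrow> bool" where
  "extended_adjoint F T u q p \<nu> \<longleftrightarrow>
     \<nu> \<in> {0, -1/2} \<and>
     (\<forall>t\<in>{0..T}. (p t, \<nu>) \<noteq> (0, 0)) \<and>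
     (\<forall>t\<in>{0..T}. ((\<lambda>s. grad (\<lambda>y. hamiltonian F \<nu> (q s) y (u s)) (p s))
                    has_integral (q t - q 0)) {0..t}) \<and>
     (\<forall>t\<in>{0..T}. ((\<lambda>s. - grad (\<lambda>x. hamiltonian F \<nu> x (p s) (u s)) (q s))
                    has_integral (p t - p 0)) {0..t}) \<and>
     (AE t in lebesgue_on {0..T}. grad (hamiltonian F \<nu> (q t) (p t)) (u t) = 0)"

(* The trajectory q of u is an abnormal geodesic whose extended adjoint vector is unique
   up to a scalar among all extended adjoint vectors, normal ones included. *)
definition strictly_abnormal ::
  "('m::finite \<Rightarrow> real^'n \<Rightarrow> real^'n) \<Rightarrow> real \<Rightarrow> (real \<Rightarrow> real^'m) \<Rightarrow> (real \<Rightarrow> real^'n) \<Rightarrow> bool" where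
  "strictly_abnormal F T u q \<longleftrightarrow>
     (\<exists>p. extended_adjoint F T u q p 0) \<and>
     (\<forall>p \<nu> p' \<nu>'. extended_adjoint F T u q p \<nu> \<and> extended_adjoint F T u q p' \<nu>' \<longrightarrow>
        (\<exists>c. (\<forall>t\<in>{0..T}. p' t = c *\<^sub>R p t) \<and> \<nu>' = c * \<nu>))"

(* The end-point mapping starts at 0; its domain is the set of square-integrable controls
   whose trajectory is defined on all of [0,T]. *)
definition end_point_dom :: "('m::finite \<Rightarrow> real^'n \<Rightarrow> real^'n) \<Rightarrow> real \<Rightarrow> (real \<Rightarrow> real^'m) set" where
  "end_point_dom F T = {v \<in> controls T. \<exists>q. trajectory F T 0 v q}"

definition end_point :: "('m::finite \<Rightarrow> real^'n \<Rightarrow> real^'n) \<Rightarrow> real \<Rightarrow> (real \<Rightarrow> real^'m) \<Rightarrow> real^'n" where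
  "end_point F T v = (THE y. \<exists>q. trajectory F T 0 v q \<and> q T = y)"

(* D is the Frechet derivative at u of a map E defined on the subset Dom of L^2([0,T], R^m):
   u is an interior point of Dom, D is linear and bounded, and the remainder is o(norm h).
   has_derivative is not applicable, as controls T is a seminormed space of functions and not
   a type; the values of D outside controls T are immaterial. *)
definition has_L2_derivative ::
  "real \<Rightarrow> (real \<Rightarrow> real^'m) set \<Rightarrow> ((real \<Rightarrow> real^'m) \<Rightarrow> real^'n) \<Rightarrow> ((real \<Rightarrow> real^'m) \<Rightarrow> real^'n)
     \<Rightarrow> (real \<Rightarrow> real^'m) \<Rightarrow> bool" where
  "has_L2_derivative T Dom E D u \<longleftrightarrow>
     (\<forall>v\<in>controls T. \<forall>w\<in>controls T. D (\<lambda>t. v t + w t) = D v + D w) \<and>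
     (\<forall>c. \<forall>v\<in>controls T. D (\<lambda>t. c *\<^sub>R v t) = c *\<^sub>R D v) \<and>
     (\<exists>C. \<forall>v\<in>controls T. norm (D v) \<le> C * L2_norm T v) \<and>
     (\<forall>e>0. \<exists>d>0. \<forall>h\<in>controls T. L2_norm T h < d \<longrightarrow>
        (\<lambda>t. u t + h t) \<in> Dom \<and>
        norm (E (\<lambda>t. u t + h t) - E u - D h) \<le> e * L2_norm T h)"

definition dE ::
  "('m::finite \<Rightarrow> real^'n \<Rightarrow> real^'n) \<Rightarrow> real \<Rightarrow> (real \<Rightarrow> real^'m) \<Rightarrow> (real \<Rightarrow> real^'m) \<Rightarrow> real^'n" where
  "dE F T u = (SOME D. has_L2_derivative T (end_point_dom F T) (end_point F T) D u)"

end

theory Submission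
  imports Defs "HOL-Complex_Analysis.Great_Picard"
begin

text \<open>
The idea. Let $E$ be the end-point mapping, $C(v) = \|v\|^2$ the energy, and suppose that the limit $L$ of the
velocities \<open>\<sigma>'\<close> is not in the image of \<open>dE(u)\<close>. Strictness of the abnormal control says that the covectors \<open>(a, b)\<close>
annihilating the image of \<open>d(E, C)(u)\<close> form a line, spanned by some \<open>(\<psi>, 0)\<close>; in particular the image of \<open>dE(u)\<close> is the
hyperplane orthogonal to \<open>\<psi>\<close>, and \<open>\<psi> \<bullet> L\<close> is nonzero. Then no nonzero covector annihilates both the image of
\<open>d(E, C)(u)\<close> and \<open>(L, 0)\<close>, so the map \<open>(v, s) \<mapsto> (E(v) - \<sigma>(s), C(v))\<close>
is a submersion in the limit \<open>v \<rightarrow> u\<close>, \<open>s \<rightarrow> 0\<close>. Both \<open>E\<close> and \<open>C\<close> are strictly differentiable at \<open>u\<close> for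
the \<open>L\<^sup>2\<close> norm, and the curve \<open>\<sigma>\<close>, being \<open>C\<^sup>1\<close> up to \<open>0\<close>, is strictly differentiable there as well. Hence, near any
control \<open>w\<close> close to \<open>u\<close> with \<open>E(w) = \<sigma>(\<tau>)\<close> and \<open>C(w)\<close> close to \<open>r\<close>, a Newton iteration finds a control \<open>v\<close> and a
parameter \<open>s\<close> near \<open>\<tau>\<close> with \<open>E(v) = \<sigma>(s)\<close> and \<open>C(v) < r\<close> (lemma \<open>perturb_to_smaller_energy\<close>). By the Cauchy-Schwarz
inequality the trajectory of \<open>v\<close> has length less than \<open>r\<close>, while \<open>\<sigma>(s)\<close> is on the sphere of radius \<open>r\<close>: a contradiction.

The control \<open>w\<close> is almost minimizing, and it is irrelevant whether minimizers to \<open>\<sigma>(\<tau>)\<close> are normal or abnormal. What matters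
is that such a \<open>w\<close> exists arbitrarily close to \<open>u\<close> in \<open>L\<^sup>2\<close>, and this is where compactness and the uniqueness
of \<open>u\<close> enter. Trajectories almost realizing the distance to \<open>\<sigma>(\<tau>)\<close> are
reparametrized by a regularized arc length, which gives controls on \<open>[0, r]\<close> bounded by \<open>1 + \<epsilon>\<close>
(\<open>arclength_reparametrization\<close>). Along a sequence with \<open>\<epsilon> \<rightarrow> 0\<close> and \<open>\<tau> \<rightarrow> 0\<close>, the primitives of these controls
converge uniformly by the theorem of Arzela and Ascoli to a \<open>1\<close>-Lipschitz function, which is the primitive of an admissible
control \<open>v\<close> (\<open>controls_weak_compactness\<close>). The end-point mapping is continuous for this weak convergence, so \<open>v\<close> is a
minimizer to \<open>A\<close> and thus equals \<open>u\<close>; as the energies converge to the energy of \<open>u\<close>, the convergence is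
strong (\<open>near_minimizers_converge\<close>).

Strict differentiability of \<open>E\<close> is proved by duality: if \<open>p\<close> solves the adjoint equation along the trajectory of \<open>u\<close>, the
product rule turns \<open>p(T) \<bullet> (q\<^sub>v(T) - q\<^sub>w(T))\<close> into an integral whose main part is the value of the derivative of \<open>E\<close>
on \<open>v - w\<close> (\<open>adjoint_strict_derivative\<close>). The same curves \<open>p\<close> turn covectors annihilating \<open>d(E, C)(u)\<close> into
extended adjoint vectors (\<open>annihilator_extended_adjoint\<close>).
\<close>

section \<open>Calculus of primitives of integrable functions\<close>

text \<open>A substitute for the vanishing of a derivative almost everywhere: increments over short intervals that are negligible with respect to
those of some $N$ add up, over a subdivision, to something negligible.\<close>

lemma constant_if_increments_negligible:
  fixes h :: "real \<Rightarrow> 'a::real_normed_vector" and N :: "real \<Rightarrow> real"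
  assumes "0 \<le> T"
    and inc: "\<And>e. e > 0 \<Longrightarrow> \<exists>d>0. \<forall>s t. 0 \<le> s \<longrightarrow> s \<le> t \<longrightarrow> t \<le> T \<longrightarrow> t - s < d
                 \<longrightarrow> norm (h t - h s) \<le> e * (N t - N s)"
  shows "h T = h 0"
proof -
  have small: "norm (h T - h 0) \<le> e * (N T - N 0)" if "e > 0" for e
  proof -
    obtain d where d: "d > 0"
      and D: "\<And>s t. 0 \<le> s \<Longrightarrow> s \<le> t \<Longrightarrow> t \<le> T \<Longrightarrow> t - s < d \<Longrightarrow> norm (h t - h s) \<le> e * (N t - N s)"
      using inc[OF \<open>e > 0\<close>] by blast
    have "norm (h t - h 0) \<le> e * (N t - N 0)" if "0 \<le> t" "t \<le> T" "t \<le> real n * (d/2)" for n t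
      using that
    proof (induction n arbitrary: t)
      case 0
      then have "t = 0" by simp
      then show ?case by simp
    next
      case (Suc n)
      define s where "s = max 0 (t - d/2)"
      have "t - d/2 \<le> real n * (d/2)" "0 \<le> real n * (d/2)"
        using Suc.prems(3) d by (simp_all add: algebra_simps)
      then have s: "0 \<le> s" "s \<le> t" "s \<le> T" "t - s < d" "s \<le> real n * (d/2)"
        using Suc.prems(1,2) d unfolding s_def by linarith+
      have "norm (h t - h 0) \<le> norm (h t - h s) + norm (h s - h 0)"
        using norm_triangle_ineq[of "h t - h s" "h s - h 0"] by simp
      also have "\<dots> \<le> e * (N t - N s) + e * (N s - N 0)"
        using D[of s t] Suc.IH[of s] s Suc.prems by (intro add_mono) auto
      finally show ?case by (simp add: algebra_simps)
    qed
    moreover obtain n :: nat where "T \<le> real n * (d/2)"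
      using d real_arch_simple[of "T / (d/2)"] by (auto simp: field_simps)
    ultimately show ?thesis using \<open>0 \<le> T\<close> by blast
  qed
  have "norm (h T - h 0) \<le> 0"
  proof (rule field_le_epsilon)
    fix e :: real assume "e > 0"
    have "norm (h T - h 0) \<le> e / (\<bar>N T - N 0\<bar> + 1) * (N T - N 0)"
      by (rule small) (use \<open>e > 0\<close> in \<open>simp add: divide_pos_pos add_nonneg_pos\<close>)
    also have "\<dots> \<le> e"
    proof -
      have "e * (N T - N 0) \<le> e * (\<bar>N T - N 0\<bar> + 1)"
        using \<open>e > 0\<close> by (intro mult_left_mono) auto
      then show ?thesis by (simp add: divide_simps)
    qed
    finally show "norm (h T - h 0) \<le> 0 + e" by simp
  qed
  then show ?thesis by simp
qed

lemma integral_diff_Icc: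
  fixes f :: "real \<Rightarrow> 'a::euclidean_space"
  assumes "f integrable_on {0..T}" "0 \<le> s" "s \<le> t" "t \<le> T"
  shows "integral {0..t} f - integral {0..s} f = integral {s..t} f"
proof -
  have "f integrable_on {0..t}"
    using assms by (intro integrable_on_subinterval[OF assms(1)]) auto
  then show ?thesis
    using Henstock_Kurzweil_Integration.integral_combine[of 0 s t f] assms by (simp add: algebra_simps)
qed

lemma abs_integrable_sub:
  fixes f :: "real \<Rightarrow> 'a::euclidean_space"
  assumes "f absolutely_integrable_on {0..T}" "0 \<le> s" "t \<le> T"
  shows "f absolutely_integrable_on {s..t}"
  using assms by (auto intro: absolutely_integrable_on_subinterval)

lemma abs_int_integrable:
  fixes f :: "'a::euclidean_space \<Rightarrow> 'b::euclidean_space"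
  shows "f absolutely_integrable_on S \<Longrightarrow> f integrable_on S"
  by (simp add: absolutely_integrable_on_def)

lemma abs_int_norm_integrable:
  fixes f :: "'a::euclidean_space \<Rightarrow> 'b::euclidean_space"
  shows "f absolutely_integrable_on S \<Longrightarrow> (\<lambda>x. norm (f x)) integrable_on S"
  by (simp add: absolutely_integrable_on_def)

lemma abs_int_bilinear_continuous:
  fixes g :: "real \<Rightarrow> 'a::euclidean_space" and prod :: "'a \<Rightarrow> 'b::euclidean_space \<Rightarrow> 'c::euclidean_space"
  assumes "bounded_bilinear prod" "continuous_on {s..t} g" "f absolutely_integrable_on {s..t}"
  shows "(\<lambda>x. prod (g x) (f x)) absolutely_integrable_on {s..t}"
proof (rule absolutely_integrable_bounded_measurable_product[where h=prod and f=g and g=f])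
  show "bilinear prod" using assms(1) bilinear_conv_bounded_bilinear by blast
  show "g \<in> borel_measurable (lebesgue_on {s..t})"
    using assms(2) by (intro continuous_imp_measurable_on_sets_lebesgue) auto
  show "bounded (g ` {s..t})"
    using assms(2) by (intro compact_imp_bounded compact_continuous_image) auto
qed (use assms in auto)

lemma abs_int_bilinear_continuous2:
  fixes g :: "real \<Rightarrow> 'a::euclidean_space" and prod :: "'b::euclidean_space \<Rightarrow> 'a \<Rightarrow> 'c::euclidean_space"
  assumes "bounded_bilinear prod" "continuous_on {s..t} g" "f absolutely_integrable_on {s..t}"
  shows "(\<lambda>x. prod (f x) (g x)) absolutely_integrable_on {s..t}"
  using abs_int_bilinear_continuous[OF bounded_bilinear.flip[OF assms(1)] assms(2,3)] .

lemma primitive_continuous: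
  fixes f F :: "real \<Rightarrow> 'a::euclidean_space"
  assumes F: "\<forall>t\<in>{0..T}. (f has_integral (F t - x)) {0..t}"
  shows "continuous_on {0..T} F"
proof (cases "0 \<le> T")
  case True
  have "f integrable_on {0..T}" using F True by (auto simp: integrable_on_def)
  then have "continuous_on {0..T} (\<lambda>t. integral {0..t} f + x)"
    by (intro continuous_intros indefinite_integral_continuous_1)
  moreover have "integral {0..t} f + x = F t" if "t \<in> {0..T}" for t
    using integral_unique[OF bspec[OF F that]] by simp
  ultimately show ?thesis by (rule continuous_on_eq)
qed simp

text \<open>The product $f(t) g(t)$ minus the integral of the expected derivative has increment
\<open>\<integral>\<^sub>s\<^sup>t \<phi>(\<tau>) (g(t) - g(\<tau>)) + (f(s) - f(\<tau>)) \<omega>(\<tau>) d\<tau>\<close> over $[s, t]$, which is negligible because $f$ and $g$ are uniformly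
continuous.\<close>

lemma product_rule_integral:
  fixes prod :: "'a::euclidean_space \<Rightarrow> 'b::euclidean_space \<Rightarrow> 'c::euclidean_space" and T :: real
  assumes bil: "bounded_bilinear prod"
    and "0 \<le> T"
    and phi: "\<phi> absolutely_integrable_on {0..T}" and chi: "\<omega> absolutely_integrable_on {0..T}"
    and f: "\<forall>t\<in>{0..T}. (\<phi> has_integral (f t - f 0)) {0..t}"
    and g: "\<forall>t\<in>{0..T}. (\<omega> has_integral (g t - g 0)) {0..t}"
  shows "((\<lambda>s. prod (\<phi> s) (g s) + prod (f s) (\<omega> s)) has_integral
            (prod (f T) (g T) - prod (f 0) (g 0))) {0..T}"
proof -
  interpret bounded_bilinear prod by (rule bil)
  define \<theta> where "\<theta> = (\<lambda>s. prod (\<phi> s) (g s) + prod (f s) (\<omega> s))"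
  have cf: "continuous_on {0..T} f" by (rule primitive_continuous[OF f])
  have cg: "continuous_on {0..T} g" by (rule primitive_continuous[OF g])
  have int_phi: "\<phi> integrable_on {0..T}" and int_chi: "\<omega> integrable_on {0..T}"
    using phi chi abs_int_integrable by blast+
  have abs1: "(\<lambda>s. prod (\<phi> s) (g s)) absolutely_integrable_on {0..T}"
    by (rule abs_int_bilinear_continuous2[OF bil cg phi])
  have abs2: "(\<lambda>s. prod (f s) (\<omega> s)) absolutely_integrable_on {0..T}"
    by (rule abs_int_bilinear_continuous[OF bil cf chi])
  have theta: "\<theta> absolutely_integrable_on {0..T}"
    unfolding \<theta>_def using abs1 abs2 by (rule set_integral_add)
  have int_theta: "\<theta> integrable_on {0..T}" using theta abs_int_integrable by blast
  have df: "f t - f s = integral {s..t} \<phi>" and dg: "g t - g s = integral {s..t} \<omega>"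
    if "0 \<le> s" "s \<le> t" "t \<le> T" for s t
    using integral_diff_Icc[OF int_phi that] integral_diff_Icc[OF int_chi that]
      integral_unique[OF bspec[OF f]] integral_unique[OF bspec[OF g]] that by (simp_all add: algebra_simps)
  define N where "N t = integral {0..t} (\<lambda>s. norm (\<phi> s) + norm (\<omega> s))" for t
  have intN: "(\<lambda>s. norm (\<phi> s) + norm (\<omega> s)) integrable_on {0..T}"
    using phi chi by (intro integrable_add abs_int_norm_integrable)
  define h where "h t = prod (f t) (g t) - integral {0..t} \<theta>" for t
  obtain K where K: "K > 0" "\<And>a b. norm (prod a b) \<le> norm a * norm b * K"
    using pos_bounded by blast
  have "h T = h 0"
  proof (rule constant_if_increments_negligible[OF \<open>0 \<le> T\<close>, of h N])
    fix e :: real assume "e > 0"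
    define e' where "e' = e / K"
    have "e' > 0" using \<open>e > 0\<close> K by (simp add: e'_def)
    have uf: "uniformly_continuous_on {0..T} f" and ug: "uniformly_continuous_on {0..T} g"
      using cf cg by (auto intro: compact_uniformly_continuous)
    obtain d1 where d1: "d1 > 0" "\<And>s t. s \<in> {0..T} \<Longrightarrow> t \<in> {0..T} \<Longrightarrow> dist t s < d1 \<Longrightarrow> dist (f t) (f s) < e'"
      using uf \<open>e' > 0\<close> unfolding uniformly_continuous_on_def by meson
    obtain d2 where d2: "d2 > 0" "\<And>s t. s \<in> {0..T} \<Longrightarrow> t \<in> {0..T} \<Longrightarrow> dist t s < d2 \<Longrightarrow> dist (g t) (g s) < e'"
      using ug \<open>e' > 0\<close> unfolding uniformly_continuous_on_def by meson
    have "norm (h t - h s) \<le> e * (N t - N s)"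
      if st: "0 \<le> s" "s \<le> t" "t \<le> T" "t - s < min d1 d2" for s t
    proof -
      have sub: "{s..t} \<subseteq> {0..T}" using st by auto
      have i1: "\<phi> integrable_on {s..t}" and i2: "\<omega> integrable_on {s..t}" and i3: "\<theta> integrable_on {s..t}"
        using integrable_on_subinterval int_phi int_chi int_theta sub by blast+
      have a1: "((\<lambda>\<tau>. prod (\<phi> \<tau>) (g t)) has_integral prod (f t - f s) (g t)) {s..t}"
        unfolding df[OF st(1-3)]
        using has_integral_linear[OF integrable_integral[OF i1] bounded_linear_left, of "g t"] by (simp add: o_def)
      have a2: "((\<lambda>\<tau>. prod (f s) (\<omega> \<tau>)) has_integral prod (f s) (g t - g s)) {s..t}"
        unfolding dg[OF st(1-3)]
        using has_integral_linear[OF integrable_integral[OF i2] bounded_linear_right, of "f s"] by (simp add: o_def)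
      have "((\<lambda>\<tau>. prod (\<phi> \<tau>) (g t) + prod (f s) (\<omega> \<tau>) - \<theta> \<tau>) has_integral
             (prod (f t - f s) (g t) + prod (f s) (g t - g s) - integral {s..t} \<theta>)) {s..t}"
        by (intro has_integral_diff has_integral_add a1 a2 integrable_integral i3)
      moreover have "prod (f t - f s) (g t) + prod (f s) (g t - g s) - integral {s..t} \<theta> = h t - h s"
        using integral_diff_Icc[OF int_theta st(1-3)]
        by (simp add: h_def diff_left diff_right algebra_simps)
      ultimately have H: "((\<lambda>\<tau>. prod (\<phi> \<tau>) (g t) + prod (f s) (\<omega> \<tau>) - \<theta> \<tau>) has_integral (h t - h s)) {s..t}"
        by simp
      have "norm (integral {s..t} (\<lambda>\<tau>. prod (\<phi> \<tau>) (g t) + prod (f s) (\<omega> \<tau>) - \<theta> \<tau>))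
             \<le> integral {s..t} (\<lambda>\<tau>. e * (norm (\<phi> \<tau>) + norm (\<omega> \<tau>)))"
      proof (rule integral_norm_bound_integral)
        show "(\<lambda>\<tau>. prod (\<phi> \<tau>) (g t) + prod (f s) (\<omega> \<tau>) - \<theta> \<tau>) integrable_on {s..t}"
          using H by blast
        show "(\<lambda>\<tau>. e * (norm (\<phi> \<tau>) + norm (\<omega> \<tau>))) integrable_on {s..t}"
          using integrable_on_subinterval[OF intN sub] by (rule integrable_on_mult_right)
        fix \<tau> assume tau: "\<tau> \<in> {s..t}"
        have e1: "norm (g t - g \<tau>) \<le> e'"
          using d2(2)[of \<tau> t] tau st by (force simp: dist_norm)
        have e2: "norm (f s - f \<tau>) \<le> e'"
          using d1(2)[of s \<tau>] tau st by (force simp: dist_norm norm_minus_commute)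
        have "prod (\<phi> \<tau>) (g t) + prod (f s) (\<omega> \<tau>) - \<theta> \<tau> = prod (\<phi> \<tau>) (g t - g \<tau>) + prod (f s - f \<tau>) (\<omega> \<tau>)"
          by (simp add: \<theta>_def diff_left diff_right)
        also have "norm \<dots> \<le> norm (\<phi> \<tau>) * e' * K + e' * norm (\<omega> \<tau>) * K"
        proof (rule order_trans[OF norm_triangle_ineq] add_mono)+
          have "norm (prod (\<phi> \<tau>) (g t - g \<tau>)) \<le> norm (\<phi> \<tau>) * norm (g t - g \<tau>) * K" by (rule K)
          also have "\<dots> \<le> norm (\<phi> \<tau>) * e' * K" using e1 K(1) by (intro mult_right_mono mult_left_mono) auto
          finally show "norm (prod (\<phi> \<tau>) (g t - g \<tau>)) \<le> norm (\<phi> \<tau>) * e' * K" .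
          have "norm (prod (f s - f \<tau>) (\<omega> \<tau>)) \<le> norm (f s - f \<tau>) * norm (\<omega> \<tau>) * K" by (rule K)
          also have "\<dots> \<le> e' * norm (\<omega> \<tau>) * K" using e2 K(1) by (intro mult_right_mono) auto
          finally show "norm (prod (f s - f \<tau>) (\<omega> \<tau>)) \<le> e' * norm (\<omega> \<tau>) * K" .
        qed
        also have "\<dots> = e * (norm (\<phi> \<tau>) + norm (\<omega> \<tau>))"
          using K(1) by (simp add: e'_def field_simps)
        finally show "norm (prod (\<phi> \<tau>) (g t) + prod (f s) (\<omega> \<tau>) - \<theta> \<tau>) \<le> e * (norm (\<phi> \<tau>) + norm (\<omega> \<tau>))" .
      qed
      also have "\<dots> = e * (N t - N s)"
        unfolding N_def by (subst integral_diff_Icc[OF intN st(1-3)]) (rule integral_mult_right)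
      finally show ?thesis using H by (simp add: integral_unique)
    qed
    then show "\<exists>d>0. \<forall>s t. 0 \<le> s \<longrightarrow> s \<le> t \<longrightarrow> t \<le> T \<longrightarrow> t - s < d \<longrightarrow> norm (h t - h s) \<le> e * (N t - N s)"
      using d1(1) d2(1) by (intro exI[of _ "min d1 d2"]) auto
  qed
  then have "integral {0..T} \<theta> = prod (f T) (g T) - prod (f 0) (g 0)"
    by (simp add: h_def algebra_simps)
  then show ?thesis
    using integrable_integral[OF int_theta] by (simp add: \<theta>_def)
qed

text \<open>The chain rule for powers of a primitive; it is what makes the Picard iterates and the iterated Gronwall bounds
behave like the terms of an exponential series even though $k$ is merely integrable.\<close>

lemma primitive_power:
  fixes k :: "real \<Rightarrow> real"
  assumes "0 \<le> T" and k: "k absolutely_integrable_on {0..T}"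
  shows "((\<lambda>s. k s * (integral {0..s} k)^n) has_integral (integral {0..T} k)^(Suc n) / Suc n) {0..T}"
  using assms
proof (induction n arbitrary: T)
  case 0
  then show ?case by (simp add: integrable_integral abs_int_integrable)
next
  case (Suc n)
  define K where "K t = integral {0..t} k" for t
  have sub: "k absolutely_integrable_on {0..t}" if "0 \<le> t" "t \<le> T" for t
    using abs_integrable_sub[OF Suc.prems(2)] that by simp
  have K: "\<forall>t\<in>{0..T}. (k has_integral (K t - K 0)) {0..t}"
    using sub by (simp add: K_def integrable_integral abs_int_integrable)
  have cK: "continuous_on {0..T} K" by (rule primitive_continuous[OF K])
  have Kn: "((\<lambda>s. Suc n * (k s * K s ^ n)) has_integral (K t ^ Suc n - K 0 ^ Suc n)) {0..t}" if "t \<in> {0..T}" for t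
  proof -
    have "((\<lambda>s. k s * K s ^ n) has_integral (K t ^ Suc n) / Suc n) {0..t}"
      using Suc.IH[of t] sub[of t] that unfolding K_def by (simp only: atLeastAtMost_iff)
    from has_integral_mult_right[OF this, of "real (Suc n)"] show ?thesis
      by (simp add: K_def del: power_Suc of_nat_Suc)
  qed
  have absn: "(\<lambda>s. Suc n * (k s * K s ^ n)) absolutely_integrable_on {0..T}"
  proof -
    have "(\<lambda>s. (Suc n * K s ^ n) * k s) absolutely_integrable_on {0..T}"
      by (intro abs_int_bilinear_continuous[OF bounded_bilinear_mult] continuous_intros cK Suc.prems)
    then show ?thesis by (simp add: mult_ac)
  qed
  have "((\<lambda>s. k s * K s ^ Suc n + K s * (Suc n * (k s * K s ^ n))) has_integral
      (K T * K T ^ Suc n - K 0 * K 0 ^ Suc n)) {0..T}"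
    by (rule product_rule_integral[OF bounded_bilinear_mult Suc.prems(1) Suc.prems(2) absn K]) (use Kn in blast)
  moreover have "k s * K s ^ Suc n + K s * (Suc n * (k s * K s ^ n)) = Suc (Suc n) * (k s * K s ^ Suc n)" for s
    by (simp add: algebra_simps of_nat_Suc)
  ultimately have "((\<lambda>s. Suc (Suc n) * (k s * K s ^ Suc n)) has_integral (K T ^ Suc (Suc n))) {0..T}"
    by (simp add: K_def)
  from has_integral_mult_right[OF this, of "inverse (real (Suc (Suc n)))"]
  have "((\<lambda>s. inverse (real (Suc (Suc n))) * (Suc (Suc n) * (k s * K s ^ Suc n))) has_integral (inverse (real (Suc (Suc n))) * K T ^ Suc (Suc n))) {0..T}" .
  moreover have "inverse (real (Suc (Suc n))) * (Suc (Suc n) * x) = x" for x :: real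
    by (simp add: mult.assoc[symmetric] del: of_nat_Suc)
  ultimately show ?case
    unfolding K_def by (simp only: divide_inverse mult.commute)
qed

section \<open>Gronwall inequality and Caratheodory solutions\<close>

text \<open>Substituting the inequality $n$ times into itself bounds \<open>\<phi>\<close> by $a$ times a partial sum of the exponential series of the
primitive of $k$, plus a remainder that tends to $0$.\<close>

lemma gronwall_integral:
  fixes \<phi> k :: "real \<Rightarrow> real"
  assumes k: "k absolutely_integrable_on {0..T}" and k0: "\<forall>t\<in>{0..T}. 0 \<le> k t"
    and cont: "continuous_on {0..T} \<phi>"
    and le: "\<forall>t\<in>{0..T}. \<phi> t \<le> a + integral {0..t} (\<lambda>s. k s * \<phi> s)"
    and t: "t \<in> {0..T}"
  shows "\<phi> t \<le> a * exp (integral {0..t} k)"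
proof -
  define K where "K t = integral {0..t} k" for t
  have "compact (\<phi> ` {0..T})" using cont by (intro compact_continuous_image) auto
  then obtain B where B: "\<And>t. t \<in> {0..T} \<Longrightarrow> \<bar>\<phi> t\<bar> \<le> B"
    using compact_imp_bounded bounded_pos by (metis imageI real_norm_def)
  have pw: "((\<lambda>s. k s * K s ^ n / fact n) has_integral K t ^ Suc n / fact (Suc n)) {0..t}" if "t \<in> {0..T}" for n t
  proof -
    have "((\<lambda>s. k s * K s ^ n) has_integral K t ^ Suc n / Suc n) {0..t}"
      unfolding K_def using that abs_integrable_sub[OF k, of 0 t] by (intro primitive_power) auto
    from has_integral_mult_right[OF this, of "1 / fact n"] show ?thesis
      by (simp add: field_simps)
  qed
  have step: "\<phi> t \<le> a * (\<Sum>j<n. K t ^ j / fact j) + B * (K t ^ n / fact n)" if "t \<in> {0..T}" for n t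
    using that
  proof (induction n arbitrary: t)
    case 0
    then show ?case using B[of t] by auto
  next
    case (Suc n)
    let ?R = "\<lambda>s. a * (\<Sum>j<n. k s * K s ^ j / fact j) + B * (k s * K s ^ n / fact n)"
    have R: "(?R has_integral (a * (\<Sum>j<n. K t ^ Suc j / fact (Suc j)) + B * (K t ^ Suc n / fact (Suc n)))) {0..t}"
      using pw[OF Suc.prems] by (intro has_integral_add has_integral_mult_right has_integral_sum) auto
    have "\<phi> t \<le> a + integral {0..t} (\<lambda>s. k s * \<phi> s)" using le Suc.prems by blast
    also have "integral {0..t} (\<lambda>s. k s * \<phi> s) \<le> integral {0..t} ?R"
    proof (rule integral_le)
      show "(\<lambda>s. k s * \<phi> s) integrable_on {0..t}"
      proof (rule abs_int_integrable, rule abs_int_bilinear_continuous2[OF bounded_bilinear_mult])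
        show "continuous_on {0..t} \<phi>" using Suc.prems by (intro continuous_on_subset[OF cont]) auto
        show "k absolutely_integrable_on {0..t}" using Suc.prems abs_integrable_sub[OF k, of 0 t] by auto
      qed
      show "?R integrable_on {0..t}" using R by blast
      fix s assume s: "s \<in> {0..t}"
      then have s': "s \<in> {0..T}" using Suc.prems by auto
      have "k s * \<phi> s \<le> k s * (a * (\<Sum>j<n. K s ^ j / fact j) + B * (K s ^ n / fact n))"
        using Suc.IH[OF s'] k0 s' by (intro mult_left_mono) auto
      also have "\<dots> = ?R s" by (simp add: distrib_left sum_distrib_left mult_ac)
      finally show "k s * \<phi> s \<le> ?R s" .
    qed
    also have "integral {0..t} ?R = a * (\<Sum>j<n. K t ^ Suc j / fact (Suc j)) + B * (K t ^ Suc n / fact (Suc n))"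
      using R by (rule integral_unique)
    also have "a + (a * (\<Sum>j<n. K t ^ Suc j / fact (Suc j)) + B * (K t ^ Suc n / fact (Suc n)))
        = a * (\<Sum>j<Suc n. K t ^ j / fact j) + B * (K t ^ Suc n / fact (Suc n))"
      by (subst sum.lessThan_Suc_shift) (simp add: distrib_left del: power_Suc fact_Suc)
    finally show ?case by simp
  qed
  have sums: "(\<lambda>j. K t ^ j / fact j) sums exp (K t)"
    using exp_converges[of "K t"] by (simp add: divide_inverse scaleR_conv_of_real mult.commute)
  have "(\<lambda>n. a * (\<Sum>j<n. K t ^ j / fact j) + B * (K t ^ n / fact n)) \<longlonglongrightarrow> a * exp (K t) + B * 0"
    using sums unfolding sums_def
    by (intro tendsto_intros summable_LIMSEQ_zero sums_summable[OF sums]) 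
  then have "\<phi> t \<le> a * exp (K t) + B * 0"
    by (rule LIMSEQ_le_const) (use step[OF t] in auto)
  then show ?thesis by (simp add: K_def)
qed

lemma integral_norm_le_sup:
  fixes f g :: "real \<Rightarrow> 'a::euclidean_space"
  assumes "f integrable_on {0..t}" "k integrable_on {0..t}" "0 \<le> t"
    "\<And>s. s \<in> {0..t} \<Longrightarrow> norm (f s) \<le> k s * e"
  shows "norm (integral {0..t} f) \<le> integral {0..t} k * e"
proof -
  have "norm (integral {0..t} f) \<le> integral {0..t} (\<lambda>s. k s * e)"
    using assms by (intro integral_norm_bound_integral integrable_on_mult_left) auto
  then show ?thesis by (simp add: integral_mult_left)
qed

text \<open>Picard iteration: successive differences are dominated by the terms of the exponential series of the primitive of $k$, so
the iterates converge uniformly on the whole interval.\<close>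

theorem caratheodory_existence:
  fixes f :: "real \<Rightarrow> 'a::euclidean_space \<Rightarrow> 'a"
  assumes T: "0 \<le> T" and k: "k absolutely_integrable_on {0..T}" and k0: "\<forall>t\<in>{0..T}. 0 \<le> k t"
    and lip: "\<And>t x y. t \<in> {0..T} \<Longrightarrow> norm (f t x - f t y) \<le> k t * norm (x - y)"
    and meas: "\<And>q. continuous_on {0..T} q \<Longrightarrow> (\<lambda>s. f s (q s)) absolutely_integrable_on {0..T}"
  obtains q where "continuous_on {0..T} q"
    "\<forall>t\<in>{0..T}. ((\<lambda>s. f s (q s)) has_integral (q t - x)) {0..t}"
proof -
  define q where "q n = ((\<lambda>p t. x + integral {0..t} (\<lambda>s. f s (p s))) ^^ n) (\<lambda>t. x)" for n
  have q0: "q 0 = (\<lambda>t. x)" and qS: "q (Suc n) = (\<lambda>t. x + integral {0..t} (\<lambda>s. f s (q n s)))" for n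
    by (simp_all add: q_def)
  have prim: "continuous_on {0..T} (\<lambda>t. x + integral {0..t} (\<lambda>s. f s (p s)))" if "continuous_on {0..T} p" for p
    using meas[OF that] by (intro continuous_intros indefinite_integral_continuous_1 abs_int_integrable)
  have cq: "continuous_on {0..T} (q n)" for n
    by (induction n) (simp_all add: q0 qS prim)
  have intf: "(\<lambda>s. f s (p s)) integrable_on {0..t}" if "continuous_on {0..T} p" "t \<in> {0..T}" for p t
    using abs_integrable_sub[OF meas[OF that(1)], of 0 t] that(2) by (auto intro: abs_int_integrable)
  define K where "K t = integral {0..t} k" for t
  have intk: "k integrable_on {0..t}" if "t \<in> {0..T}" for t
    using abs_integrable_sub[OF k, of 0 t] that by (auto intro: abs_int_integrable)
  have K0: "0 \<le> K t" if "t \<in> {0..T}" for t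
    unfolding K_def using intk[OF that] k0 that by (intro integral_nonneg) auto
  have Kmono: "K t \<le> K T" if "t \<in> {0..T}" for t
    unfolding K_def using intk k0 that by (intro integral_subset_le) auto
  have "compact ((\<lambda>t. q 1 t - q 0 t) ` {0..T})"
    by (intro compact_continuous_image continuous_intros cq) auto
  then obtain M where M: "\<And>t. t \<in> {0..T} \<Longrightarrow> norm (q 1 t - q 0 t) \<le> M"
    using compact_imp_bounded bounded_pos by (metis (no_types, lifting) imageI)
  have M0: "0 \<le> M" using order_trans[OF norm_ge_zero M[of 0]] T by simp
  have step: "norm (q (Suc n) t - q n t) \<le> M * (K t ^ n / fact n)" if "t \<in> {0..T}" for n t
    using that
  proof (induction n arbitrary: t)
    case 0
    then show ?case using M by simp
  next
    case (Suc n)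
    have pw: "((\<lambda>s. M * (k s * K s ^ n / fact n)) has_integral M * (K t ^ Suc n / fact (Suc n))) {0..t}"
    proof (rule has_integral_mult_right)
      have "((\<lambda>s. k s * K s ^ n) has_integral K t ^ Suc n / Suc n) {0..t}"
        unfolding K_def using Suc.prems abs_integrable_sub[OF k, of 0 t] by (intro primitive_power) auto
      from has_integral_mult_right[OF this, of "1 / fact n"]
      show "((\<lambda>s. k s * K s ^ n / fact n) has_integral K t ^ Suc n / fact (Suc n)) {0..t}"
        by (simp add: field_simps)
    qed
    have "q (Suc (Suc n)) t - q (Suc n) t = integral {0..t} (\<lambda>s. f s (q (Suc n) s) - f s (q n s))"
      unfolding fun_cong[OF qS[of "Suc n"], of t] fun_cong[OF qS[of n], of t]
      by (simp add: integral_diff[OF intf[OF cq Suc.prems] intf[OF cq Suc.prems]])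
    also have "norm \<dots> \<le> integral {0..t} (\<lambda>s. M * (k s * K s ^ n / fact n))"
    proof (rule integral_norm_bound_integral)
      show "(\<lambda>s. f s (q (Suc n) s) - f s (q n s)) integrable_on {0..t}"
        by (intro integrable_diff intf cq Suc.prems)
      show "(\<lambda>s. M * (k s * K s ^ n / fact n)) integrable_on {0..t}" using pw by blast
      fix s assume "s \<in> {0..t}"
      then have s: "s \<in> {0..T}" using Suc.prems by auto
      have "norm (f s (q (Suc n) s) - f s (q n s)) \<le> k s * norm (q (Suc n) s - q n s)"
        by (rule lip[OF s])
      also have "\<dots> \<le> k s * (M * (K s ^ n / fact n))"
        using Suc.IH[OF s] k0 s by (intro mult_left_mono) auto
      finally show "norm (f s (q (Suc n) s) - f s (q n s)) \<le> M * (k s * K s ^ n / fact n)"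
        by (simp add: mult_ac)
    qed
    also have "\<dots> = M * (K t ^ Suc n / fact (Suc n))" using pw by (rule integral_unique)
    finally show ?case .
  qed
  have summ: "summable (\<lambda>n. M * (K T ^ n / fact n))"
    using summable_exp[of "K T"] by (intro summable_mult) (simp add: divide_inverse mult.commute)
  define Q where "Q t = x + (\<Sum>n. q (Suc n) t - q n t)" for t
  have "uniform_limit {0..T} (\<lambda>n t. \<Sum>i<n. q (Suc i) t - q i t) (\<lambda>t. \<Sum>n. q (Suc n) t - q n t) sequentially"
  proof (rule Weierstrass_m_test[OF _ summ])
    fix n t assume t: "t \<in> {0..T}"
    have "M * (K t ^ n / fact n) \<le> M * (K T ^ n / fact n)"
      using K0 Kmono t M0 by (intro mult_left_mono divide_right_mono power_mono) auto
    then show "norm (q (Suc n) t - q n t) \<le> M * (K T ^ n / fact n)" using step[OF t, of n] by linarith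
  qed
  moreover have "(\<Sum>i<n. q (Suc i) t - q i t) = q n t - x" for n t
    using sum_lessThan_telescope[of "\<lambda>i. q i t" n] by (simp add: q0)
  ultimately have ul: "uniform_limit {0..T} q Q sequentially"
    unfolding uniform_limit_iff Q_def dist_norm by (simp add: algebra_simps)
  have cQ: "continuous_on {0..T} Q"
    by (rule uniform_limit_theorem[OF _ ul]) (use cq in auto)
  have "Q t = x + integral {0..t} (\<lambda>s. f s (Q s))" if t: "t \<in> {0..T}" for t
  proof -
    have "(\<lambda>n. q (Suc n) t) \<longlonglongrightarrow> Q t"
      using tendsto_uniform_limitI[OF ul t] by (rule LIMSEQ_Suc)
    moreover have "(\<lambda>n. q (Suc n) t) \<longlonglongrightarrow> x + integral {0..t} (\<lambda>s. f s (Q s))"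
    proof (rule LIMSEQ_I)
      fix e :: real assume "e > 0"
      have "\<forall>\<^sub>F n in sequentially. \<forall>s\<in>{0..T}. dist (q n s) (Q s) < e / (K T + 1)"
        using ul \<open>e > 0\<close> K0[of T] T unfolding uniform_limit_iff by (simp add: add_nonneg_pos)
      then obtain N where N: "\<And>n s. n \<ge> N \<Longrightarrow> s \<in> {0..T} \<Longrightarrow> dist (q n s) (Q s) < e / (K T + 1)"
        unfolding eventually_sequentially by blast
      have "norm (q (Suc n) t - (x + integral {0..t} (\<lambda>s. f s (Q s)))) < e" if "n \<ge> N" for n
      proof -
        have "q (Suc n) t - (x + integral {0..t} (\<lambda>s. f s (Q s))) = integral {0..t} (\<lambda>s. f s (q n s) - f s (Q s))"
          using intf[OF cq t] intf[OF cQ t] by (simp add: qS integral_diff)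
        also have "norm \<dots> \<le> integral {0..t} k * (e / (K T + 1))"
        proof (rule integral_norm_le_sup)
          show "(\<lambda>s. f s (q n s) - f s (Q s)) integrable_on {0..t}"
            by (intro integrable_diff intf cq cQ t)
          show "k integrable_on {0..t}" by (rule intk[OF t])
          show "0 \<le> t" using t by simp
          fix s assume "s \<in> {0..t}"
          then have s: "s \<in> {0..T}" using t by auto
          have "norm (f s (q n s) - f s (Q s)) \<le> k s * norm (q n s - Q s)" by (rule lip[OF s])
          also have "\<dots> \<le> k s * (e / (K T + 1))"
            using N[OF that s] k0 s by (intro mult_left_mono) (auto simp: dist_norm)
          finally show "norm (f s (q n s) - f s (Q s)) \<le> k s * (e / (K T + 1))" .
        qed
        also have "\<dots> \<le> K T * (e / (K T + 1))"
          using Kmono[OF t] K0[of T] T \<open>e > 0\<close> by (intro mult_right_mono) (auto simp: K_def)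
        also have "\<dots> < e" using K0[of T] T \<open>e > 0\<close> by (simp add: field_simps)
        finally show ?thesis .
      qed
      then show "\<exists>no. \<forall>n\<ge>no. norm (q (Suc n) t - (x + integral {0..t} (\<lambda>s. f s (Q s)))) < e" by blast
    qed
    ultimately show ?thesis by (rule LIMSEQ_unique)
  qed
  then have "\<forall>t\<in>{0..T}. ((\<lambda>s. f s (Q s)) has_integral (Q t - x)) {0..t}"
    using intf[OF cQ] by (metis add_diff_cancel_left' integrable_integral)
  with cQ show ?thesis by (rule that)
qed

section \<open>Square-integrable controls\<close>

text \<open>The Cauchy-Schwarz inequality, from $2 a b f g \le b^2 f^2 + a^2 g^2$ with $a$ and $b$ slightly larger than the two norms
(slightly, so that division by them is possible when a norm vanishes).\<close>

lemma integral_mult_le_sqrt: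
  fixes f g :: "real \<Rightarrow> real"
  assumes f: "(\<lambda>t. (f t)\<^sup>2) integrable_on S" and g: "(\<lambda>t. (g t)\<^sup>2) integrable_on S"
    and fg: "(\<lambda>t. f t * g t) integrable_on S"
  shows "integral S (\<lambda>t. f t * g t) \<le> sqrt (integral S (\<lambda>t. (f t)\<^sup>2)) * sqrt (integral S (\<lambda>t. (g t)\<^sup>2))"
proof -
  define A where "A = integral S (\<lambda>t. (f t)\<^sup>2)"
  define B where "B = integral S (\<lambda>t. (g t)\<^sup>2)"
  have A0: "A \<ge> 0" and B0: "B \<ge> 0"
    unfolding A_def B_def using f g by (auto intro: integral_nonneg)
  have le: "integral S (\<lambda>t. f t * g t) \<le> (sqrt A + e) * (sqrt B + e)" if "e > 0" for e
  proof -
    define a where "a = sqrt A + e"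
    define b where "b = sqrt B + e"
    have ab: "a > 0" "b > 0" using that A0 B0 by (auto simp: a_def b_def add_nonneg_pos)
    have "A \<le> a\<^sup>2" "B \<le> b\<^sup>2"
      unfolding a_def b_def using A0 B0 that
      by (metis abs_of_nonneg less_eq_real_def linorder_not_le real_le_lsqrt real_sqrt_ge_zero sqrt_le_D add_increasing2)+
    have "integral S (\<lambda>t. f t * g t) \<le> integral S (\<lambda>t. (b / (2 * a)) * (f t)\<^sup>2 + (a / (2 * b)) * (g t)\<^sup>2)"
    proof (rule integral_le[OF fg])
      show "(\<lambda>t. (b / (2 * a)) * (f t)\<^sup>2 + (a / (2 * b)) * (g t)\<^sup>2) integrable_on S"
        by (intro integrable_add integrable_on_mult_right f g)
      fix t
      have "0 \<le> (b * f t - a * g t)\<^sup>2 / (2 * a * b)" using ab by auto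
      also have "\<dots> = (b / (2 * a)) * (f t)\<^sup>2 + (a / (2 * b)) * (g t)\<^sup>2 - f t * g t"
        using ab by (simp add: field_simps power2_eq_square)
      finally show "f t * g t \<le> (b / (2 * a)) * (f t)\<^sup>2 + (a / (2 * b)) * (g t)\<^sup>2" by simp
    qed
    also have "\<dots> = (b / (2 * a)) * A + (a / (2 * b)) * B"
      unfolding A_def B_def
      by (subst integral_add) (use f g in \<open>auto simp del: times_divide_eq_left times_divide_eq_right
         intro: integrable_on_mult_right\<close>)
    also have "\<dots> \<le> (b / (2 * a)) * a\<^sup>2 + (a / (2 * b)) * b\<^sup>2"
      using \<open>A \<le> a\<^sup>2\<close> \<open>B \<le> b\<^sup>2\<close> ab by (intro add_mono mult_left_mono) auto
    also have "\<dots> = a * b" using ab by (simp add: power2_eq_square)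
    finally show ?thesis by (simp add: a_def b_def)
  qed
  have "((\<lambda>e. (sqrt A + e) * (sqrt B + e)) \<longlongrightarrow> (sqrt A + 0) * (sqrt B + 0)) (at_right 0)"
    by (intro tendsto_intros)
  then have "integral S (\<lambda>t. f t * g t) \<le> (sqrt A + 0) * (sqrt B + 0)"
    by (rule tendsto_lowerbound) (auto simp: eventually_at_filter le)
  then show ?thesis by (simp add: A_def B_def)
qed

lemma controlsD:
  assumes "v \<in> controls T"
  shows controls_meas: "v \<in> borel_measurable (lebesgue_on {0..T})"
    and controls_sq: "(\<lambda>t. (norm (v t))\<^sup>2) integrable_on {0..T}"
  using assms by (auto simp: controls_def)

lemma controlsI_bound:
  assumes "v \<in> borel_measurable (lebesgue_on {0..T})" "g integrable_on {0..T}"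
    "\<And>t. t \<in> {0..T} \<Longrightarrow> (norm (v t))\<^sup>2 \<le> g t"
  shows "v \<in> controls T"
proof -
  have "(\<lambda>t. (norm (v t))\<^sup>2) integrable_on {0..T}"
    by (rule measurable_bounded_by_integrable_imp_integrable[OF _ assms(2)]) (use assms in auto)
  with assms show ?thesis by (simp add: controls_def)
qed

lemma controls_bounded:
  assumes "v \<in> borel_measurable (lebesgue_on {0..T})" "\<And>t. t \<in> {0..T} \<Longrightarrow> norm (v t) \<le> c"
  shows "v \<in> controls T"
  by (rule controlsI_bound[OF assms(1), of "\<lambda>t. c\<^sup>2"]) (use assms(2) in \<open>auto intro: power_mono\<close>)

lemma controls_zero: "(\<lambda>t. 0) \<in> controls T"
  by (rule controls_bounded[where c=0]) auto

lemma controls_scaleR: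
  assumes "v \<in> controls T"
  shows "(\<lambda>t. c *\<^sub>R v t) \<in> controls T"
  by (rule controlsI_bound[where g="\<lambda>t. c\<^sup>2 * (norm (v t))\<^sup>2"])
     (use controlsD[OF assms] in \<open>auto simp: power_mult_distrib intro!: integrable_on_mult_right\<close>)

lemma controls_add:
  assumes "v \<in> controls T" "w \<in> controls T"
  shows "(\<lambda>t. v t + w t) \<in> controls T"
proof (rule controlsI_bound[where g="\<lambda>t. 2 * (norm (v t))\<^sup>2 + 2 * (norm (w t))\<^sup>2"])
  show "(\<lambda>t. v t + w t) \<in> borel_measurable (lebesgue_on {0..T})"
    using controls_meas[OF assms(1)] controls_meas[OF assms(2)] by measurable
  show "(\<lambda>t. 2 * (norm (v t))\<^sup>2 + 2 * (norm (w t))\<^sup>2) integrable_on {0..T}"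
    using controls_sq[OF assms(1)] controls_sq[OF assms(2)] by (intro integrable_add integrable_on_mult_right)
  fix t
  have "(norm (v t + w t))\<^sup>2 \<le> (norm (v t) + norm (w t))\<^sup>2"
    by (intro power_mono norm_triangle_ineq) auto
  also have "\<dots> \<le> 2 * (norm (v t))\<^sup>2 + 2 * (norm (w t))\<^sup>2"
    using sum_squares_bound[of "norm (v t)" "norm (w t)"] by (simp add: power2_sum)
  finally show "(norm (v t + w t))\<^sup>2 \<le> 2 * (norm (v t))\<^sup>2 + 2 * (norm (w t))\<^sup>2" .
qed

lemma controls_diff:
  assumes "v \<in> controls T" "w \<in> controls T"
  shows "(\<lambda>t. v t - w t) \<in> controls T"
  using controls_add[OF assms(1) controls_scaleR[OF assms(2), of "-1"]] by simp

lemma controls_sum: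
  assumes "finite I" "\<And>i. i \<in> I \<Longrightarrow> v i \<in> controls T"
  shows "(\<lambda>t. \<Sum>i\<in>I. v i t) \<in> controls T"
  using assms by (induction I rule: finite_induct) (auto intro: controls_add controls_zero)

lemma controls_abs_integrable:
  assumes "v \<in> controls T"
  shows "v absolutely_integrable_on {0..T}"
proof (rule measurable_bounded_by_integrable_imp_absolutely_integrable)
  show "(\<lambda>t. 1 + (norm (v t))\<^sup>2) integrable_on {0..T}"
    using controls_sq[OF assms] by (intro integrable_add) auto
  fix t
  show "norm (v t) \<le> 1 + (norm (v t))\<^sup>2"
    using zero_le_power2[of "norm (v t) - 1"] by (simp add: power2_diff) (smt (verit) norm_ge_zero)
qed (use controls_meas[OF assms] in auto)

lemma controls_norm_integrable:
  "v \<in> controls T \<Longrightarrow> (\<lambda>t. norm (v t)) integrable_on {0..T}"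
  using controls_abs_integrable abs_int_norm_integrable by blast

lemma controls_mult_abs_integrable:
  fixes v :: "real \<Rightarrow> real^'m" and w :: "real \<Rightarrow> real^'k"
  assumes "v \<in> controls T" "w \<in> controls T"
  shows "(\<lambda>t. norm (v t) * norm (w t)) absolutely_integrable_on {0..T}"
proof (rule measurable_bounded_by_integrable_imp_absolutely_integrable)
  show "(\<lambda>t. (norm (v t))\<^sup>2 + (norm (w t))\<^sup>2) integrable_on {0..T}"
    using controls_sq[OF assms(1)] controls_sq[OF assms(2)] by (rule integrable_add)
  show "(\<lambda>t. norm (v t) * norm (w t)) \<in> borel_measurable (lebesgue_on {0..T})"
    using controls_meas[OF assms(1)] controls_meas[OF assms(2)] by measurable
  fix t show "norm (norm (v t) * norm (w t)) \<le> (norm (v t))\<^sup>2 + (norm (w t))\<^sup>2"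
    using sum_squares_bound[of "norm (v t)" "norm (w t)"]
      mult_nonneg_nonneg[OF norm_ge_zero[of "v t"] norm_ge_zero[of "w t"]]
    unfolding real_norm_def abs_mult abs_norm_cancel mult.assoc by linarith
qed auto

lemma controls_inner_abs_integrable:
  assumes "v \<in> controls T" "w \<in> controls T"
  shows "(\<lambda>t. v t \<bullet> w t) absolutely_integrable_on {0..T}"
proof (rule measurable_bounded_by_integrable_imp_absolutely_integrable)
  show "(\<lambda>t. norm (v t) * norm (w t)) integrable_on {0..T}"
    using controls_mult_abs_integrable[OF assms] abs_int_integrable by blast
  show "(\<lambda>t. v t \<bullet> w t) \<in> borel_measurable (lebesgue_on {0..T})"
    using controls_meas[OF assms(1)] controls_meas[OF assms(2)] by measurable
qed (auto simp: Cauchy_Schwarz_ineq2)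

lemma L2_norm_nonneg: "v \<in> controls T \<Longrightarrow> 0 \<le> L2_norm T v"
  unfolding L2_norm_def by (simp add: integral_nonneg controls_sq)

lemma L2_norm_power2: "v \<in> controls T \<Longrightarrow> (L2_norm T v)\<^sup>2 = integral {0..T} (\<lambda>t. (norm (v t))\<^sup>2)"
  unfolding L2_norm_def by (subst real_sqrt_pow2) (auto intro: integral_nonneg controls_sq)

lemma integral_norm_mult_le:
  fixes v :: "real \<Rightarrow> real^'m" and w :: "real \<Rightarrow> real^'k"
  assumes "v \<in> controls T" "w \<in> controls T"
  shows "integral {0..T} (\<lambda>t. norm (v t) * norm (w t)) \<le> L2_norm T v * L2_norm T w"
  unfolding L2_norm_def
  by (intro integral_mult_le_sqrt controls_sq[OF assms(1)] controls_sq[OF assms(2)]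
      abs_int_integrable[OF controls_mult_abs_integrable[OF assms]])

lemma integral_norm_le_L2:
  assumes "v \<in> controls T" "0 \<le> T"
  shows "integral {0..T} (\<lambda>t. norm (v t)) \<le> sqrt T * L2_norm T v"
  using integral_mult_le_sqrt[of "\<lambda>_. 1" "{0..T}" "\<lambda>t. norm (v t)"]
    controls_sq[OF assms(1)] controls_norm_integrable[OF assms(1)] assms(2)
    integrable_continuous_real[OF continuous_on_const[of "{0..T}" "1::real"]]
  by (simp add: L2_norm_def)

lemma L2_norm_scaleR: "L2_norm T (\<lambda>t. c *\<^sub>R v t) = \<bar>c\<bar> * L2_norm T v"
  by (simp add: L2_norm_def power_mult_distrib real_sqrt_mult)

lemma L2_norm_triangle:
  assumes "v \<in> controls T" "w \<in> controls T"
  shows "L2_norm T (\<lambda>t. v t + w t) \<le> L2_norm T v + L2_norm T w"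
proof (rule power2_le_imp_le)
  note s = controls_sq[OF assms(1)] controls_sq[OF assms(2)]
    abs_int_integrable[OF controls_mult_abs_integrable[OF assms]]
  have "(L2_norm T (\<lambda>t. v t + w t))\<^sup>2 = integral {0..T} (\<lambda>t. (norm (v t + w t))\<^sup>2)"
    by (rule L2_norm_power2[OF controls_add[OF assms]])
  also have "\<dots> \<le> integral {0..T} (\<lambda>t. (norm (v t))\<^sup>2 + 2 * (norm (v t) * norm (w t)) + (norm (w t))\<^sup>2)"
  proof (rule integral_le)
    show "(\<lambda>t. (norm (v t + w t))\<^sup>2) integrable_on {0..T}"
      by (rule controls_sq[OF controls_add[OF assms]])
    show "(\<lambda>t. (norm (v t))\<^sup>2 + 2 * (norm (v t) * norm (w t)) + (norm (w t))\<^sup>2) integrable_on {0..T}"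
      by (intro integrable_add integrable_on_mult_right s)
    fix t
    have "(norm (v t + w t))\<^sup>2 \<le> (norm (v t) + norm (w t))\<^sup>2"
      by (intro power_mono norm_triangle_ineq) auto
    then show "(norm (v t + w t))\<^sup>2 \<le> (norm (v t))\<^sup>2 + 2 * (norm (v t) * norm (w t)) + (norm (w t))\<^sup>2"
      by (simp add: power2_sum)
  qed
  also have "\<dots> = (L2_norm T v)\<^sup>2 + 2 * integral {0..T} (\<lambda>t. norm (v t) * norm (w t)) + (L2_norm T w)\<^sup>2"
    using s by (simp add: L2_norm_power2[OF assms(1)] L2_norm_power2[OF assms(2)] integral_add integrable_add integrable_on_mult_right)
  also have "\<dots> \<le> (L2_norm T v + L2_norm T w)\<^sup>2"
    using integral_norm_mult_le[OF assms] by (simp add: power2_sum)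
  finally show "(L2_norm T (\<lambda>t. v t + w t))\<^sup>2 \<le> (L2_norm T v + L2_norm T w)\<^sup>2" .
  show "0 \<le> L2_norm T v + L2_norm T w" using assms by (simp add: L2_norm_nonneg)
qed

lemma L2_norm_minus_commute: "L2_norm T (\<lambda>t. v t - w t) = L2_norm T (\<lambda>t. w t - v t)"
  by (simp add: L2_norm_def norm_minus_commute)

lemma L2_norm_sum:
  assumes "finite I" "\<And>i. i \<in> I \<Longrightarrow> v i \<in> controls T"
  shows "L2_norm T (\<lambda>t. \<Sum>i\<in>I. v i t) \<le> (\<Sum>i\<in>I. L2_norm T (v i))"
  using assms
proof (induction I rule: finite_induct)
  case empty
  then show ?case by (simp add: L2_norm_def)
next
  case (insert i I)
  have "L2_norm T (\<lambda>t. v i t + (\<Sum>i\<in>I. v i t)) \<le> L2_norm T (v i) + L2_norm T (\<lambda>t. \<Sum>i\<in>I. v i t)"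
    using insert by (intro L2_norm_triangle controls_sum) auto
  with insert show ?case by auto
qed

lemma integral_eq_AE:
  fixes f g :: "real \<Rightarrow> 'a::euclidean_space"
  assumes "AE t in lebesgue_on S. f t = g t" "f absolutely_integrable_on S" "g absolutely_integrable_on S"
    "S \<in> sets lebesgue"
  shows "integral S f = integral S g"
proof -
  have i: "integrable (lebesgue_on S) f" "integrable (lebesgue_on S) g"
    using assms absolutely_integrable_imp_integrable by blast+
  have "integral\<^sup>L (lebesgue_on S) f = integral\<^sup>L (lebesgue_on S) g"
    using i assms(1) by (intro integral_cong_AE) auto
  then show ?thesis using lebesgue_integral_eq_integral i assms(4) by metis
qed

lemma controls_AE_cong_sq_zero:
  assumes "v \<in> controls T" "integral {0..T} (\<lambda>t. (norm (v t))\<^sup>2) = 0"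
  shows "AE t in lebesgue_on {0..T}. v t = 0"
proof -
  have a: "(\<lambda>t. (norm (v t))\<^sup>2) absolutely_integrable_on {0..T}"
    using controls_sq[OF assms(1)] by (intro nonnegative_absolutely_integrable_1) auto
  have i: "integrable (lebesgue_on {0..T}) (\<lambda>t. (norm (v t))\<^sup>2)"
    by (rule absolutely_integrable_imp_integrable[OF a]) auto
  have "integral\<^sup>L (lebesgue_on {0..T}) (\<lambda>t. (norm (v t))\<^sup>2) = 0"
    using lebesgue_integral_eq_integral[OF i] assms(2) by simp
  then have "AE t in lebesgue_on {0..T}. (norm (v t))\<^sup>2 = 0"
    using integral_nonneg_eq_0_iff_AE[OF i] by simp
  then show ?thesis by simp
qed

section \<open>Trajectories and their dependence on the control\<close>

lemma velocity_add: "velocity F (v + w) q = velocity F v q + velocity F w q"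
  by (simp add: velocity_def scaleR_add_left sum.distrib)

lemma velocity_diff: "velocity F (v - w) q = velocity F v q - velocity F w q"
  by (simp add: velocity_def scaleR_diff_left sum_subtractf)

lemma velocity_scaleR: "velocity F (c *\<^sub>R v) q = c *\<^sub>R velocity F v q"
  by (simp add: velocity_def scaleR_sum_right)

lemma linear_velocity: "linear (\<lambda>w. velocity F w q)"
  by (rule linearI) (auto simp: velocity_add velocity_scaleR)

lemma bounded_linear_velocity: "bounded_linear (\<lambda>w. velocity F w q)"
  using linear_velocity linear_conv_bounded_linear by blast

lemma norm_velocity_le: "norm (velocity F w q) \<le> norm w * (\<Sum>i\<in>UNIV. norm (F i q))"
proof -
  have "norm (velocity F w q) \<le> (\<Sum>i\<in>UNIV. norm (w $ i *\<^sub>R F i q))"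
    unfolding velocity_def by (rule norm_sum)
  also have "\<dots> \<le> (\<Sum>i\<in>UNIV. norm w * norm (F i q))"
    by (intro sum_mono) (auto intro: mult_right_mono component_le_norm_cart)
  finally show ?thesis by (simp add: sum_distrib_left)
qed

lemma norm_velocity_diff_le:
  "norm (velocity F w x - velocity F w y) \<le> norm w * (\<Sum>i\<in>UNIV. norm (F i x - F i y))"
proof -
  have "velocity F w x - velocity F w y = velocity (\<lambda>i q. F i x - F i y) w x"
    by (simp add: velocity_def scaleR_diff_right sum_subtractf)
  then show ?thesis using norm_velocity_le[of "\<lambda>i q. F i x - F i y" w x] by simp
qed

lemma velocity_abs_integrable:
  fixes F :: "'m::finite \<Rightarrow> real^'n \<Rightarrow> real^'n"
  assumes v: "v \<in> controls T" and q: "continuous_on {0..T} q" and F: "\<And>i. continuous_on UNIV (F i)"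
  shows "(\<lambda>s. velocity F (v s) (q s)) absolutely_integrable_on {0..T}"
  unfolding velocity_def
proof (rule absolutely_integrable_sum)
  fix i :: 'm
  have "(\<lambda>s. v s $ i) absolutely_integrable_on {0..T}"
    using absolutely_integrable_linear[OF controls_abs_integrable[OF v] bounded_linear_vec_nth[of i]]
    by (simp add: o_def)
  moreover have "continuous_on {0..T} (\<lambda>s. F i (q s))"
    using continuous_on_compose2[OF F q] by simp
  ultimately show "(\<lambda>s. v s $ i *\<^sub>R F i (q s)) absolutely_integrable_on {0..T}"
    by (intro abs_int_bilinear_continuous2[OF bounded_bilinear_scaleR])
qed simp

definition lipschitz_frame :: "('m::finite \<Rightarrow> real^'n \<Rightarrow> real^'n) \<Rightarrow> real \<Rightarrow> real \<Rightarrow> bool" where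
  "lipschitz_frame G K B \<longleftrightarrow> 0 \<le> K \<and> 0 \<le> B \<and> (\<forall>i. continuous_on UNIV (G i)) \<and>
     (\<forall>w x y. norm (velocity G w x - velocity G w y) \<le> K * norm w * norm (x - y)) \<and>
     (\<forall>w x. norm (velocity G w x) \<le> B * norm w)"

definition C1_frame :: "('m::finite \<Rightarrow> real^'n \<Rightarrow> real^'n) \<Rightarrow> ('m \<Rightarrow> real^'n \<Rightarrow> real^'n \<Rightarrow> real^'n) \<Rightarrow> bool" where
  "C1_frame F DF \<longleftrightarrow> (\<forall>i x. (F i has_derivative DF i x) (at x)) \<and>
     (\<forall>i h. continuous_on UNIV (\<lambda>x. DF i x h))"

lemma smooth_C1_frame:
  assumes "\<And>i. smooth (F i)"
  shows "C1_frame F (\<lambda>i x. frechet_derivative (F i) (at x))"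
proof -
  have "Ck (Suc 0) (F i)" for i using assms unfolding smooth_def by blast
  then show ?thesis
    unfolding C1_frame_def Ck.simps
    by (simp add: differentiable_on_def frechet_derivative_works)
qed

lemma C1_frameD:
  assumes "C1_frame F DF"
  shows C1_frame_deriv: "(F i has_derivative DF i x) (at x)"
    and C1_frame_deriv_cont: "continuous_on UNIV (\<lambda>x. DF i x h)"
    and C1_frame_cont: "continuous_on UNIV (F i)"
proof -
  show d: "(F i has_derivative DF i x) (at x)" for i x
    using assms unfolding C1_frame_def by blast
  show "continuous_on UNIV (\<lambda>x. DF i x h)"
    using assms unfolding C1_frame_def by blast
  show "continuous_on UNIV (F i)"
    by (rule has_derivative_continuous_on[of UNIV "F i" "DF i"]) (rule d)
qed

lemma linear_norm_le_Basis:
  fixes f :: "'a::euclidean_space \<Rightarrow> 'b::real_normed_vector"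
  assumes "linear f"
  shows "norm (f h) \<le> norm h * (\<Sum>b\<in>Basis. norm (f b))"
proof -
  have "f h = (\<Sum>b\<in>Basis. (h \<bullet> b) *\<^sub>R f b)"
    by (subst euclidean_representation[of h, symmetric]) (simp add: linear_sum[OF assms] linear_scale[OF assms])
  also have "norm \<dots> \<le> (\<Sum>b\<in>Basis. norm h * norm (f b))"
    by (rule sum_norm_le) (auto intro!: mult_right_mono simp: Basis_le_norm)
  finally show ?thesis by (simp add: sum_distrib_left)
qed

text \<open>On a compact convex set the derivative is bounded, so the mean value theorem applies.\<close>

lemma C1_lipschitz_on_compact:
  fixes f :: "'a::euclidean_space \<Rightarrow> 'b::real_normed_vector"
  assumes "\<And>x. (f has_derivative Df x) (at x)" "\<And>h. continuous_on UNIV (\<lambda>x. Df x h)"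
    and "compact S" "convex S"
  obtains L where "0 \<le> L" "\<And>x y. x \<in> S \<Longrightarrow> y \<in> S \<Longrightarrow> norm (f x - f y) \<le> L * norm (x - y)"
proof -
  have "continuous_on S (\<lambda>x. \<Sum>b\<in>Basis. norm (Df x b))"
    by (intro continuous_intros continuous_on_subset[OF assms(2)]) auto
  then have "compact ((\<lambda>x. \<Sum>b\<in>Basis. norm (Df x b)) ` S)" using assms(3) by (rule compact_continuous_image)
  then obtain L where L: "L > 0" "\<And>x. x \<in> S \<Longrightarrow> norm (\<Sum>b\<in>Basis. norm (Df x b)) \<le> L"
    by (auto dest!: compact_imp_bounded simp: bounded_pos)
  have on: "onorm (Df x) \<le> L" if "x \<in> S" for x
  proof (rule onorm_le)
    fix h
    have "norm (Df x h) \<le> norm h * (\<Sum>b\<in>Basis. norm (Df x b))"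
      by (rule linear_norm_le_Basis[OF has_derivative_linear[OF assms(1)]])
    also have "\<dots> \<le> norm h * L" using L(2)[OF that] by (intro mult_left_mono) auto
    finally show "norm (Df x h) \<le> L * norm h" by (simp add: mult.commute)
  qed
  show ?thesis
  proof (rule that[of L])
    show "norm (f x - f y) \<le> L * norm (x - y)" if "x \<in> S" "y \<in> S" for x y
      by (rule differentiable_bound[OF \<open>convex S\<close> has_derivative_at_withinI[OF assms(1)] on that])
  qed (use L in auto)
qed

text \<open>The fields are assumed smooth but neither bounded nor globally Lipschitz. Precomposing them with the nearest-point projection
onto a large ball, which is $1$-Lipschitz, makes them so without changing the trajectories that stay inside the ball.\<close>

definition cutoff :: "real \<Rightarrow> ('m \<Rightarrow> real^'n \<Rightarrow> real^'n) \<Rightarrow> 'm \<Rightarrow> real^'n \<Rightarrow> real^'n" where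
  "cutoff R F i x = F i (closest_point (cball 0 R) x)"

lemma cutoff_eq: "norm x \<le> R \<Longrightarrow> cutoff R F i x = F i x"
  by (simp add: cutoff_def closest_point_self)

lemma velocity_cutoff_eq: "norm x \<le> R \<Longrightarrow> velocity (cutoff R F) w x = velocity F w x"
  by (simp add: velocity_def cutoff_eq)

lemma cutoff_lipschitz_frame:
  fixes F :: "'m::finite \<Rightarrow> real^'n \<Rightarrow> real^'n"
  assumes C1: "C1_frame F DF" and R: "0 \<le> R"
  obtains K B where "lipschitz_frame (cutoff R F) K B"
proof -
  let ?S = "cball 0 R :: (real^'n) set" and ?\<pi> = "closest_point (cball 0 R) :: real^'n \<Rightarrow> real^'n"
  have ne: "?S \<noteq> {}" using R by auto
  have pi: "?\<pi> x \<in> ?S" for x using ne by (intro closest_point_in_set) auto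
  have pil: "norm (?\<pi> x - ?\<pi> y) \<le> norm (x - y)" for x y
    using closest_point_lipschitz[of ?S x y] ne by (auto simp: dist_norm)
  have pic: "continuous_on UNIV ?\<pi>" using ne by (intro continuous_on_closest_point) auto
  have "\<exists>L\<ge>0. \<forall>x\<in>?S. \<forall>y\<in>?S. norm (F i x - F i y) \<le> L * norm (x - y)" for i
  proof -
    obtain L where "0 \<le> L" "\<And>x y. x \<in> ?S \<Longrightarrow> y \<in> ?S \<Longrightarrow> norm (F i x - F i y) \<le> L * norm (x - y)"
      by (rule C1_lipschitz_on_compact[OF C1_frame_deriv[OF C1, of i] C1_frame_deriv_cont[OF C1, of i] compact_cball convex_cball, of 0 R])
         blast
    then show ?thesis by blast
  qed
  then obtain L where L: "\<And>i. 0 \<le> L i" "\<And>i x y. x \<in> ?S \<Longrightarrow> y \<in> ?S \<Longrightarrow> norm (F i x - F i y) \<le> L i * norm (x - y)"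
    by metis
  have "\<exists>B. \<forall>x\<in>?S. norm (F i x) \<le> B" for i
  proof -
    have "bounded (F i ` ?S)"
      by (intro compact_imp_bounded compact_continuous_image continuous_on_subset[OF C1_frame_cont[OF C1]]) auto
    then show ?thesis by (auto simp: bounded_iff)
  qed
  then obtain B where B: "\<And>i x. x \<in> ?S \<Longrightarrow> norm (F i x) \<le> B i" by metis
  have B0: "0 \<le> B i" for i using order_trans[OF norm_ge_zero B[of 0 i]] R by simp
  show ?thesis
  proof (rule that[of "\<Sum>i\<in>UNIV. L i" "\<Sum>i\<in>UNIV. B i"], unfold lipschitz_frame_def, intro conjI allI)
    show "0 \<le> (\<Sum>i\<in>UNIV. L i)" "0 \<le> (\<Sum>i\<in>UNIV. B i)" using L(1) B0 by (auto intro: sum_nonneg)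
    show "continuous_on UNIV (cutoff R F i)" for i
      unfolding cutoff_def using continuous_on_compose2[OF C1_frame_cont[OF C1] pic] by simp
    fix w :: "real^'m" and x y :: "real^'n"
    have "norm (velocity (cutoff R F) w x - velocity (cutoff R F) w y)
        \<le> norm w * (\<Sum>i\<in>UNIV. norm (cutoff R F i x - cutoff R F i y))" by (rule norm_velocity_diff_le)
    also have "\<dots> \<le> norm w * (\<Sum>i\<in>UNIV. L i * norm (x - y))"
    proof (intro mult_left_mono sum_mono)
      fix i
      have "norm (cutoff R F i x - cutoff R F i y) \<le> L i * norm (?\<pi> x - ?\<pi> y)"
        unfolding cutoff_def by (rule L(2)[OF pi pi])
      also have "\<dots> \<le> L i * norm (x - y)" by (intro mult_left_mono pil L)
      finally show "norm (cutoff R F i x - cutoff R F i y) \<le> L i * norm (x - y)" .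
    qed simp
    finally show "norm (velocity (cutoff R F) w x - velocity (cutoff R F) w y)
        \<le> (\<Sum>i\<in>UNIV. L i) * norm w * norm (x - y)"
      by (simp add: sum_distrib_right sum_distrib_left mult_ac)
    have "norm (velocity (cutoff R F) w x) \<le> norm w * (\<Sum>i\<in>UNIV. norm (cutoff R F i x))"
      by (rule norm_velocity_le)
    also have "\<dots> \<le> norm w * (\<Sum>i\<in>UNIV. B i)"
      unfolding cutoff_def by (intro mult_left_mono sum_mono B pi) simp
    finally show "norm (velocity (cutoff R F) w x) \<le> (\<Sum>i\<in>UNIV. B i) * norm w" by (simp add: mult.commute)
  qed
qed

lemma trajectory_start:
  assumes "trajectory F T x v q" "0 \<le> T"
  shows "q 0 = x"
proof -
  have "((\<lambda>s. velocity F (v s) (q s)) has_integral (q 0 - x)) {0}"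
    using bspec[OF assms(1)[unfolded trajectory_def], of 0] assms(2) by simp
  then have "q 0 - x = 0" by (rule has_integral_unique) (rule has_integral_refl(2))
  then show ?thesis by simp
qed

lemma trajectory_eq_integral:
  assumes "trajectory F T x v q" "t \<in> {0..T}"
  shows "q t = x + integral {0..t} (\<lambda>s. velocity F (v s) (q s))"
proof -
  have "((\<lambda>s. velocity F (v s) (q s)) has_integral (q t - x)) {0..t}"
    using assms unfolding trajectory_def by blast
  from integral_unique[OF this] show ?thesis by simp
qed

lemma trajectory_continuous: "trajectory F T x v q \<Longrightarrow> continuous_on {0..T} q"
  unfolding trajectory_def by (rule primitive_continuous)

lemma trajectory_bounded:
  assumes "trajectory F T x v q"
  obtains R where "0 \<le> R" "\<And>t. t \<in> {0..T} \<Longrightarrow> norm (q t) \<le> R"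
proof -
  have "bounded (q ` {0..T})"
    by (intro compact_imp_bounded compact_continuous_image trajectory_continuous[OF assms]) auto
  then show ?thesis using that unfolding bounded_pos by (metis imageI less_imp_le)
qed

lemma trajectory_cutoff:
  assumes "\<And>t. t \<in> {0..T} \<Longrightarrow> norm (q t) \<le> R"
  shows "trajectory (cutoff R F) T x v q \<longleftrightarrow> trajectory F T x v q"
  unfolding trajectory_def
proof (intro ball_cong refl has_integral_cong)
  fix t s assume "t \<in> {0..T}" "s \<in> {0..t}"
  then show "velocity (cutoff R F) (v s) (q s) = velocity F (v s) (q s)"
    using assms by (intro velocity_cutoff_eq) auto
qed

lemma lipschitz_frame_trajectory_exists:
  assumes G: "lipschitz_frame G K B" and v: "v \<in> controls T" and T: "0 \<le> T"
  obtains q where "trajectory G T x v q"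
proof -
  have k: "(\<lambda>t. K * norm (v t)) absolutely_integrable_on {0..T}"
    using controls_norm_integrable[OF v] G
    by (intro nonnegative_absolutely_integrable_1 integrable_on_mult_right) (auto simp: lipschitz_frame_def)
  obtain q where "\<forall>t\<in>{0..T}. ((\<lambda>s. velocity G (v s) (q s)) has_integral (q t - x)) {0..t}"
  proof (rule caratheodory_existence[OF T k, of "\<lambda>t. velocity G (v t)"])
    show "norm (velocity G (v t) x - velocity G (v t) y) \<le> K * norm (v t) * norm (x - y)" for t x y
      using G by (simp add: lipschitz_frame_def)
    show "(\<lambda>s. velocity G (v s) (q s)) absolutely_integrable_on {0..T}" if "continuous_on {0..T} q" for q
      using G by (intro velocity_abs_integrable v that) (simp add: lipschitz_frame_def)
  qed (use G in \<open>auto simp: lipschitz_frame_def\<close>)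
  then show ?thesis using that unfolding trajectory_def by blast
qed

text \<open>The bound only involves the integrals of $v - w$ against the fields along one of the two trajectories, not the integral of
$|v - w|$. It therefore gives Lipschitz dependence on the control in \<open>L\<^sup>1\<close>, and also continuity for weak
convergence of controls.\<close>

lemma trajectory_stability:
  assumes G: "lipschitz_frame G K B" and v: "v \<in> controls T" and w: "w \<in> controls T"
    and q: "trajectory G T x v q" and p: "trajectory G T x w p"
    and a: "\<And>t. t \<in> {0..T} \<Longrightarrow> norm (integral {0..t} (\<lambda>s. velocity G (v s - w s) (p s))) \<le> a"
    and t: "t \<in> {0..T}"
  shows "norm (q t - p t) \<le> a * exp (K * integral {0..T} (\<lambda>s. norm (v s)))"
proof -
  note cq = trajectory_continuous[OF q] and cp = trajectory_continuous[OF p]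
  have cG: "continuous_on UNIV (G i)" for i using G by (simp add: lipschitz_frame_def)
  have K0: "0 \<le> K" using G by (simp add: lipschitz_frame_def)
  have k: "(\<lambda>t. K * norm (v t)) absolutely_integrable_on {0..T}"
    using controls_norm_integrable[OF v] K0
    by (intro nonnegative_absolutely_integrable_1 integrable_on_mult_right) auto
  have a0: "0 \<le> a" using order_trans[OF norm_ge_zero a[OF t]] .
  have int: "(\<lambda>s. velocity G (c s) (y s)) integrable_on {0..t}"
    if "c \<in> controls T" "continuous_on {0..T} y" "t \<in> {0..T}" for c y t
    by (rule abs_int_integrable, rule abs_integrable_sub[OF velocity_abs_integrable[OF that(1,2) cG]])
      (use that in auto)
  have "norm (q t - p t) \<le> a * exp (integral {0..t} (\<lambda>t. K * norm (v t)))"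
  proof (rule gronwall_integral[OF k _ _ _ t])
    show "\<forall>t\<in>{0..T}. 0 \<le> K * norm (v t)" using K0 by simp
    show "continuous_on {0..T} (\<lambda>t. norm (q t - p t))" by (intro continuous_intros cq cp)
    show "\<forall>t\<in>{0..T}. norm (q t - p t) \<le> a + integral {0..t} (\<lambda>s. K * norm (v s) * norm (q s - p s))"
    proof
      fix t assume t: "t \<in> {0..T}"
      have "q t - p t = integral {0..t} (\<lambda>s. velocity G (v s) (q s)) - integral {0..t} (\<lambda>s. velocity G (w s) (p s))"
        using trajectory_eq_integral[OF q t] trajectory_eq_integral[OF p t] by simp
      also have "\<dots> = integral {0..t} (\<lambda>s. velocity G (v s) (q s) - velocity G (v s) (p s))
            + integral {0..t} (\<lambda>s. velocity G (v s - w s) (p s))"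
        unfolding velocity_diff
        using int[OF v cq t] int[OF v cp t] int[OF w cp t] by (simp add: integral_diff)
      also have "norm \<dots> \<le> norm (integral {0..t} (\<lambda>s. velocity G (v s) (q s) - velocity G (v s) (p s))) + a"
        by (rule order_trans[OF norm_triangle_ineq]) (use a[OF t] in simp)
      also have "norm (integral {0..t} (\<lambda>s. velocity G (v s) (q s) - velocity G (v s) (p s)))
          \<le> integral {0..t} (\<lambda>s. K * norm (v s) * norm (q s - p s))"
      proof (rule integral_norm_bound_integral)
        show "(\<lambda>s. velocity G (v s) (q s) - velocity G (v s) (p s)) integrable_on {0..t}"
          by (intro integrable_diff int v cq cp t)
        show "(\<lambda>s. K * norm (v s) * norm (q s - p s)) integrable_on {0..t}"
          by (rule abs_int_integrable, rule abs_integrable_sub[where T=T],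
              rule abs_int_bilinear_continuous2[OF bounded_bilinear_mult _ k])
            (use t in \<open>auto intro!: continuous_intros cq cp\<close>)
        show "norm (velocity G (v s) (q s) - velocity G (v s) (p s)) \<le> K * norm (v s) * norm (q s - p s)" for s
          using G by (simp add: lipschitz_frame_def)
      qed
      finally show "norm (q t - p t) \<le> a + integral {0..t} (\<lambda>s. K * norm (v s) * norm (q s - p s))" by simp
    qed
  qed
  also have "\<dots> \<le> a * exp (K * integral {0..T} (\<lambda>s. norm (v s)))"
  proof -
    have "integral {0..t} (\<lambda>s. norm (v s)) \<le> integral {0..T} (\<lambda>s. norm (v s))"
      using controls_norm_integrable[OF v] t
      by (intro integral_subset_le) (auto intro: integrable_on_subinterval)
    then have "integral {0..t} (\<lambda>t. K * norm (v t)) \<le> K * integral {0..T} (\<lambda>s. norm (v s))"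
      using K0 by (simp add: mult_left_mono)
    then show ?thesis using a0 by (intro mult_left_mono) auto
  qed
  finally show ?thesis .
qed

lemma norm_integral_velocity_le:
  assumes G: "lipschitz_frame G K B" and v: "v \<in> controls T" and p: "continuous_on {0..T} p" and t: "t \<in> {0..T}"
  shows "norm (integral {0..t} (\<lambda>s. velocity G (v s) (p s))) \<le> B * integral {0..T} (\<lambda>s. norm (v s))"
proof -
  have i: "(\<lambda>s. norm (v s)) integrable_on {0..t}"
    using controls_norm_integrable[OF v] t by (auto intro: integrable_on_subinterval)
  have "norm (integral {0..t} (\<lambda>s. velocity G (v s) (p s))) \<le> integral {0..t} (\<lambda>s. B * norm (v s))"
  proof (rule integral_norm_bound_integral)
    show "(\<lambda>s. velocity G (v s) (p s)) integrable_on {0..t}"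
      using G t by (intro abs_int_integrable abs_integrable_sub[OF velocity_abs_integrable[OF v p]])
         (auto simp: lipschitz_frame_def)
  qed (use i G in \<open>auto intro: integrable_on_mult_right simp: lipschitz_frame_def\<close>)
  also have "\<dots> = B * integral {0..t} (\<lambda>s. norm (v s))" by simp
  also have "\<dots> \<le> B * integral {0..T} (\<lambda>s. norm (v s))"
    using controls_norm_integrable[OF v] t G i
    by (intro mult_left_mono integral_subset_le) (auto simp: lipschitz_frame_def)
  finally show ?thesis .
qed

lemma trajectory_L1_lipschitz:
  assumes G: "lipschitz_frame G K B" and v: "v \<in> controls T" and w: "w \<in> controls T"
    and q: "trajectory G T x v q" and p: "trajectory G T x w p" and t: "t \<in> {0..T}"
  shows "norm (q t - p t) \<le> B * integral {0..T} (\<lambda>s. norm (v s - w s)) * exp (K * integral {0..T} (\<lambda>s. norm (v s)))"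
  by (rule trajectory_stability[OF G v w q p _ t])
     (rule norm_integral_velocity_le[OF G controls_diff[OF v w] trajectory_continuous[OF p]])

lemma integral_norm_diff_AE_zero:
  assumes "v \<in> controls T" "w \<in> controls T" "AE t in lebesgue_on {0..T}. v t = w t"
  shows "integral {0..T} (\<lambda>s. norm (v s - w s)) = 0"
proof -
  have "integral {0..T} (\<lambda>s. norm (v s - w s)) = integral {0..T} (\<lambda>s. 0::real)"
  proof (rule integral_eq_AE)
    show "AE t in lebesgue_on {0..T}. norm (v t - w t) = 0" using assms(3) by auto
    show "(\<lambda>s. norm (v s - w s)) absolutely_integrable_on {0..T}"
      using controls_abs_integrable[OF controls_diff[OF assms(1,2)]] by (rule absolutely_integrable_norm[unfolded o_def])
  qed auto
  then show ?thesis by simp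
qed

text \<open>Both trajectories are bounded, so they are trajectories of a common cut-off frame, for which the stability estimate
applies.\<close>

lemma trajectory_unique:
  fixes F :: "'m::finite \<Rightarrow> real^'n \<Rightarrow> real^'n"
  assumes C1: "C1_frame F DF" and v: "v \<in> controls T" and w: "w \<in> controls T"
    and ae: "AE t in lebesgue_on {0..T}. v t = w t"
    and q: "trajectory F T x v q" and p: "trajectory F T x w p" and t: "t \<in> {0..T}"
  shows "q t = p t"
proof -
  obtain R1 where R1: "0 \<le> R1" "\<And>t. t \<in> {0..T} \<Longrightarrow> norm (q t) \<le> R1" using trajectory_bounded[OF q] by blast
  obtain R2 where R2: "0 \<le> R2" "\<And>t. t \<in> {0..T} \<Longrightarrow> norm (p t) \<le> R2" using trajectory_bounded[OF p] by blast
  define R where "R = max R1 R2"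
  obtain K B where G: "lipschitz_frame (cutoff R F) K B"
    by (rule cutoff_lipschitz_frame[OF C1, of R]) (use R1(1) in \<open>auto simp: R_def\<close>)
  have "trajectory (cutoff R F) T x v q" "trajectory (cutoff R F) T x w p"
    using q p R1(2) R2(2) by (subst trajectory_cutoff; force simp: R_def)+
  from trajectory_L1_lipschitz[OF G v w this t] integral_norm_diff_AE_zero[OF v w ae]
  show ?thesis by simp
qed

lemma end_point_eq:
  assumes C1: "C1_frame F DF" and v: "v \<in> controls T" and q: "trajectory F T 0 v q" and T: "0 \<le> T"
  shows "end_point F T v = q T"
  unfolding end_point_def
proof (rule the_equality)
  show "\<exists>p. trajectory F T 0 v p \<and> p T = q T" using q by blast
  fix y assume "\<exists>p. trajectory F T 0 v p \<and> p T = y"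
  then show "y = q T" using trajectory_unique[OF C1 v v _ _ q, of _ T] T by auto
qed

section \<open>Uniform estimates near a reference trajectory\<close>

lemma has_integral_reflect_Icc:
  fixes f :: "real \<Rightarrow> 'a::euclidean_space"
  assumes "(f has_integral I) {a..b}"
  shows "((\<lambda>s. f (T - s)) has_integral I) {T - b..T - a}"
proof (cases "a \<le> b")
  case True
  have "((\<lambda>x. f ((-1) *\<^sub>R x + T)) has_integral I) ((\<lambda>x. T - x) ` {a..b})"
    using has_integral_affinity[of f I a b "-1" T] assms by simp
  moreover have "(\<lambda>x. T - x) ` {a..b} = {T - b..T - a}" by auto
  ultimately show ?thesis by (simp add: algebra_simps)
next
  case False
  then have "I = 0" using assms by simp
  then show ?thesis using False by simp
qed

lemma abs_integrable_reflect_Icc: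
  fixes f :: "real \<Rightarrow> 'a::euclidean_space"
  assumes "f absolutely_integrable_on {0..T}"
  shows "(\<lambda>s. f (T - s)) absolutely_integrable_on {0..T}"
proof -
  have "(\<lambda>s. f (T - s)) integrable_on {0..T}"
    using has_integral_reflect_Icc[OF integrable_integral[OF abs_int_integrable[OF assms]], of T]
    by auto
  moreover have "(\<lambda>s. norm (f (T - s))) integrable_on {0..T}"
    using has_integral_reflect_Icc[OF integrable_integral[OF abs_int_norm_integrable[OF assms]], of T]
    by auto
  ultimately show ?thesis by (simp add: absolutely_integrable_on_def)
qed

text \<open>The mean value theorem applied to \<open>w \<mapsto> f(w) - Df(z) w\<close>, whose derivative is uniformly small on a small ball around $z$ because
$Df$ is uniformly continuous on compact sets.\<close>

lemma C1_uniform_strict_derivative: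
  fixes f :: "'a::euclidean_space \<Rightarrow> 'b::real_normed_vector"
  assumes d: "\<And>x. (f has_derivative Df x) (at x)" and c: "\<And>h. continuous_on UNIV (\<lambda>x. Df x h)"
    and e: "e > 0"
  obtains \<rho> where "\<rho> > 0" "\<And>z x y. z \<in> cball 0 R \<Longrightarrow> x \<in> ball z \<rho> \<Longrightarrow> y \<in> ball z \<rho> \<Longrightarrow>
     norm (f x - f y - Df z (x - y)) \<le> e * norm (x - y)"
proof -
  define e' where "e' = e / DIM('a)"
  have e': "e' > 0" using e by (simp add: e'_def)
  let ?S = "cball 0 (R + 1) :: 'a set"
  have "\<exists>r>0. \<forall>x\<in>?S. \<forall>x'\<in>?S. dist x' x < r \<longrightarrow> norm (Df x' b - Df x b) < e'" for b
  proof -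
    have "uniformly_continuous_on ?S (\<lambda>x. Df x b)"
      by (intro compact_uniformly_continuous continuous_on_subset[OF c]) auto
    then show ?thesis using e' unfolding uniformly_continuous_on_def dist_norm[of "Df _ b"] by blast
  qed
  then obtain r where r: "\<And>b. r b > 0"
    "\<And>b x x'. x \<in> ?S \<Longrightarrow> x' \<in> ?S \<Longrightarrow> dist x' x < r b \<Longrightarrow> norm (Df x' b - Df x b) < e'"
    by metis
  define \<rho> where "\<rho> = min 1 (Min (r ` Basis))"
  have rho0: "\<rho> > 0" unfolding \<rho>_def using r(1) by (simp add: nonempty_Basis)
  have rho_le: "\<rho> \<le> 1" "\<And>b. b \<in> Basis \<Longrightarrow> \<rho> \<le> r b"
    by (auto simp: \<rho>_def min_le_iff_disj)
  have "norm (f x - f y - Df z (x - y)) \<le> e * norm (x - y)"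
    if z: "z \<in> cball 0 R" and xy: "x \<in> ball z \<rho>" "y \<in> ball z \<rho>" for z x y
  proof -
    have lin: "linear (Df w)" for w by (rule has_derivative_linear[OF d])
    have "norm ((f x - Df z x) - (f y - Df z y)) \<le> e * norm (x - y)"
    proof (rule differentiable_bound[of "ball z \<rho>" "\<lambda>w. f w - Df z w" "\<lambda>w h. Df w h - Df z h"])
      show "((\<lambda>w. f w - Df z w) has_derivative (\<lambda>h. Df w h - Df z h)) (at w within ball z \<rho>)" for w
        by (intro has_derivative_diff has_derivative_at_withinI[OF d] has_derivative_linear bounded_linear_imp_has_derivative
              has_derivative_bounded_linear[OF d])
      fix w assume w: "w \<in> ball z \<rho>"
      have wS: "w \<in> ?S"
        using w z rho_le(1) norm_triangle_ineq[of z "w - z"] by (auto simp: dist_norm norm_minus_commute)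
      have zS: "z \<in> ?S" using z by auto
      show "onorm (\<lambda>h. Df w h - Df z h) \<le> e"
      proof (rule onorm_le)
        fix h
        have "linear (\<lambda>h. Df w h - Df z h)" by (intro linear_compose_sub lin)
        then have "norm (Df w h - Df z h) \<le> norm h * (\<Sum>b\<in>Basis. norm (Df w b - Df z b))"
          by (rule linear_norm_le_Basis)
        also have "\<dots> \<le> norm h * (\<Sum>b\<in>(Basis::'a set). e')"
        proof (intro mult_left_mono sum_mono)
          fix b :: 'a assume "b \<in> Basis"
          then have "dist w z < r b" using w rho_le(2)[of b] by (simp add: dist_commute)
          then show "norm (Df w b - Df z b) \<le> e'" using r(2)[OF zS wS] by fastforce
        qed simp
        also have "\<dots> = e * norm h" by (simp add: e'_def)
        finally show "norm (Df w h - Df z h) \<le> e * norm h" .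
      qed
    qed (use xy in auto)
    moreover have "(f x - Df z x) - (f y - Df z y) = f x - f y - Df z (x - y)"
      by (simp add: linear_diff[OF lin])
    ultimately show ?thesis by simp
  qed
  with rho0 show ?thesis by (rule that)
qed

lemma frame_uniform_strict_derivative:
  fixes F :: "'m::finite \<Rightarrow> real^'n \<Rightarrow> real^'n"
  assumes C1: "C1_frame F DF" and e: "e > 0"
  obtains \<rho> where "\<rho> > 0" "\<And>w z x y. z \<in> cball 0 R \<Longrightarrow> x \<in> ball z \<rho> \<Longrightarrow> y \<in> ball z \<rho> \<Longrightarrow>
     norm (velocity F w x - velocity F w y - velocity (\<lambda>i a. DF i a (x - y)) w z) \<le> e * norm w * norm (x - y)"
proof -
  define e' where "e' = e / CARD('m)"
  have e': "e' > 0" using e by (simp add: e'_def)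
  have "\<exists>\<rho>>0. \<forall>z x y. z \<in> cball 0 R \<longrightarrow> x \<in> ball z \<rho> \<longrightarrow> y \<in> ball z \<rho> \<longrightarrow>
     norm (F i x - F i y - DF i z (x - y)) \<le> e' * norm (x - y)" for i
    by (rule C1_uniform_strict_derivative[of "F i" "DF i" e' R, OF C1_frame_deriv[OF C1] C1_frame_deriv_cont[OF C1] e']) blast
  then obtain r where r: "\<And>i. r i > 0"
    "\<And>i z x y. z \<in> cball 0 R \<Longrightarrow> x \<in> ball z (r i) \<Longrightarrow> y \<in> ball z (r i) \<Longrightarrow>
       norm (F i x - F i y - DF i z (x - y)) \<le> e' * norm (x - y)"
    by metis
  define \<rho> where "\<rho> = Min (range r)"
  have rho: "\<rho> > 0" "\<And>i. \<rho> \<le> r i" unfolding \<rho>_def using r(1) by (auto simp: Min_gr_iff)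
  show ?thesis
  proof (rule that[OF rho(1)])
    fix w :: "real^'m" and z x y :: "real^'n"
    assume z: "z \<in> cball 0 R" and x: "x \<in> ball z \<rho>" and y: "y \<in> ball z \<rho>"
    have "velocity F w x - velocity F w y - velocity (\<lambda>i a. DF i a (x - y)) w z
      = velocity (\<lambda>i a. F i x - F i y - DF i z (x - y)) w z"
      by (simp add: velocity_def scaleR_diff_right sum_subtractf)
    also have "norm \<dots> \<le> norm w * (\<Sum>i\<in>UNIV. norm (F i x - F i y - DF i z (x - y)))"
      by (rule norm_velocity_le)
    also have "\<dots> \<le> norm w * (\<Sum>i\<in>(UNIV::'m set). e' * norm (x - y))"
    proof (intro mult_left_mono sum_mono)
      fix i
      have "x \<in> ball z (r i)" "y \<in> ball z (r i)" using x y rho(2)[of i] by auto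
      then show "norm (F i x - F i y - DF i z (x - y)) \<le> e' * norm (x - y)" by (rule r(2)[OF z])
    qed simp
    also have "\<dots> = e * norm w * norm (x - y)" by (simp add: e'_def)
    finally show "norm (velocity F w x - velocity F w y - velocity (\<lambda>i a. DF i a (x - y)) w z) \<le> e * norm w * norm (x - y)" .
  qed
qed

text \<open>Controls close to $u$ in \<open>L\<^sup>2\<close> have trajectories on the whole interval: those of the cut-off frame exist, and by
stability they stay at distance at most $1$ from \<open>\<gamma>\<close>, hence in the ball where the cut-off has no effect.\<close>

lemma trajectories_near:
  fixes F :: "'m::finite \<Rightarrow> real^'n \<Rightarrow> real^'n"
  assumes C1: "C1_frame F DF" and u: "u \<in> controls T" and g: "trajectory F T 0 u \<gamma>" and T: "0 \<le> T"
  obtains C \<delta> R K where "0 \<le> C" "0 < \<delta>" "0 \<le> K" "\<And>t. t \<in> {0..T} \<Longrightarrow> norm (\<gamma> t) \<le> R"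
    "\<And>v. v \<in> controls T \<Longrightarrow> L2_norm T (\<lambda>t. v t - u t) < \<delta> \<Longrightarrow> \<exists>q. trajectory F T 0 v q"
    "\<And>v q t. v \<in> controls T \<Longrightarrow> L2_norm T (\<lambda>t. v t - u t) < \<delta> \<Longrightarrow> trajectory F T 0 v q \<Longrightarrow> t \<in> {0..T} \<Longrightarrow> norm (q t) \<le> R"
    "\<And>v w q p t. v \<in> controls T \<Longrightarrow> w \<in> controls T \<Longrightarrow>
       L2_norm T (\<lambda>t. v t - u t) < \<delta> \<Longrightarrow> L2_norm T (\<lambda>t. w t - u t) < \<delta> \<Longrightarrow>
       trajectory F T 0 v q \<Longrightarrow> trajectory F T 0 w p \<Longrightarrow> t \<in> {0..T} \<Longrightarrow>
       norm (q t - p t) \<le> C * L2_norm T (\<lambda>t. v t - w t)"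
    "\<And>w x y. norm x \<le> R \<Longrightarrow> norm y \<le> R \<Longrightarrow> norm (velocity F w x - velocity F w y) \<le> K * norm w * norm (x - y)"
proof -
  obtain R0 where R0: "0 \<le> R0" "\<And>t. t \<in> {0..T} \<Longrightarrow> norm (\<gamma> t) \<le> R0" using trajectory_bounded[OF g] by blast
  define R where "R = R0 + 1"
  define G where "G = cutoff R F"
  obtain K B where G: "lipschitz_frame G K B"
    unfolding G_def by (rule cutoff_lipschitz_frame[OF C1, of R]) (use R0(1) in \<open>auto simp: R_def\<close>)
  have K0: "0 \<le> K" and B0: "0 \<le> B" using G by (auto simp: lipschitz_frame_def)
  define C where "C = B * sqrt T * exp (K * (sqrt T * (L2_norm T u + 1)))"
  have C0: "0 \<le> C" using B0 T by (simp add: C_def)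
  \<comment> \<open>the bound 1 keeps the constant C uniform, the other one keeps the trajectories within 1 of the reference\<close>
  define \<delta> where "\<delta> = min 1 (1 / (C + 1))"
  have d0: "0 < \<delta>" using C0 by (simp add: \<delta>_def)
  have gG: "trajectory G T 0 u \<gamma>"
    unfolding G_def by (subst trajectory_cutoff) (use g R0 in \<open>force simp: R_def\<close>)+
  have lipG: "norm (q t - p t) \<le> C * L2_norm T (\<lambda>t. v t - w t)"
    if v: "v \<in> controls T" and w: "w \<in> controls T" and near: "L2_norm T (\<lambda>t. v t - u t) < \<delta>"
      and q: "trajectory G T 0 v q" and p: "trajectory G T 0 w p" and t: "t \<in> {0..T}" for v w q p t
  proof -
    have "L2_norm T v \<le> L2_norm T u + L2_norm T (\<lambda>t. v t - u t)"
      using L2_norm_triangle[OF u controls_diff[OF v u]] by simp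
    then have "L2_norm T v \<le> L2_norm T u + 1" using near by (simp add: \<delta>_def)
    then have "sqrt T * L2_norm T v \<le> sqrt T * (L2_norm T u + 1)" using T by (intro mult_left_mono) auto
    then have 1: "integral {0..T} (\<lambda>s. norm (v s)) \<le> sqrt T * (L2_norm T u + 1)"
      using integral_norm_le_L2[OF v T] by linarith
    have "norm (q t - p t) \<le> B * integral {0..T} (\<lambda>s. norm (v s - w s)) * exp (K * integral {0..T} (\<lambda>s. norm (v s)))"
      by (rule trajectory_L1_lipschitz[OF G v w q p t])
    also have "\<dots> \<le> B * (sqrt T * L2_norm T (\<lambda>t. v t - w t)) * exp (K * (sqrt T * (L2_norm T u + 1)))"
      using integral_norm_le_L2[OF controls_diff[OF v w] T] 1 K0 B0 T L2_norm_nonneg[OF controls_diff[OF v w]]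
      by (intro mult_mono mult_left_mono) (auto intro!: mult_left_mono)
    finally show ?thesis by (simp add: C_def mult_ac)
  qed
  have ex: "\<exists>q. trajectory F T 0 v q \<and> trajectory G T 0 v q \<and> (\<forall>t\<in>{0..T}. norm (q t) \<le> R)"
    if v: "v \<in> controls T" and near: "L2_norm T (\<lambda>t. v t - u t) < \<delta>" for v
  proof -
    obtain q where q: "trajectory G T 0 v q" using lipschitz_frame_trajectory_exists[OF G v T] by blast
    have bd: "norm (q t) \<le> R" if t: "t \<in> {0..T}" for t
    proof -
      have "norm (q t - \<gamma> t) \<le> C * L2_norm T (\<lambda>t. v t - u t)" by (rule lipG[OF v u near q gG t])
      also have "\<dots> \<le> C * (1 / (C + 1))" using near C0 by (intro mult_left_mono) (auto simp: \<delta>_def)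
      also have "\<dots> \<le> 1" using C0 by (simp add: field_simps)
      finally have "norm (q t - \<gamma> t) \<le> 1" .
      then show ?thesis using R0(2)[OF t] norm_triangle_ineq[of "q t - \<gamma> t" "\<gamma> t"] by (simp add: R_def)
    qed
    have "trajectory F T 0 v q" using q bd unfolding G_def by (subst (asm) trajectory_cutoff) auto
    then show ?thesis using q bd by blast
  qed
  have bd: "norm (q t) \<le> R"
    if v: "v \<in> controls T" and near: "L2_norm T (\<lambda>t. v t - u t) < \<delta>" and q: "trajectory F T 0 v q" and t: "t \<in> {0..T}" for v q t
  proof -
    obtain q' where "trajectory F T 0 v q'" "\<forall>t\<in>{0..T}. norm (q' t) \<le> R" using ex[OF v near] by blast
    then show ?thesis using trajectory_unique[OF C1 v v _ q, of q' t] t by auto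
  qed
  show ?thesis
  proof (rule that[OF C0 d0 K0, of R])
    show "norm (\<gamma> t) \<le> R" if "t \<in> {0..T}" for t using R0(2)[OF that] by (simp add: R_def)
    show "\<exists>q. trajectory F T 0 v q" if "v \<in> controls T" "L2_norm T (\<lambda>t. v t - u t) < \<delta>" for v
      using ex[OF that] by blast
    show "norm (q t) \<le> R" if "v \<in> controls T" "L2_norm T (\<lambda>t. v t - u t) < \<delta>" "trajectory F T 0 v q" "t \<in> {0..T}" for v q t
      by (rule bd[OF that])
    show "norm (q t - p t) \<le> C * L2_norm T (\<lambda>t. v t - w t)"
      if "v \<in> controls T" "w \<in> controls T" "L2_norm T (\<lambda>t. v t - u t) < \<delta>" "L2_norm T (\<lambda>t. w t - u t) < \<delta>"
       "trajectory F T 0 v q" "trajectory F T 0 w p" "t \<in> {0..T}" for v w q p t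
    proof (rule lipG[OF that(1,2,3) _ _ that(7)])
      show "trajectory G T 0 v q" unfolding G_def
        using bd[OF that(1,3,5)] that(5) by (subst trajectory_cutoff) auto
      show "trajectory G T 0 w p" unfolding G_def
        using bd[OF that(2,4,6)] that(6) by (subst trajectory_cutoff) auto
    qed
    show "norm (velocity F w x - velocity F w y) \<le> K * norm w * norm (x - y)" if "norm x \<le> R" "norm y \<le> R" for w x y
      using G velocity_cutoff_eq[OF that(1), of F w] velocity_cutoff_eq[OF that(2), of F w]
      unfolding lipschitz_frame_def G_def by metis
  qed
qed

section \<open>The adjoint equation\<close>

text \<open>The transpose of the linear map $h \mapsto \sum_i w_i DF_i(z) h$, applied to $p$.\<close>

definition adjoint_velocity ::
  "('m::finite \<Rightarrow> real^'n \<Rightarrow> real^'n \<Rightarrow> real^'n) \<Rightarrow> real^'m \<Rightarrow> real^'n \<Rightarrow> real^'n \<Rightarrow> real^'n" where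
  "adjoint_velocity DF w z p = (\<Sum>b\<in>Basis. (p \<bullet> velocity (\<lambda>i a. DF i a b) w z) *\<^sub>R b)"

definition adjoint_curve ::
  "('m::finite \<Rightarrow> real^'n \<Rightarrow> real^'n \<Rightarrow> real^'n) \<Rightarrow> real \<Rightarrow> (real \<Rightarrow> real^'m) \<Rightarrow> (real \<Rightarrow> real^'n)
     \<Rightarrow> (real \<Rightarrow> real^'n) \<Rightarrow> bool" where
  "adjoint_curve DF T u \<gamma> p \<longleftrightarrow>
     (\<forall>t\<in>{0..T}. ((\<lambda>s. - adjoint_velocity DF (u s) (\<gamma> s) (p s)) has_integral (p t - p 0)) {0..t})"

lemma velocity_deriv_linear:
  assumes "\<And>i. linear (DF i z)"
  shows "linear (\<lambda>h. velocity (\<lambda>i a. DF i a h) w z)"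
  unfolding velocity_def
  by (rule linearI) (simp_all add: linear_add[OF assms] linear_scale[OF assms] scaleR_add_right sum.distrib scaleR_sum_right mult.commute)

lemma adjoint_velocity_inner:
  assumes "\<And>i. linear (DF i z)"
  shows "adjoint_velocity DF w z p \<bullet> h = p \<bullet> velocity (\<lambda>i a. DF i a h) w z"
proof -
  let ?V = "\<lambda>h. velocity (\<lambda>i a. DF i a h) w z"
  have lin: "linear ?V" by (rule velocity_deriv_linear[of DF z w]) (rule assms)
  have "?V h = (\<Sum>b\<in>Basis. (h \<bullet> b) *\<^sub>R ?V b)"
    by (subst euclidean_representation[of h, symmetric]) (simp only: linear_sum[OF lin] linear_scale[OF lin])
  then show ?thesis
    by (simp add: adjoint_velocity_def inner_sum_left inner_sum_right inner_commute[of _ h] mult.commute)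
qed

lemma adjoint_velocity_linear: "linear (adjoint_velocity DF w z)"
  unfolding adjoint_velocity_def
  by (rule linearI) (simp_all add: inner_add_left scaleR_add_left sum.distrib scaleR_sum_right)

lemma norm_adjoint_velocity_le:
  fixes DF :: "'m::finite \<Rightarrow> real^'n \<Rightarrow> real^'n \<Rightarrow> real^'n"
  shows
  "norm (adjoint_velocity DF w z p) \<le> norm w * (\<Sum>b\<in>Basis. \<Sum>i\<in>UNIV. norm (DF i z b)) * norm p"
proof -
  have "norm (adjoint_velocity DF w z p) \<le> (\<Sum>b\<in>Basis. norm p * (norm w * (\<Sum>i\<in>UNIV. norm (DF i z b))))"
    unfolding adjoint_velocity_def
  proof (rule sum_norm_le)
    fix b :: "real^'n" assume "b \<in> Basis"
    then have "norm ((p \<bullet> velocity (\<lambda>i a. DF i a b) w z) *\<^sub>R b) \<le> norm p * norm (velocity (\<lambda>i a. DF i a b) w z)"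
      by (simp add: Cauchy_Schwarz_ineq2)
    also have "\<dots> \<le> norm p * (norm w * (\<Sum>i\<in>UNIV. norm (DF i z b)))"
      by (intro mult_left_mono norm_velocity_le) simp
    finally show "norm ((p \<bullet> velocity (\<lambda>i a. DF i a b) w z) *\<^sub>R b) \<le> norm p * (norm w * (\<Sum>i\<in>UNIV. norm (DF i z b)))" .
  qed
  then show ?thesis by (simp add: sum_distrib_left sum_distrib_right mult_ac)
qed

lemma adjoint_velocity_abs_integrable:
  fixes F :: "'m::finite \<Rightarrow> real^'n \<Rightarrow> real^'n" and T :: real
  assumes C1: "C1_frame F DF" and u: "u \<in> controls T" and g: "continuous_on {0..T} \<gamma>" and p: "continuous_on {0..T} p"
  shows "(\<lambda>s. adjoint_velocity DF (u s) (\<gamma> s) (p s)) absolutely_integrable_on {0..T}"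
  unfolding adjoint_velocity_def
proof (rule absolutely_integrable_sum)
  fix b :: "real^'n"
  have "(\<lambda>s. velocity (\<lambda>i a. DF i a b) (u s) (\<gamma> s)) absolutely_integrable_on {0..T}"
    by (rule velocity_abs_integrable[OF u g C1_frame_deriv_cont[OF C1]])
  then have "(\<lambda>s. p s \<bullet> velocity (\<lambda>i a. DF i a b) (u s) (\<gamma> s)) absolutely_integrable_on {0..T}"
    by (rule abs_int_bilinear_continuous[OF bounded_bilinear_inner p])
  then show "(\<lambda>s. (p s \<bullet> velocity (\<lambda>i a. DF i a b) (u s) (\<gamma> s)) *\<^sub>R b) absolutely_integrable_on {0..T}"
    by (rule absolutely_integrable_scaleR_right)
qed simp

lemma adjoint_velocity_bound_along:
  fixes F :: "'m::finite \<Rightarrow> real^'n \<Rightarrow> real^'n" and T :: real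
  assumes C1: "C1_frame F DF" and g: "continuous_on {0..T} \<gamma>"
  obtains M where "0 \<le> M" "\<And>t w p. t \<in> {0..T} \<Longrightarrow> norm (adjoint_velocity DF w (\<gamma> t) p) \<le> M * norm w * norm p"
proof -
  have "continuous_on {0..T} (\<lambda>t. \<Sum>b\<in>Basis. \<Sum>i\<in>UNIV. norm (DF i (\<gamma> t) b))"
    by (intro continuous_intros continuous_on_compose2[OF C1_frame_deriv_cont[OF C1] g]) auto
  then have "bounded ((\<lambda>t. \<Sum>b\<in>Basis. \<Sum>i\<in>UNIV. norm (DF i (\<gamma> t) b)) ` {0..T})"
    by (intro compact_imp_bounded compact_continuous_image) auto
  then obtain M where M: "M > 0" "\<And>t. t \<in> {0..T} \<Longrightarrow> (\<Sum>b\<in>Basis. \<Sum>i\<in>UNIV. norm (DF i (\<gamma> t) b)) \<le> M"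
    unfolding bounded_pos by (auto simp: abs_le_iff)
  show ?thesis
  proof (rule that[of M])
    fix t w and p :: "real^'n" assume t: "t \<in> {0..T}"
    have "norm (adjoint_velocity DF w (\<gamma> t) p) \<le> norm w * (\<Sum>b\<in>Basis. \<Sum>i\<in>UNIV. norm (DF i (\<gamma> t) b)) * norm p"
      by (rule norm_adjoint_velocity_le)
    also have "\<dots> \<le> norm w * M * norm p" using M(2)[OF t] by (intro mult_left_mono mult_right_mono) auto
    finally show "norm (adjoint_velocity DF w (\<gamma> t) p) \<le> M * norm w * norm p" by (simp add: mult_ac)
  qed (use M in auto)
qed

text \<open>Reversing time turns the terminal condition into an initial one.\<close>

lemma adjoint_curve_exists:
  fixes F :: "'m::finite \<Rightarrow> real^'n \<Rightarrow> real^'n" and T :: real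
  assumes C1: "C1_frame F DF" and u: "u \<in> controls T" and g: "continuous_on {0..T} \<gamma>" and T: "0 \<le> T"
  obtains p where "adjoint_curve DF T u \<gamma> p" "p T = a"
proof -
  obtain M where M: "0 \<le> M" "\<And>t w p. t \<in> {0..T} \<Longrightarrow> norm (adjoint_velocity DF w (\<gamma> t) p) \<le> M * norm w * norm p"
    using adjoint_velocity_bound_along[OF C1 g] by blast
  let ?f = "\<lambda>s y. adjoint_velocity DF (u (T - s)) (\<gamma> (T - s)) y"
  have k: "(\<lambda>t. M * norm (u (T - t))) absolutely_integrable_on {0..T}"
  proof (rule abs_integrable_reflect_Icc)
    show "(\<lambda>t. M * norm (u t)) absolutely_integrable_on {0..T}"
      using controls_norm_integrable[OF u] M
      by (intro nonnegative_absolutely_integrable_1 integrable_on_mult_right) auto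
  qed
  obtain q where q: "continuous_on {0..T} q" "\<forall>t\<in>{0..T}. ((\<lambda>s. ?f s (q s)) has_integral (q t - a)) {0..t}"
  proof (rule caratheodory_existence[OF T k, of ?f])
    fix t x y assume "t \<in> {0..T}"
    then have "T - t \<in> {0..T}" by auto
    then show "norm (?f t x - ?f t y) \<le> M * norm (u (T - t)) * norm (x - y)"
      using M(2) by (simp add: linear_diff[OF adjoint_velocity_linear, symmetric])
  next
    fix q :: "real \<Rightarrow> real^'n" assume q: "continuous_on {0..T} q"
    have "continuous_on {0..T} (\<lambda>s. q (T - s))"
      by (intro continuous_on_compose2[OF q] continuous_intros) auto
    from abs_integrable_reflect_Icc[OF adjoint_velocity_abs_integrable[OF C1 u g this]]
    show "(\<lambda>s. ?f s (q s)) absolutely_integrable_on {0..T}" by simp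
  qed (use M in auto)
  define p where "p t = q (T - t)" for t
  have "((\<lambda>s. ?f s (q s)) has_integral (q 0 - a)) {0}" using bspec[OF q(2), of 0] T by simp
  then have q0: "q 0 = a" using has_integral_unique[OF _ has_integral_refl(2)] by fastforce
  have "adjoint_curve DF T u \<gamma> p"
    unfolding adjoint_curve_def
  proof
    fix t assume t: "t \<in> {0..T}"
    have i: "((\<lambda>s. ?f s (q s)) has_integral (q T - q (T - t))) {T - t..T}"
    proof -
      have I: "(\<lambda>s. ?f s (q s)) integrable_on {0..T}" using q(2) T by auto
      have "integral {T - t..T} (\<lambda>s. ?f s (q s)) = q T - q (T - t)"
        using integral_diff_Icc[OF I, of "T - t" T] integral_unique[OF bspec[OF q(2), of T]]
          integral_unique[OF bspec[OF q(2), of "T - t"]] t by auto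
      then show ?thesis
        using integrable_integral[OF integrable_on_subinterval[OF I, of "T - t" T]] t by auto
    qed
    have "((\<lambda>s. ?f (T - s) (q (T - s))) has_integral (q T - q (T - t))) {0..t}"
      using has_integral_reflect_Icc[OF i, of T] by simp
    from has_integral_neg[OF this]
    show "((\<lambda>s. - adjoint_velocity DF (u s) (\<gamma> s) (p s)) has_integral (p t - p 0)) {0..t}"
      by (simp add: p_def)
  qed
  moreover have "p T = a" by (simp add: p_def q0)
  ultimately show ?thesis by (rule that)
qed

lemma adjoint_curve_continuous: "adjoint_curve DF T u \<gamma> p \<Longrightarrow> continuous_on {0..T} p"
  unfolding adjoint_curve_def by (rule primitive_continuous)

lemma adjoint_curve_sum:
  assumes "finite I" "\<And>b. b \<in> I \<Longrightarrow> adjoint_curve DF T u \<gamma> (P b)"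
  shows "adjoint_curve DF T u \<gamma> (\<lambda>t. \<Sum>b\<in>I. c b *\<^sub>R P b t)"
  unfolding adjoint_curve_def
proof
  fix t assume t: "t \<in> {0..T}"
  have "((\<lambda>s. \<Sum>b\<in>I. c b *\<^sub>R (- adjoint_velocity DF (u s) (\<gamma> s) (P b s))) has_integral (\<Sum>b\<in>I. c b *\<^sub>R (P b t - P b 0))) {0..t}"
    using assms t unfolding adjoint_curve_def by (intro has_integral_sum has_integral_cmul) auto
  then show "((\<lambda>s. - adjoint_velocity DF (u s) (\<gamma> s) (\<Sum>b\<in>I. c b *\<^sub>R P b s)) has_integral
        ((\<Sum>b\<in>I. c b *\<^sub>R P b t) - (\<Sum>b\<in>I. c b *\<^sub>R P b 0))) {0..t}"
    by (simp add: linear_sum[OF adjoint_velocity_linear] linear_scale[OF adjoint_velocity_linear]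
        sum_negf scaleR_diff_right sum_subtractf)
qed

text \<open>The adjoint equation is linear: a solution that vanishes at $t_0$ vanishes at all later times by Gronwall's inequality.\<close>

lemma adjoint_curve_nonzero:
  fixes F :: "'m::finite \<Rightarrow> real^'n \<Rightarrow> real^'n" and T :: real
  assumes C1: "C1_frame F DF" and u: "u \<in> controls T" and g: "continuous_on {0..T} \<gamma>"
    and p: "adjoint_curve DF T u \<gamma> p" and nz: "p T \<noteq> 0" and t0: "t0 \<in> {0..T}"
  shows "p t0 \<noteq> 0"
proof
  assume z: "p t0 = 0"
  obtain M where M: "0 \<le> M" "\<And>t w p. t \<in> {0..T} \<Longrightarrow> norm (adjoint_velocity DF w (\<gamma> t) p) \<le> M * norm w * norm p"
    using adjoint_velocity_bound_along[OF C1 g] by blast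
  note cp = adjoint_curve_continuous[OF p]
  let ?A = "\<lambda>s. - adjoint_velocity DF (u s) (\<gamma> s) (p s)"
  have k: "(\<lambda>t. M * norm (u t)) absolutely_integrable_on {0..T}"
    using controls_norm_integrable[OF u] M
    by (intro nonnegative_absolutely_integrable_1 integrable_on_mult_right) auto
  have A: "?A integrable_on {0..T}" using p t0 unfolding adjoint_curve_def by force
  \<comment> \<open>freezing p before t0 gives a continuous function on all of [0, T] that starts at 0\<close>
  define \<phi> where "\<phi> t = norm (p (max t t0))" for t
  have c\<phi>: "continuous_on {0..T} \<phi>"
    unfolding \<phi>_def using t0 by (intro continuous_intros continuous_on_compose2[OF cp]) auto
  have int\<phi>: "(\<lambda>s. M * norm (u s) * \<phi> s) integrable_on {0..T}"
    by (rule abs_int_integrable, rule abs_int_bilinear_continuous2[OF bounded_bilinear_mult c\<phi> k])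
  have "\<phi> T \<le> 0 * exp (integral {0..T} (\<lambda>t. M * norm (u t)))"
  proof (rule gronwall_integral[OF k _ c\<phi>])
    show "\<forall>t\<in>{0..T}. \<phi> t \<le> 0 + integral {0..t} (\<lambda>s. M * norm (u s) * \<phi> s)"
    proof
      fix t assume t: "t \<in> {0..T}"
      have int\<phi>t: "(\<lambda>s. M * norm (u s) * \<phi> s) integrable_on {0..t}"
        using integrable_on_subinterval[OF int\<phi>, of 0 t] t by auto
      show "\<phi> t \<le> 0 + integral {0..t} (\<lambda>s. M * norm (u s) * \<phi> s)"
      proof (cases "t \<le> t0")
        case True
        then have "\<phi> t = 0" using z by (simp add: \<phi>_def max_def)
        moreover have "0 \<le> integral {0..t} (\<lambda>s. M * norm (u s) * \<phi> s)"
          using M(1) by (intro integral_nonneg int\<phi>t) (auto simp: \<phi>_def)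
        ultimately show ?thesis by simp
      next
        case False
        have "p t - p t0 = integral {t0..t} ?A"
          using integral_diff_Icc[OF A, of t0 t] t t0 False p integral_unique
          unfolding adjoint_curve_def by (smt (verit) atLeastAtMost_iff diff_add_cancel diff_diff_eq2)
        then have "\<phi> t = norm (integral {t0..t} ?A)" using z False by (simp add: \<phi>_def max_def)
        also have "\<dots> \<le> integral {t0..t} (\<lambda>s. M * norm (u s) * \<phi> s)"
        proof (rule integral_norm_bound_integral)
          show "?A integrable_on {t0..t}" using integrable_on_subinterval[OF A, of t0 t] t t0 by auto
          show "(\<lambda>s. M * norm (u s) * \<phi> s) integrable_on {t0..t}"
            using integrable_on_subinterval[OF int\<phi>, of t0 t] t t0 by auto
          fix s assume s: "s \<in> {t0..t}"
          then have "\<phi> s = norm (p s)" by (simp add: \<phi>_def max_absorb1)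
          then show "norm (?A s) \<le> M * norm (u s) * \<phi> s" using M(2)[of s "u s" "p s"] s t t0 by auto
        qed
        also have "\<dots> \<le> integral {0..t} (\<lambda>s. M * norm (u s) * \<phi> s)"
        proof (rule integral_subset_le)
          show "(\<lambda>s. M * norm (u s) * \<phi> s) integrable_on {t0..t}"
            using integrable_on_subinterval[OF int\<phi>, of t0 t] t t0 by auto
        qed (use t0 int\<phi>t M(1) in \<open>auto simp: \<phi>_def\<close>)
        finally show ?thesis by simp
      qed
    qed
  qed (use M t0 in auto)
  then have "norm (p T) \<le> 0" using t0 by (simp add: \<phi>_def max_def split: if_splits)
  with nz show False by simp
qed

lemma inner_velocity_abs_integrable:
  fixes F :: "'m::finite \<Rightarrow> real^'n \<Rightarrow> real^'n" and T :: real
  assumes C1: "C1_frame F DF" and h: "h \<in> controls T" and g: "continuous_on {0..T} \<gamma>" and p: "continuous_on {0..T} p"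
  shows "(\<lambda>s. p s \<bullet> velocity F (h s) (\<gamma> s)) absolutely_integrable_on {0..T}"
  by (rule abs_int_bilinear_continuous[OF bounded_bilinear_inner p velocity_abs_integrable[OF h g C1_frame_cont[OF C1]]])

text \<open>With $d = q - y$, the product rule for $p \bullet d$ yields
\<open>p(T) \<bullet> d(T) = \<integral> p \<bullet> (velocity v q - velocity w y - A d)\<close> where $A$ is the linearization along \<open>\<gamma>\<close>. Up to the
main term \<open>velocity (v - w) \<gamma>\<close>, the integrand splits into three parts, each of which is small with respect to
$\|v - w\|$: the fields at $q$ and at \<open>\<gamma>\<close> differ little, $w$ differs little from $u$, and the fields are strictly
differentiable along \<open>\<gamma>\<close>.\<close>

lemma adjoint_strict_derivative:
  fixes F :: "'m::finite \<Rightarrow> real^'n \<Rightarrow> real^'n"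
  assumes C1: "C1_frame F DF" and u: "u \<in> controls T" and g: "trajectory F T 0 u \<gamma>" and T: "0 \<le> T"
    and p: "adjoint_curve DF T u \<gamma> p" and e: "e > 0"
  shows "\<exists>\<delta>. 0 < \<delta> \<and>
      (\<forall>v. v \<in> controls T \<longrightarrow> L2_norm T (\<lambda>t. v t - u t) < \<delta> \<longrightarrow> (\<exists>q. trajectory F T 0 v q)) \<and>
      (\<forall>v w q y. v \<in> controls T \<longrightarrow> w \<in> controls T \<longrightarrow>
       L2_norm T (\<lambda>t. v t - u t) < \<delta> \<longrightarrow> L2_norm T (\<lambda>t. w t - u t) < \<delta> \<longrightarrow>
       trajectory F T 0 v q \<longrightarrow> trajectory F T 0 w y \<longrightarrow>
       \<bar>p T \<bullet> (q T - y T) - integral {0..T} (\<lambda>s. p s \<bullet> velocity F (v s - w s) (\<gamma> s))\<bar>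
         \<le> e * L2_norm T (\<lambda>t. v t - w t))"
proof -
  note cg = trajectory_continuous[OF g] and cp = adjoint_curve_continuous[OF p]
  obtain C \<delta>1 R K where C0: "0 \<le> C" and d1: "0 < \<delta>1" and K0: "0 \<le> K" and gR: "\<And>t. t \<in> {0..T} \<Longrightarrow> norm (\<gamma> t) \<le> R"
    and ex: "\<And>v. v \<in> controls T \<Longrightarrow> L2_norm T (\<lambda>t. v t - u t) < \<delta>1 \<Longrightarrow> \<exists>q. trajectory F T 0 v q"
    and bd: "\<And>v q t. v \<in> controls T \<Longrightarrow> L2_norm T (\<lambda>t. v t - u t) < \<delta>1 \<Longrightarrow> trajectory F T 0 v q \<Longrightarrow> t \<in> {0..T} \<Longrightarrow> norm (q t) \<le> R"
    and lip: "\<And>v w q p t. v \<in> controls T \<Longrightarrow> w \<in> controls T \<Longrightarrow>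
       L2_norm T (\<lambda>t. v t - u t) < \<delta>1 \<Longrightarrow> L2_norm T (\<lambda>t. w t - u t) < \<delta>1 \<Longrightarrow>
       trajectory F T 0 v q \<Longrightarrow> trajectory F T 0 w p \<Longrightarrow> t \<in> {0..T} \<Longrightarrow>
       norm (q t - p t) \<le> C * L2_norm T (\<lambda>t. v t - w t)"
    and K: "\<And>w x y. norm x \<le> R \<Longrightarrow> norm y \<le> R \<Longrightarrow> norm (velocity F w x - velocity F w y) \<le> K * norm w * norm (x - y)"
    by (rule trajectories_near[OF C1 u g T], rule that, assumption+)
  have "bounded (p ` {0..T})" by (intro compact_imp_bounded compact_continuous_image cp) auto
  then obtain P where P: "P > 0" "\<And>t. t \<in> {0..T} \<Longrightarrow> norm (p t) \<le> P" unfolding bounded_pos by auto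
  define Lu where "Lu = L2_norm T u"
  have Lu0: "0 \<le> Lu" using L2_norm_nonneg[OF u] by (simp add: Lu_def)
  define c where "c = P * C * sqrt T + 1"
  have c1: "P * C * sqrt T \<le> c" "0 < c" using P C0 T by (auto simp: c_def add_nonneg_pos)
  define \<eta> where "\<eta> = e / (2 * c * (Lu + 1))"
  have eta: "\<eta> > 0" using e c1 Lu0 by (simp add: \<eta>_def)
  obtain \<rho> where rho: "\<rho> > 0" "\<And>w z x y. z \<in> cball 0 R \<Longrightarrow> x \<in> ball z \<rho> \<Longrightarrow> y \<in> ball z \<rho> \<Longrightarrow>
     norm (velocity F w x - velocity F w y - velocity (\<lambda>i a. DF i a (x - y)) w z) \<le> \<eta> * norm w * norm (x - y)"
    using frame_uniform_strict_derivative[OF C1 eta] by blast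
  define \<delta> where "\<delta> = min \<delta>1 (min (\<rho> / (C + 1)) (e / (4 * c * (K + 1))))"
  have d0: "\<delta> > 0" using d1 rho(1) e c1 K0 C0 by (simp add: \<delta>_def)
  show ?thesis
  proof (intro exI[of _ \<delta>] conjI allI impI d0)
    show "\<exists>q. trajectory F T 0 v q" if "v \<in> controls T" "L2_norm T (\<lambda>t. v t - u t) < \<delta>" for v
      using ex that by (simp add: \<delta>_def)
  next
    fix v w q y
    assume v: "v \<in> controls T" and w: "w \<in> controls T"
      and vd: "L2_norm T (\<lambda>t. v t - u t) < \<delta>" and wd: "L2_norm T (\<lambda>t. w t - u t) < \<delta>"
      and q: "trajectory F T 0 v q" and y: "trajectory F T 0 w y"
    have vd1: "L2_norm T (\<lambda>t. v t - u t) < \<delta>1" and wd1: "L2_norm T (\<lambda>t. w t - u t) < \<delta>1"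
      using vd wd by (auto simp: \<delta>_def)
    have ud1: "L2_norm T (\<lambda>t. u t - u t) < \<delta>1" using d1 by (simp add: L2_norm_def)
    note cq = trajectory_continuous[OF q] and cy = trajectory_continuous[OF y]
    let ?L = "L2_norm T (\<lambda>t. v t - w t)"
    have L0: "0 \<le> ?L" by (rule L2_norm_nonneg[OF controls_diff[OF v w]])
    define d where "d t = q t - y t" for t
    have dL: "norm (d t) \<le> C * ?L" if "t \<in> {0..T}" for t
      unfolding d_def by (rule lip[OF v w vd1 wd1 q y that])
    have close: "norm (z t - \<gamma> t) \<le> C * \<delta>" "norm (z t - \<gamma> t) < \<rho>"
      if "x \<in> controls T" "L2_norm T (\<lambda>t. x t - u t) < \<delta>" "trajectory F T 0 x z" "t \<in> {0..T}" for x z t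
    proof -
      have "L2_norm T (\<lambda>t. x t - u t) < \<delta>1" using that(2) by (simp add: \<delta>_def)
      then have "norm (z t - \<gamma> t) \<le> C * L2_norm T (\<lambda>t. x t - u t)"
        by (rule lip[OF that(1) u _ ud1 that(3) g that(4)])
      then show 1: "norm (z t - \<gamma> t) \<le> C * \<delta>"
        using that(2) C0 by (meson less_eq_real_def mult_left_mono order_trans)
      have "C * \<delta> \<le> C * (\<rho> / (C + 1))" using C0 by (intro mult_left_mono) (auto simp: \<delta>_def)
      also have "\<dots> < \<rho>" using C0 rho(1) by (simp add: field_simps)
      finally show "norm (z t - \<gamma> t) < \<rho>" using 1 by simp
    qed
    let ?\<phi> = "\<lambda>s. velocity F (v s) (q s) - velocity F (w s) (y s)"
    let ?A = "\<lambda>s. - adjoint_velocity DF (u s) (\<gamma> s) (p s)"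
    have absphi: "?\<phi> absolutely_integrable_on {0..T}"
      by (intro set_integral_diff velocity_abs_integrable v w cq cy C1_frame_cont[OF C1])
    have absA: "?A absolutely_integrable_on {0..T}"
      using adjoint_velocity_abs_integrable[OF C1 u cg cp] by (simp add: set_integrable_def)
    have d00: "d 0 = 0" using trajectory_start[OF q T] trajectory_start[OF y T] by (simp add: d_def)
    have "\<forall>t\<in>{0..T}. (?\<phi> has_integral (d t - d 0)) {0..t}"
    proof
      fix t assume t: "t \<in> {0..T}"
      have "(?\<phi> has_integral ((q t - 0) - (y t - 0))) {0..t}"
        using q y t unfolding trajectory_def by (intro has_integral_diff) auto
      then show "(?\<phi> has_integral (d t - d 0)) {0..t}" by (simp add: d00) (simp add: d_def)
    qed
    from product_rule_integral[OF bounded_bilinear_inner T absA absphi p[unfolded adjoint_curve_def] this]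
    have H1: "((\<lambda>s. ?A s \<bullet> d s + p s \<bullet> ?\<phi> s) has_integral p T \<bullet> d T) {0..T}"
      unfolding d00 by simp
    let ?I = "integral {0..T} (\<lambda>s. p s \<bullet> velocity F (v s - w s) (\<gamma> s))"
    have H2: "((\<lambda>s. p s \<bullet> velocity F (v s - w s) (\<gamma> s)) has_integral ?I) {0..T}"
      by (intro integrable_integral abs_int_integrable inner_velocity_abs_integrable[OF C1 controls_diff[OF v w] cg cp])
    let ?r = "\<lambda>s. ?A s \<bullet> d s + p s \<bullet> ?\<phi> s - p s \<bullet> velocity F (v s - w s) (\<gamma> s)"
    have H3: "(?r has_integral (p T \<bullet> d T - ?I)) {0..T}" by (rule has_integral_diff[OF H1 H2])
    let ?b = "\<lambda>s. P * C * (K * \<delta> * norm (v s - w s) + K * ?L * norm (w s - u s) + \<eta> * ?L * norm (u s))"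
    note ni = controls_norm_integrable[OF controls_diff[OF v w]] controls_norm_integrable[OF controls_diff[OF w u]]
      controls_norm_integrable[OF u]
    have H4: "(?b has_integral P * C * (K * \<delta> * integral {0..T} (\<lambda>s. norm (v s - w s))
        + K * ?L * integral {0..T} (\<lambda>s. norm (w s - u s)) + \<eta> * ?L * integral {0..T} (\<lambda>s. norm (u s)))) {0..T}"
      by (intro has_integral_mult_right has_integral_add integrable_integral ni)
    have "\<bar>p T \<bullet> d T - ?I\<bar> = norm (integral {0..T} ?r)" using H3 by (simp add: integral_unique)
    also have "\<dots> \<le> integral {0..T} ?b"
    proof (rule integral_norm_bound_integral)
      show "?r integrable_on {0..T}" "?b integrable_on {0..T}" using H3 H4 by blast+
      fix s assume s: "s \<in> {0..T}"
      have lin: "linear (DF i (\<gamma> s))" for i by (rule has_derivative_linear[OF C1_frame_deriv[OF C1]])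
      \<comment> \<open>the three parts of the remainder\<close>
      let ?R1 = "velocity F (v s - w s) (q s) - velocity F (v s - w s) (\<gamma> s)"
      let ?R2 = "velocity F (w s - u s) (q s) - velocity F (w s - u s) (y s)"
      let ?R3 = "velocity F (u s) (q s) - velocity F (u s) (y s) - velocity (\<lambda>i a. DF i a (d s)) (u s) (\<gamma> s)"
      have "?r s = p s \<bullet> (?R1 + ?R2 + ?R3)"
        by (simp add: adjoint_velocity_inner[of DF, OF lin] velocity_diff inner_diff_right inner_add_right)
      then have "norm (?r s) \<le> norm (p s) * norm (?R1 + ?R2 + ?R3)"
        by (simp add: Cauchy_Schwarz_ineq2)
      also have "\<dots> \<le> P * (K * norm (v s - w s) * (C * \<delta>) + K * norm (w s - u s) * (C * ?L) + \<eta> * norm (u s) * (C * ?L))"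
      proof (intro mult_mono)
        have n1: "norm ?R1 \<le> K * norm (v s - w s) * (C * \<delta>)"
          using K[OF bd[OF v vd1 q s] gR[OF s], of "v s - w s"] close(1)[OF v vd q s] K0
          by (meson mult_left_mono mult_nonneg_nonneg norm_ge_zero order_trans)
        have n2: "norm ?R2 \<le> K * norm (w s - u s) * (C * ?L)"
          using K[OF bd[OF v vd1 q s] bd[OF w wd1 y s], of "w s - u s"] dL[OF s] K0
          unfolding d_def by (meson mult_left_mono mult_nonneg_nonneg norm_ge_zero order_trans)
        have "norm ?R3 \<le> \<eta> * norm (u s) * norm (q s - y s)"
          unfolding d_def using gR[OF s] close(2)[OF v vd q s] close(2)[OF w wd y s]
          by (intro rho(2)) (auto simp: dist_norm norm_minus_commute)
        then have n3: "norm ?R3 \<le> \<eta> * norm (u s) * (C * ?L)"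
          using dL[OF s] eta unfolding d_def
          by (meson mult_left_mono mult_nonneg_nonneg norm_ge_zero order_trans less_imp_le)
        show "norm (?R1 + ?R2 + ?R3) \<le> K * norm (v s - w s) * (C * \<delta>) + K * norm (w s - u s) * (C * ?L) + \<eta> * norm (u s) * (C * ?L)"
          using n1 n2 n3 norm_triangle_ineq[of "?R1 + ?R2" ?R3] norm_triangle_ineq[of ?R1 ?R2] by linarith
      qed (use P(1) P(2)[OF s] in auto)
      also have "\<dots> = ?b s" by (simp add: algebra_simps)
      finally show "norm (?r s) \<le> ?b s" .
    qed
    also have "\<dots> = P * C * (K * \<delta> * integral {0..T} (\<lambda>s. norm (v s - w s))
        + K * ?L * integral {0..T} (\<lambda>s. norm (w s - u s)) + \<eta> * ?L * integral {0..T} (\<lambda>s. norm (u s)))"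
      using H4 by (rule integral_unique)
    also have "\<dots> \<le> P * C * (K * \<delta> * (sqrt T * ?L) + K * ?L * (sqrt T * \<delta>) + \<eta> * ?L * (sqrt T * Lu))"
    proof -
      have "integral {0..T} (\<lambda>s. norm (w s - u s)) \<le> sqrt T * \<delta>"
        using integral_norm_le_L2[OF controls_diff[OF w u] T] wd T
        by (meson less_imp_le mult_left_mono order_trans real_sqrt_ge_zero)
      then show ?thesis
        using integral_norm_le_L2[OF controls_diff[OF v w] T] integral_norm_le_L2[OF u T] K0 eta L0 d0 P(1) C0
        unfolding Lu_def by (intro mult_left_mono add_mono) auto
    qed
    also have "\<dots> = (P * C * sqrt T) * ((2 * (K * \<delta>) + \<eta> * Lu) * ?L)" by (simp add: algebra_simps)
    also have "\<dots> \<le> c * ((2 * (K * \<delta>) + \<eta> * Lu) * ?L)"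
      using c1 K0 d0 eta Lu0 L0 by (intro mult_right_mono) auto
    also have "\<dots> \<le> e * ?L"
    proof -
      have "K * \<delta> \<le> (K + 1) * (e / (4 * c * (K + 1)))"
        using K0 d0 by (intro mult_mono) (auto simp: \<delta>_def)
      also have "\<dots> = e / (4 * c)" using K0 c1 by (simp add: divide_simps)
      finally have a1: "2 * (K * \<delta>) \<le> e / (2 * c)" by simp
      have "\<eta> * Lu \<le> \<eta> * (Lu + 1)" using eta by simp
      also have "\<dots> = e / (2 * c)" using Lu0 c1 by (simp add: \<eta>_def)
      finally have "2 * (K * \<delta>) + \<eta> * Lu \<le> e / c" using a1 c1 by (simp add: field_simps)
      then have "c * (2 * (K * \<delta>) + \<eta> * Lu) \<le> c * (e / c)" using c1 by (intro mult_left_mono) auto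
      then have "c * (2 * (K * \<delta>) + \<eta> * Lu) \<le> e" using c1 by simp
      then show ?thesis using L0 by (metis mult.assoc mult_right_mono)
    qed
    finally show "\<bar>p T \<bullet> (q T - y T) - ?I\<bar> \<le> e * ?L" by (simp add: d_def)
  qed
qed

section \<open>The derivative of the end-point mapping and its covectors\<close>

lemma L2_derivative_unique:
  assumes D: "has_L2_derivative T Dom E D u" and D': "has_L2_derivative T Dom E D' u" and h: "h \<in> controls T"
  shows "D h = D' h"
proof -
  have small: "norm (D h - D' h) \<le> e * (2 * L2_norm T h)" if e: "e > 0" for e
  proof -
    obtain d where d: "d > 0" "\<And>k. k \<in> controls T \<Longrightarrow> L2_norm T k < d \<Longrightarrow>
        norm (E (\<lambda>t. u t + k t) - E u - D k) \<le> e * L2_norm T k"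
      using D e unfolding has_L2_derivative_def by meson
    obtain d' where d': "d' > 0" "\<And>k. k \<in> controls T \<Longrightarrow> L2_norm T k < d' \<Longrightarrow>
        norm (E (\<lambda>t. u t + k t) - E u - D' k) \<le> e * L2_norm T k"
      using D' e unfolding has_L2_derivative_def by meson
    define s where "s = min d d' / (L2_norm T h + 1)"
    have L0: "0 \<le> L2_norm T h" by (rule L2_norm_nonneg[OF h])
    have s0: "s > 0" using d(1) d'(1) L0 by (simp add: s_def)
    let ?k = "\<lambda>t. s *\<^sub>R h t"
    have k: "?k \<in> controls T" by (rule controls_scaleR[OF h])
    have Lk: "L2_norm T ?k = s * L2_norm T h" using s0 by (simp add: L2_norm_scaleR)
    have "s * L2_norm T h < s * (L2_norm T h + 1)" using s0 by simp
    also have "\<dots> = min d d'" using L0 by (simp add: s_def)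
    finally have lt: "L2_norm T ?k < d" "L2_norm T ?k < d'" using Lk by auto
    let ?x = "E (\<lambda>t. u t + ?k t) - E u"
    have "D ?k = s *\<^sub>R D h" "D' ?k = s *\<^sub>R D' h"
      using D D' h unfolding has_L2_derivative_def by blast+
    then have "s * norm (D h - D' h) = norm ((?x - D' ?k) - (?x - D ?k))"
      using s0 by (simp add: scaleR_diff_right[symmetric])
    also have "\<dots> \<le> norm (?x - D' ?k) + norm (?x - D ?k)" by (rule norm_triangle_ineq4)
    also have "\<dots> \<le> s * (e * (2 * L2_norm T h))"
      using d(2)[OF k lt(1)] d'(2)[OF k lt(2)] by (simp add: Lk algebra_simps)
    finally show ?thesis using s0 by simp
  qed
  have "norm (D h - D' h) \<le> 0"
  proof (rule field_le_epsilon)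
    fix e :: real assume "e > 0"
    have L0: "0 \<le> L2_norm T h" by (rule L2_norm_nonneg[OF h])
    have "norm (D h - D' h) \<le> e / (2 * L2_norm T h + 1) * (2 * L2_norm T h)"
      using \<open>e > 0\<close> L0 by (intro small) simp
    also have "\<dots> \<le> e" using \<open>e > 0\<close> L0 by (simp add: field_simps)
    finally show "norm (D h - D' h) \<le> 0 + e" by simp
  qed
  then show ?thesis by simp
qed

text \<open>Strict differentiability at $u$: the linear approximation $D$ is valid for the difference of the values at any two points near
$u$, uniformly. Unlike differentiability at $u$ it gives information about $E$ near controls $w \ne u$.\<close>

definition strict_L2_derivative ::
  "real \<Rightarrow> (real \<Rightarrow> real^'m) set \<Rightarrow> ((real \<Rightarrow> real^'m) \<Rightarrow> real^'n) \<Rightarrow> ((real \<Rightarrow> real^'m) \<Rightarrow> real^'n)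
     \<Rightarrow> (real \<Rightarrow> real^'m) \<Rightarrow> bool" where
  "strict_L2_derivative T Dom E D u \<longleftrightarrow>
     (\<forall>e>0. \<exists>\<delta>>0. \<forall>v\<in>controls T. \<forall>w\<in>controls T.
        L2_norm T (\<lambda>t. v t - u t) < \<delta> \<longrightarrow> L2_norm T (\<lambda>t. w t - u t) < \<delta> \<longrightarrow>
        v \<in> Dom \<and> norm (E v - E w - D (\<lambda>t. v t - w t)) \<le> e * L2_norm T (\<lambda>t. v t - w t))"

text \<open>The derivative is defined through its components, one adjoint curve for each vector of the basis; linearity of the adjoint
equation then provides an adjoint curve representing $h \mapsto a \bullet D h$ for each covector $a$.\<close>

theorem end_point_strict_derivative:
  fixes F :: "'m::finite \<Rightarrow> real^'n \<Rightarrow> real^'n"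
  assumes C1: "C1_frame F DF" and u: "u \<in> controls T" and g: "trajectory F T 0 u \<gamma>" and T: "0 \<le> T"
  obtains D where
    "has_L2_derivative T (end_point_dom F T) (end_point F T) D u"
    "strict_L2_derivative T (end_point_dom F T) (end_point F T) D u"
    "\<And>a. \<exists>p. adjoint_curve DF T u \<gamma> p \<and> p T = a \<and>
       (\<forall>h\<in>controls T. a \<bullet> D h = integral {0..T} (\<lambda>s. p s \<bullet> velocity F (h s) (\<gamma> s)))"
proof -
  note cg = trajectory_continuous[OF g]
  have "\<exists>p. adjoint_curve DF T u \<gamma> p \<and> p T = b" for b
    using adjoint_curve_exists[OF C1 u cg T, of b] by blast
  then obtain P where P: "\<And>b. adjoint_curve DF T u \<gamma> (P b)" "\<And>b. P b T = b" by metis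
  define I where "I b h = integral {0..T} (\<lambda>s. P b s \<bullet> velocity F (h s) (\<gamma> s))" for b h
  define D where "D h = (\<Sum>b\<in>Basis. I b h *\<^sub>R b)" for h
  have int: "(\<lambda>s. P b s \<bullet> velocity F (h s) (\<gamma> s)) integrable_on {0..T}" if "h \<in> controls T" for b h
    by (rule abs_int_integrable, rule inner_velocity_abs_integrable[OF C1 that cg adjoint_curve_continuous[OF P(1)]])
  have D_b: "D h \<bullet> b = I b h" if "b \<in> Basis" for h b
    using that by (simp add: D_def inner_sum_left inner_Basis if_distrib cong: if_cong)
  have D_add: "D (\<lambda>t. v t + w t) = D v + D w" if "v \<in> controls T" "w \<in> controls T" for v w
    using int[OF that(1)] int[OF that(2)]
    by (simp add: D_def I_def velocity_add inner_add_right integral_add scaleR_add_left sum.distrib)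
  have D_scale: "D (\<lambda>t. c *\<^sub>R v t) = c *\<^sub>R D v" for c v
    by (simp add: D_def I_def velocity_scaleR scaleR_sum_right)
  have strict: "\<exists>\<delta>>0. \<forall>v\<in>controls T. \<forall>w\<in>controls T.
        L2_norm T (\<lambda>t. v t - u t) < \<delta> \<longrightarrow> L2_norm T (\<lambda>t. w t - u t) < \<delta> \<longrightarrow>
        v \<in> end_point_dom F T \<and>
        norm (end_point F T v - end_point F T w - D (\<lambda>t. v t - w t)) \<le> e * L2_norm T (\<lambda>t. v t - w t)"
    if e: "e > 0" for e
  proof -
    define e' where "e' = e / DIM(real^'n)"
    have e': "e' > 0" using e by (simp add: e'_def)
    define Q where "Q b \<delta> \<longleftrightarrow> 0 < \<delta> \<and> (\<forall>v. v \<in> controls T \<longrightarrow> L2_norm T (\<lambda>t. v t - u t) < \<delta> \<longrightarrow> (\<exists>q. trajectory F T 0 v q)) \<and>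
      (\<forall>v w q y. v \<in> controls T \<longrightarrow> w \<in> controls T \<longrightarrow>
       L2_norm T (\<lambda>t. v t - u t) < \<delta> \<longrightarrow> L2_norm T (\<lambda>t. w t - u t) < \<delta> \<longrightarrow>
       trajectory F T 0 v q \<longrightarrow> trajectory F T 0 w y \<longrightarrow>
       \<bar>b \<bullet> (q T - y T) - I b (\<lambda>s. v s - w s)\<bar> \<le> e' * L2_norm T (\<lambda>t. v t - w t))" for b \<delta>
    have "\<exists>\<delta>. Q b \<delta>" for b
      using adjoint_strict_derivative[OF C1 u g T P(1)[of b] e'] unfolding Q_def I_def P(2) .
    then obtain r where Q: "\<And>b. Q b (r b)" by metis
    have r: "\<And>b. r b > 0"
      "\<And>b v. v \<in> controls T \<Longrightarrow> L2_norm T (\<lambda>t. v t - u t) < r b \<Longrightarrow> \<exists>q. trajectory F T 0 v q"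
      "\<And>b v w q y. v \<in> controls T \<Longrightarrow> w \<in> controls T \<Longrightarrow>
       L2_norm T (\<lambda>t. v t - u t) < r b \<Longrightarrow> L2_norm T (\<lambda>t. w t - u t) < r b \<Longrightarrow>
       trajectory F T 0 v q \<Longrightarrow> trajectory F T 0 w y \<Longrightarrow>
       \<bar>b \<bullet> (q T - y T) - I b (\<lambda>s. v s - w s)\<bar> \<le> e' * L2_norm T (\<lambda>t. v t - w t)"
      using Q unfolding Q_def by blast+
    define \<delta> where "\<delta> = min (r 0) (Min (r ` Basis))"
    have d0: "\<delta> > 0" and dle: "\<delta> \<le> r 0" "\<And>b. b \<in> Basis \<Longrightarrow> \<delta> \<le> r b"
      unfolding \<delta>_def using r(1) by (auto simp: min_le_iff_disj)
    show ?thesis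
    proof (intro exI[of _ \<delta>] conjI ballI impI d0)
      fix v w assume v: "v \<in> controls T" and w: "w \<in> controls T"
        and vd: "L2_norm T (\<lambda>t. v t - u t) < \<delta>" and wd: "L2_norm T (\<lambda>t. w t - u t) < \<delta>"
      obtain q where q: "trajectory F T 0 v q" using r(2)[OF v, of 0] vd dle(1) by auto
      obtain y where y: "trajectory F T 0 w y" using r(2)[OF w, of 0] wd dle(1) by auto
      show "v \<in> end_point_dom F T" using v q by (auto simp: end_point_dom_def)
      let ?x = "q T - y T - D (\<lambda>t. v t - w t)"
      have "norm ?x \<le> (\<Sum>b\<in>Basis. \<bar>?x \<bullet> b\<bar>)" by (rule norm_le_l1)
      also have "\<dots> \<le> (\<Sum>b\<in>(Basis::(real^'n) set). e' * L2_norm T (\<lambda>t. v t - w t))"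
      proof (rule sum_mono)
        fix b :: "real^'n" assume b: "b \<in> Basis"
        have "?x \<bullet> b = b \<bullet> (q T - y T) - I b (\<lambda>s. v s - w s)"
          using D_b[OF b] by (simp add: inner_diff_left inner_diff_right inner_commute)
        then show "\<bar>?x \<bullet> b\<bar> \<le> e' * L2_norm T (\<lambda>t. v t - w t)"
          using r(3)[OF v w _ _ q y, of b] vd wd dle(2)[OF b] by auto
      qed
      also have "\<dots> = e * L2_norm T (\<lambda>t. v t - w t)" by (simp add: e'_def)
      finally show "norm (end_point F T v - end_point F T w - D (\<lambda>t. v t - w t)) \<le> e * L2_norm T (\<lambda>t. v t - w t)"
        by (simp add: end_point_eq[OF C1 v q T] end_point_eq[OF C1 w y T])
    qed
  qed
  have bounded: "\<exists>C. \<forall>h\<in>controls T. norm (D h) \<le> C * L2_norm T h"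
  proof -
    have "\<exists>c\<ge>0. \<forall>h\<in>controls T. \<bar>I b h\<bar> \<le> c * L2_norm T h" for b
    proof -
      have "bounded ((\<lambda>s. norm (P b s) * (\<Sum>i\<in>UNIV. norm (F i (\<gamma> s)))) ` {0..T})"
        by (intro compact_imp_bounded compact_continuous_image continuous_intros
            adjoint_curve_continuous[OF P(1)] continuous_on_compose2[OF C1_frame_cont[OF C1] cg]) auto
      then obtain M where M: "M > 0" "\<And>s. s \<in> {0..T} \<Longrightarrow> norm (P b s) * (\<Sum>i\<in>UNIV. norm (F i (\<gamma> s))) \<le> M"
        unfolding bounded_pos by (auto simp: abs_le_iff)
      have "\<bar>I b h\<bar> \<le> (M * sqrt T) * L2_norm T h" if h: "h \<in> controls T" for h
      proof -
        have "norm (I b h) \<le> integral {0..T} (\<lambda>s. M * norm (h s))"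
          unfolding I_def
        proof (rule integral_norm_bound_integral[OF int[OF h]])
          show "(\<lambda>s. M * norm (h s)) integrable_on {0..T}"
            by (intro integrable_on_mult_right controls_norm_integrable h)
          fix s assume s: "s \<in> {0..T}"
          have "norm (P b s \<bullet> velocity F (h s) (\<gamma> s)) \<le> norm (P b s) * norm (velocity F (h s) (\<gamma> s))"
            by (simp add: Cauchy_Schwarz_ineq2)
          also have "\<dots> \<le> norm (P b s) * (norm (h s) * (\<Sum>i\<in>UNIV. norm (F i (\<gamma> s))))"
            by (intro mult_left_mono norm_velocity_le) simp
          also have "\<dots> = (norm (P b s) * (\<Sum>i\<in>UNIV. norm (F i (\<gamma> s)))) * norm (h s)" by simp
          also have "\<dots> \<le> M * norm (h s)" by (intro mult_right_mono M(2) s) simp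
          finally show "norm (P b s \<bullet> velocity F (h s) (\<gamma> s)) \<le> M * norm (h s)" .
        qed
        also have "\<dots> \<le> M * (sqrt T * L2_norm T h)"
          using integral_norm_le_L2[OF h T] M(1) by simp
        finally show ?thesis by (simp add: mult.assoc)
      qed
      then show ?thesis using M(1) T by (intro exI[of _ "M * sqrt T"]) auto
    qed
    then obtain c where c: "\<And>b. 0 \<le> c b" "\<And>b h. h \<in> controls T \<Longrightarrow> \<bar>I b h\<bar> \<le> c b * L2_norm T h" by metis
    have "norm (D h) \<le> (\<Sum>b\<in>Basis. c b) * L2_norm T h" if h: "h \<in> controls T" for h
    proof -
      have "norm (D h) \<le> (\<Sum>b\<in>Basis. \<bar>D h \<bullet> b\<bar>)" by (rule norm_le_l1)
      also have "\<dots> \<le> (\<Sum>b\<in>Basis. c b * L2_norm T h)"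
        using c(2)[OF h] D_b by (intro sum_mono) auto
      finally show ?thesis by (simp add: sum_distrib_right)
    qed
    then show ?thesis by blast
  qed
  show ?thesis
  proof (rule that[of D])
    show "has_L2_derivative T (end_point_dom F T) (end_point F T) D u"
      unfolding has_L2_derivative_def
    proof (intro conjI ballI allI impI D_add D_scale bounded)
      fix e :: real assume "e > 0"
      from strict[OF this] obtain \<delta> where d: "\<delta> > 0" "\<forall>v\<in>controls T. \<forall>w\<in>controls T.
          L2_norm T (\<lambda>t. v t - u t) < \<delta> \<longrightarrow> L2_norm T (\<lambda>t. w t - u t) < \<delta> \<longrightarrow>
          v \<in> end_point_dom F T \<and>
          norm (end_point F T v - end_point F T w - D (\<lambda>t. v t - w t)) \<le> e * L2_norm T (\<lambda>t. v t - w t)"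
        by (elim exE conjE)
      have "(\<lambda>t. u t + h t) \<in> end_point_dom F T \<and> norm (end_point F T (\<lambda>t. u t + h t) - end_point F T u - D h) \<le> e * L2_norm T h"
        if "h \<in> controls T" "L2_norm T h < \<delta>" for h
        using bspec[OF bspec[OF d(2) controls_add[OF u that(1)]] u] that(2) d(1) by (simp add: L2_norm_def)
      then show "\<exists>d>0. \<forall>h\<in>controls T. L2_norm T h < d \<longrightarrow>
            (\<lambda>t. u t + h t) \<in> end_point_dom F T \<and>
            norm (end_point F T (\<lambda>t. u t + h t) - end_point F T u - D h) \<le> e * L2_norm T h"
        using d(1) by blast
    qed
  next
    fix a :: "real^'n"
    define p where "p t = (\<Sum>b\<in>Basis. (a \<bullet> b) *\<^sub>R P b t)" for t
    have "adjoint_curve DF T u \<gamma> p" unfolding p_def by (intro adjoint_curve_sum P) simp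
    moreover have "p T = a" by (simp add: p_def P euclidean_representation)
    moreover have "a \<bullet> D h = integral {0..T} (\<lambda>s. p s \<bullet> velocity F (h s) (\<gamma> s))" if h: "h \<in> controls T" for h
    proof -
      have "a \<bullet> D h = (\<Sum>b\<in>Basis. (a \<bullet> b) * I b h)"
        by (simp add: D_def inner_sum_right mult.commute)
      also have "\<dots> = integral {0..T} (\<lambda>s. \<Sum>b\<in>Basis. (a \<bullet> b) * (P b s \<bullet> velocity F (h s) (\<gamma> s)))"
        unfolding I_def by (subst integral_sum) (auto intro!: integrable_on_mult_right int[OF h])
      also have "\<dots> = integral {0..T} (\<lambda>s. p s \<bullet> velocity F (h s) (\<gamma> s))"
        by (simp add: p_def inner_sum_left)
      finally show ?thesis .
    qed
    ultimately show "\<exists>p. adjoint_curve DF T u \<gamma> p \<and> p T = a \<and>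
       (\<forall>h\<in>controls T. a \<bullet> D h = integral {0..T} (\<lambda>s. p s \<bullet> velocity F (h s) (\<gamma> s)))" by blast
  next
    show "strict_L2_derivative T (end_point_dom F T) (end_point F T) D u"
      unfolding strict_L2_derivative_def using strict by (intro allI impI)
  qed
qed

text \<open>A Frechet derivative is unique, so the one selected by Hilbert choice in the definition of $dE$ is the one constructed
from the adjoint equation.\<close>

lemma dE_eq:
  assumes "has_L2_derivative T (end_point_dom F T) (end_point F T) D u" "h \<in> controls T"
  shows "dE F T u h = D h"
proof -
  have "has_L2_derivative T (end_point_dom F T) (end_point F T) (dE F T u) u"
    unfolding dE_def by (rule someI[of "\<lambda>D. has_L2_derivative T (end_point_dom F T) (end_point F T) D u", OF assms(1)])
  then show ?thesis using L2_derivative_unique assms by blast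
qed

lemma grad_eq:
  assumes "(f has_derivative (\<lambda>h. h \<bullet> D)) (at x)"
  shows "grad f x = D"
  unfolding grad_def
proof (rule the_equality)
  show "GDERIV f x :> D" using assms by (simp add: gderiv_def)
  fix D' assume "GDERIV f x :> D'"
  then have "(\<lambda>h. h \<bullet> D') = (\<lambda>h. h \<bullet> D)"
    using assms has_derivative_unique unfolding gderiv_def by blast
  then have "(D' - D) \<bullet> D' = (D' - D) \<bullet> D" by metis
  then show "D' = D" by (metis inner_diff_right inner_eq_zero_iff right_minus_eq)
qed

lemma grad_hamiltonian_p: "grad (\<lambda>y. hamiltonian F \<nu> q y w) p = velocity F w q"
  unfolding hamiltonian_def by (rule grad_eq) (auto intro!: derivative_eq_intros)

lemma grad_hamiltonian_q:
  assumes C1: "C1_frame F DF"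
  shows "grad (\<lambda>x. hamiltonian F \<nu> x p w) q = adjoint_velocity DF w q p"
proof (rule grad_eq)
  have lin: "linear (DF i q)" for i by (rule has_derivative_linear[OF C1_frame_deriv[OF C1]])
  have "((\<lambda>x. velocity F w x) has_derivative (\<lambda>h. velocity (\<lambda>i a. DF i a h) w q)) (at q)"
    unfolding velocity_def by (intro has_derivative_sum has_derivative_scaleR_right C1_frame_deriv[OF C1])
  then have "((\<lambda>x. hamiltonian F \<nu> x p w) has_derivative (\<lambda>h. p \<bullet> velocity (\<lambda>i a. DF i a h) w q + 0)) (at q)"
    unfolding hamiltonian_def by (intro has_derivative_add has_derivative_inner_right has_derivative_const)
  then show "((\<lambda>x. hamiltonian F \<nu> x p w) has_derivative (\<lambda>h. h \<bullet> adjoint_velocity DF w q p)) (at q)"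
    by (simp add: inner_commute[of _ "adjoint_velocity DF w q p"] adjoint_velocity_inner[of DF, OF lin])
qed

lemma grad_hamiltonian_u:
  fixes F :: "'m::finite \<Rightarrow> real^'n \<Rightarrow> real^'n"
  shows "grad (hamiltonian F \<nu> q p) w = (\<chi> i. p \<bullet> F i q + 2 * \<nu> * w $ i)"
proof (rule grad_eq)
  have "((\<lambda>w. p \<bullet> velocity F w q + \<nu> * (\<Sum>i\<in>UNIV. (w $ i)\<^sup>2)) has_derivative
      (\<lambda>h. p \<bullet> velocity F h q + \<nu> * (\<Sum>i\<in>UNIV. 2 * w $ i * h $ i))) (at w)"
  proof (intro has_derivative_add has_derivative_inner_right has_derivative_mult_right has_derivative_sum)
    show "((\<lambda>w. velocity F w q) has_derivative (\<lambda>h. velocity F h q)) (at w)"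
      by (rule bounded_linear_imp_has_derivative[OF bounded_linear_velocity])
    show "((\<lambda>w. (w $ i)\<^sup>2) has_derivative (\<lambda>h. 2 * w $ i * h $ i)) (at w)" for i
      by (auto intro!: derivative_eq_intros bounded_linear_imp_has_derivative bounded_linear_vec_nth)
  qed
  moreover have "p \<bullet> velocity F h q + \<nu> * (\<Sum>i\<in>UNIV. 2 * w $ i * h $ i)
     = h \<bullet> (\<chi> i. p \<bullet> F i q + 2 * \<nu> * w $ i)" for h
    by (simp add: velocity_def inner_sum_right inner_vec_def[of h] sum.distrib[symmetric] sum_distrib_left algebra_simps)
  ultimately show "(hamiltonian F \<nu> q p has_derivative (\<lambda>h. h \<bullet> (\<chi> i. p \<bullet> F i q + 2 * \<nu> * w $ i))) (at w)"
    unfolding hamiltonian_def by simp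
qed

lemma controls_continuous:
  fixes c :: "real \<Rightarrow> real^'m"
  assumes "continuous_on {0..T} c"
  shows "c \<in> controls T"
proof -
  have "bounded (c ` {0..T})" by (intro compact_imp_bounded compact_continuous_image assms) auto
  then obtain B where "\<And>t. t \<in> {0..T} \<Longrightarrow> norm (c t) \<le> B" unfolding bounded_iff by (meson imageI)
  then show ?thesis
    by (intro controls_bounded[where c=B] continuous_imp_measurable_on_sets_lebesgue[OF assms]) auto
qed

text \<open>The first two Hamiltonian equations are the equations of the trajectory and of the adjoint curve. For the third, the
annihilation condition reads \<open>\<integral> g(s) \<bullet> h(s) ds = 0\<close> for each control $h$, where $g$ is the gradient of the Hamiltonian
with respect to the control; choosing $h = g$ shows that $g$ vanishes almost everywhere.\<close>

lemma annihilator_extended_adjoint: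
  fixes F :: "'m::finite \<Rightarrow> real^'n \<Rightarrow> real^'n"
  assumes C1: "C1_frame F DF" and u: "u \<in> controls T" and g: "trajectory F T 0 u \<gamma>" and T: "0 \<le> T"
    and p: "adjoint_curve DF T u \<gamma> p" and nu: "\<nu> \<in> {0, -1/2}" and nz: "\<nu> = 0 \<Longrightarrow> p T \<noteq> 0"
    and ann: "\<And>h. h \<in> controls T \<Longrightarrow>
        integral {0..T} (\<lambda>s. p s \<bullet> velocity F (h s) (\<gamma> s)) + 2 * \<nu> * integral {0..T} (\<lambda>s. u s \<bullet> h s) = 0"
  shows "extended_adjoint F T u \<gamma> p \<nu>"
proof -
  note cg = trajectory_continuous[OF g] and cp = adjoint_curve_continuous[OF p]
  define h where "h t = (\<chi> i. p t \<bullet> F i (\<gamma> t)) + (2 * \<nu>) *\<^sub>R u t" for t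
  have "continuous_on {0..T} (\<lambda>t. \<chi> i. p t \<bullet> F i (\<gamma> t))"
    by (intro continuous_intros cp continuous_on_compose2[OF C1_frame_cont[OF C1] cg]) auto
  then have h: "h \<in> controls T"
    unfolding h_def by (intro controls_add controls_scaleR controls_continuous u)
  have h_alt: "h t = (\<chi> i. p t \<bullet> F i (\<gamma> t) + 2 * \<nu> * u t $ i)" for t
    by (simp add: h_def vec_eq_iff)
  have sq: "(norm (h s))\<^sup>2 = p s \<bullet> velocity F (h s) (\<gamma> s) + 2 * \<nu> * (u s \<bullet> h s)" for s
  proof -
    have "(norm (h s))\<^sup>2 = h s \<bullet> (\<chi> i. p s \<bullet> F i (\<gamma> s) + 2 * \<nu> * u s $ i)"
      by (simp add: power2_norm_eq_inner h_alt)
    also have "\<dots> = p s \<bullet> velocity F (h s) (\<gamma> s) + 2 * \<nu> * (u s \<bullet> h s)"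
      by (simp add: velocity_def inner_sum_right inner_vec_def[of "h s"] inner_vec_def[of "u s"] sum.distrib[symmetric] sum_distrib_left algebra_simps)
    finally show ?thesis .
  qed
  have "integral {0..T} (\<lambda>s. (norm (h s))\<^sup>2) = 0"
    unfolding sq using ann[OF h]
      abs_int_integrable[OF inner_velocity_abs_integrable[OF C1 h cg cp]]
      abs_int_integrable[OF controls_inner_abs_integrable[OF u h]]
    by (simp add: integral_add integrable_on_mult_right mult.assoc)
  then have "AE t in lebesgue_on {0..T}. h t = 0" by (rule controls_AE_cong_sq_zero[OF h])
  moreover have "\<gamma> 0 = 0" by (rule trajectory_start[OF g T])
  moreover have "\<forall>t\<in>{0..T}. (p t, \<nu>) \<noteq> (0, 0)"
    using adjoint_curve_nonzero[OF C1 u cg p] nz by auto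
  ultimately show ?thesis
    using nu g p unfolding extended_adjoint_def grad_hamiltonian_p grad_hamiltonian_q[OF C1] grad_hamiltonian_u
      h_alt trajectory_def adjoint_curve_def
    by simp
qed

section \<open>Densities of Lipschitz functions\<close>

text \<open>The part of the completeness of \<open>L\<^sup>2\<close> that is needed: a subsequence converges almost everywhere, and for uniformly
bounded functions dominated convergence applies.\<close>

lemma bounded_L2_Cauchy_converges:
  fixes f :: "nat \<Rightarrow> real \<Rightarrow> real^'m"
  assumes T: "0 \<le> T" and f: "\<And>n. f n \<in> controls T" and bd: "\<And>n t. norm (f n t) \<le> c"
    and cauchy: "\<And>e. e > 0 \<Longrightarrow> \<exists>N. \<forall>i\<ge>N. \<forall>j\<ge>N. L2_norm T (\<lambda>t. f i t - f j t) < e"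
  obtains v \<kappa> where "v \<in> borel_measurable (lebesgue_on {0..T})" "\<And>t. norm (v t) \<le> c" "strict_mono (\<kappa> :: nat \<Rightarrow> nat)"
    "(\<lambda>i. integral {0..T} (\<lambda>t. norm (f (\<kappa> i) t - v t))) \<longlonglongrightarrow> 0"
proof -
  let ?M = "lebesgue_on {0..T}"
  have int: "integrable ?M (f n)" for n
    by (rule absolutely_integrable_imp_integrable[OF controls_abs_integrable[OF f]]) simp
  have c0: "0 \<le> c" using order_trans[OF norm_ge_zero bd] .
  have L1: "LINT x|?M. norm (f i x - f j x) \<le> sqrt T * L2_norm T (\<lambda>t. f i t - f j t)" for i j
  proof -
    have "integrable ?M (\<lambda>x. norm (f i x - f j x))" by (intro integrable_norm Bochner_Integration.integrable_diff int)
    then have "(LINT x|?M. norm (f i x - f j x)) = integral {0..T} (\<lambda>x. norm (f i x - f j x))"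
      by (rule lebesgue_integral_eq_integral) simp
    also have "\<dots> \<le> sqrt T * L2_norm T (\<lambda>t. f i t - f j t)"
      by (rule integral_norm_le_L2[OF controls_diff[OF f f] T])
    finally show ?thesis .
  qed
  obtain \<kappa> where k: "strict_mono (\<kappa> :: nat \<Rightarrow> nat)" "AE x in ?M. Cauchy (\<lambda>i. f (\<kappa> i) x)"
  proof (rule cauchy_L1_AE_cauchy_subseq[of ?M f])
    fix e :: real assume e: "e > 0"
    then obtain N where N: "\<And>i j. i \<ge> N \<Longrightarrow> j \<ge> N \<Longrightarrow> L2_norm T (\<lambda>t. f i t - f j t) < e / (sqrt T + 1)"
      using cauchy[of "e / (sqrt T + 1)"] T by (auto simp: add_nonneg_pos)
    have "LINT x|?M. norm (f i x - f j x) < e" if "i \<ge> N" "j \<ge> N" for i j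
    proof -
      have "sqrt T * L2_norm T (\<lambda>t. f i t - f j t) \<le> sqrt T * (e / (sqrt T + 1))"
        using N[OF that] T by (intro mult_left_mono) auto
      also have "\<dots> < e"
      proof -
        have "0 < sqrt T + 1" using T by (simp add: add_nonneg_pos)
        then show ?thesis using e by (simp add: field_simps)
      qed
      finally show ?thesis using L1[of i j] by linarith
    qed
    then show "\<exists>N. \<forall>i\<ge>N. \<forall>j\<ge>N. LINT x|?M. norm (f i x - f j x) < e" by blast
  qed (use int in auto)
  obtain N where N: "\<And>x. x \<in> {0..T} - N \<Longrightarrow> Cauchy (\<lambda>i. f (\<kappa> i) x)" "N \<in> null_sets ?M"
    using AE_E3[OF k(2)] by (metis space_lebesgue_on)
  have setN: "N \<inter> space ?M \<in> sets ?M" by (intro sets.Int sets.top null_setsD2[OF N(2)])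
  have negN: "negligible N"
    using N(2) by (auto simp: negligible_iff_null_sets null_sets_restrict_space[of "{0..T}" lebesgue] simp del: space_lebesgue_on)
  define g where "g i t = (if t \<in> - (N \<union> - {0..T}) then f (\<kappa> i) t else 0)" for i t
  define v where "v t = lim (\<lambda>i. g i t)" for t
  have g_lim: "(\<lambda>i. g i t) \<longlonglongrightarrow> v t" for t
  proof (cases "t \<in> {0..T} - N")
    case True
    then have "g i t = f (\<kappa> i) t" for i by (simp add: g_def)
    then have "convergent (\<lambda>i. g i t)" using Cauchy_convergent[OF N(1)[OF True]] by simp
    then show ?thesis unfolding v_def by (simp add: convergent_LIMSEQ_iff)
  next
    case False
    then have "g i t = 0" for i by (auto simp: g_def)
    then show ?thesis unfolding v_def by simp
  qed
  have gmeas: "g i \<in> borel_measurable ?M" for i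
  proof -
    have "(\<lambda>t. if t \<in> N then 0 else f (\<kappa> i) t) \<in> borel_measurable ?M"
      by (intro measurable_If_set setN controls_meas[OF f]) simp
    moreover have "g i \<in> borel_measurable ?M \<longleftrightarrow> (\<lambda>t. if t \<in> N then 0 else f (\<kappa> i) t) \<in> borel_measurable ?M"
      by (rule measurable_cong) (auto simp: g_def)
    ultimately show ?thesis by simp
  qed
  have vmeas: "v \<in> borel_measurable ?M" by (rule borel_measurable_LIMSEQ_metric[OF gmeas g_lim])
  have gbd: "norm (g i t) \<le> c" for i t using bd c0 by (simp add: g_def)
  have vbd: "norm (v t) \<le> c" for t
    by (rule Lim_norm_ubound[OF _ g_lim]) (use gbd in auto)
  have v: "v \<in> controls T" by (rule controls_bounded[OF vmeas vbd])
  have g: "g i \<in> controls T" for i by (rule controls_bounded[OF gmeas gbd])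
  have "(\<lambda>i. integral {0..T} (\<lambda>t. norm (g i t - v t))) \<longlonglongrightarrow> integral {0..T} (\<lambda>t. 0::real)"
  proof (rule dominated_convergence(2))
    show "(\<lambda>t. norm (g i t - v t)) integrable_on {0..T}" for i
      by (rule controls_norm_integrable[OF controls_diff[OF g v]])
    show "(\<lambda>t. 2 * c) integrable_on {0..T}" by (rule integrable_continuous_real) simp
    show "norm (norm (g i t - v t)) \<le> 2 * c" for i t
      using norm_triangle_ineq4[of "g i t" "v t"] gbd[of i t] vbd[of t] by simp
    show "(\<lambda>i. norm (g i t - v t)) \<longlonglongrightarrow> 0" for t
      using g_lim[of t] by (simp add: LIM_zero tendsto_norm_zero)
  qed
  moreover have "integral {0..T} (\<lambda>t. norm (g i t - v t)) = integral {0..T} (\<lambda>t. norm (f (\<kappa> i) t - v t))" for i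
    by (rule integral_spike[OF negN]) (auto simp: g_def)
  ultimately have "(\<lambda>i. integral {0..T} (\<lambda>t. norm (f (\<kappa> i) t - v t))) \<longlonglongrightarrow> 0" by simp
  with vmeas vbd k(1) show ?thesis by (rule that)
qed

lemma L2_parallelogram:
  assumes f: "f \<in> controls T" and g: "g \<in> controls T"
  shows "(L2_norm T (\<lambda>t. f t - g t))\<^sup>2 =
     2 * (L2_norm T f)\<^sup>2 + 2 * (L2_norm T g)\<^sup>2 - 4 * (L2_norm T (\<lambda>t. (1/2) *\<^sub>R f t + (1/2) *\<^sub>R g t))\<^sup>2"
proof -
  let ?m = "\<lambda>t. (1/2) *\<^sub>R f t + (1/2) *\<^sub>R g t"
  have m: "?m \<in> controls T" by (intro controls_add controls_scaleR f g)
  have eq: "(norm (f t - g t))\<^sup>2 = 2 * (norm (f t))\<^sup>2 + 2 * (norm (g t))\<^sup>2 - 4 * (norm (?m t))\<^sup>2" for t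
    by (simp add: power2_norm_eq_inner inner_add_left inner_add_right inner_diff_left inner_diff_right inner_commute field_simps)
  show ?thesis
    unfolding L2_norm_power2[OF controls_diff[OF f g]] L2_norm_power2[OF f] L2_norm_power2[OF g] L2_norm_power2[OF m] eq
    using controls_sq[OF f] controls_sq[OF g] controls_sq[OF m]
    by (simp add: integral_diff integral_add integrable_on_mult_right integrable_add)
qed

lemma steklov_average:
  fixes W :: "real \<Rightarrow> 'a::euclidean_space"
  assumes lip: "\<And>s t. norm (W t - W s) \<le> c * \<bar>t - s\<bar>" and c: "0 \<le> c" and h: "h > 0" and t: "0 \<le> t"
  shows "norm (integral {0..t} (\<lambda>s. (1 / h) *\<^sub>R (W (s + h) - W s)) - (W t - W 0)) \<le> 2 * c * h"
proof -
  have contW: "continuous_on S W" for S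
    by (rule lipschitz_on_continuous_on[of c]) (auto simp: lipschitz_on_def dist_norm lip c)
  have iW: "W integrable_on {a..b}" for a b by (rule integrable_continuous_real[OF contW])
  have shift: "integral {0..t} (\<lambda>s. W (s + h)) = integral {h..t + h} W"
    using integral_shift_Icc_real[of 0 t W h] by (simp add: o_def add.commute)
  have sh: "(\<lambda>s. W (s + h)) integrable_on {0..t}"
    by (intro integrable_continuous_real continuous_on_compose2[OF contW[of UNIV]] continuous_intros) auto
  have c1: "integral {0..h} W + integral {h..t + h} W = integral {0..t + h} W"
    "integral {0..t} W + integral {t..t + h} W = integral {0..t + h} W"
    using h t by (intro Henstock_Kurzweil_Integration.integral_combine iW; simp)+
  have I: "integral {0..t} (\<lambda>s. W (s + h) - W s) = integral {t..t + h} W - integral {0..h} W"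
    using c1 by (simp add: integral_diff[OF sh iW] shift algebra_simps)
  have avg: "norm (integral {a..a + h} W - h *\<^sub>R W a) \<le> c * h * h" for a
  proof -
    have "integral {a..a + h} W - h *\<^sub>R W a = integral {a..a + h} (\<lambda>s. W s - W a)"
      using h by (simp add: integral_diff[OF iW integrable_continuous_real])
    also have "norm \<dots> \<le> integral {a..a + h} (\<lambda>s. c * h)"
    proof (rule integral_norm_bound_integral)
      show "(\<lambda>s. W s - W a) integrable_on {a..a + h}" by (intro integrable_diff iW integrable_continuous_real) simp
      show "(\<lambda>s. c * h) integrable_on {a..a + h}" by (rule integrable_continuous_real) simp
      fix s assume "s \<in> {a..a + h}"
      then have "c * \<bar>s - a\<bar> \<le> c * h" using c by (intro mult_left_mono) auto
      then show "norm (W s - W a) \<le> c * h" using lip[of s a] by linarith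
    qed
    also have "\<dots> = c * h * h" using h by simp
    finally show ?thesis .
  qed
  have "integral {0..t} (\<lambda>s. (1 / h) *\<^sub>R (W (s + h) - W s)) - (W t - W 0)
     = (1 / h) *\<^sub>R ((integral {t..t + h} W - h *\<^sub>R W t) - (integral {0..0 + h} W - h *\<^sub>R W 0))"
    unfolding integral_cmul I using h by (simp add: scaleR_diff_right algebra_simps)
  also have "norm \<dots> = (1 / h) * norm ((integral {t..t + h} W - h *\<^sub>R W t) - (integral {0..0 + h} W - h *\<^sub>R W 0))"
    using h by (simp only: norm_scaleR) simp
  also have "\<dots> \<le> (1 / h) * (c * h * h + c * h * h)"
    using h by (intro mult_left_mono order_trans[OF norm_triangle_ineq4] add_mono avg) simp
  also have "\<dots> = 2 * c * h" using h by simp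
  finally show ?thesis .
qed

lemma midpoint_diff:
  fixes a b x :: "'a::real_vector"
  shows "(1/2) *\<^sub>R a + (1/2) *\<^sub>R b - x = (1/2) *\<^sub>R (a - x) + (1/2) *\<^sub>R (b - x)"
proof -
  have "x = (1/2) *\<^sub>R x + (1/2) *\<^sub>R x" by (simp add: scaleR_add_left[symmetric])
  then show ?thesis by (metis scaleR_diff_right add_diff_add)
qed

text \<open>A Lipschitz function is the primitive of a bounded function. Among the continuous functions $f$ bounded by $c$ whose primitive is
within $d$ of $V$ choose one of nearly minimal energy, for $d = 1, 1/2, 1/3, \dots$. These sets are convex and decrease
with $d$, so by the parallelogram law the chosen functions form a Cauchy sequence in \<open>L\<^sup>2\<close>; its limit is the density.
The sets are nonempty because they contain difference quotients of $V$. By construction the density is a limit of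
continuous functions in \<open>L\<^sup>1\<close>, which is used to pair it with weakly convergent controls.\<close>

lemma lipschitz_density:
  fixes V :: "real \<Rightarrow> real^'m"
  assumes T: "0 \<le> T" and c: "0 \<le> c"
    and lip: "\<And>s t. s \<in> {0..T} \<Longrightarrow> t \<in> {0..T} \<Longrightarrow> norm (V t - V s) \<le> c * \<bar>t - s\<bar>"
  obtains v where "v \<in> controls T" "\<And>t. norm (v t) \<le> c"
    "\<And>t. t \<in> {0..T} \<Longrightarrow> integral {0..t} v = V t - V 0"
    "\<And>e. e > 0 \<Longrightarrow> \<exists>g. continuous_on {0..T} g \<and> integral {0..T} (\<lambda>t. norm (g t - v t)) < e"
proof -
  \<comment> \<open>the approximate densities\<close>
  define \<K> where "\<K> d = {f. continuous_on {0..T} f \<and> (\<forall>t. norm (f t) \<le> c) \<and>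
      (\<forall>t\<in>{0..T}. norm (integral {0..t} f - (V t - V 0)) \<le> d)}" for d
  have Kc: "f \<in> controls T" if "f \<in> \<K> d" for f d
    by (rule controls_continuous) (use that in \<open>simp add: \<K>_def\<close>)
  have intK: "f integrable_on {0..t}" if "f \<in> \<K> d" "t \<in> {0..T}" for f d t
  proof (rule integrable_continuous_real, rule continuous_on_subset)
    show "continuous_on {0..T} f" using that(1) by (simp add: \<K>_def)
    show "{0..t} \<subseteq> {0..T}" using that(2) by simp
  qed
  have Kmono: "\<K> d \<subseteq> \<K> d'" if "d \<le> d'" for d d'
    using that unfolding \<K>_def by fastforce
  have mid: "(\<lambda>t. (1/2) *\<^sub>R f t + (1/2) *\<^sub>R g t) \<in> \<K> d" if f: "f \<in> \<K> d" and g: "g \<in> \<K> d" for f g d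
    unfolding \<K>_def
  proof (intro CollectI conjI allI ballI)
    show "continuous_on {0..T} (\<lambda>t. (1/2) *\<^sub>R f t + (1/2) *\<^sub>R g t)"
      using f g unfolding \<K>_def by (intro continuous_intros) auto
    fix t
    have "norm ((1/2) *\<^sub>R f t + (1/2) *\<^sub>R g t) \<le> norm ((1/2) *\<^sub>R f t) + norm ((1/2) *\<^sub>R g t)" by (rule norm_triangle_ineq)
    moreover have "norm (f t) \<le> c" "norm (g t) \<le> c" using f g unfolding \<K>_def by auto
    ultimately show "norm ((1/2) *\<^sub>R f t + (1/2) *\<^sub>R g t) \<le> c" by simp
  next
    fix t assume t: "t \<in> {0..T}"
    have i: "integral {0..t} (\<lambda>t. (1/2) *\<^sub>R f t + (1/2) *\<^sub>R g t) = (1/2) *\<^sub>R integral {0..t} f + (1/2) *\<^sub>R integral {0..t} g"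
      using intK[OF f t] intK[OF g t] by (simp add: integral_add integrable_cmul)
    let ?a = "integral {0..t} f - (V t - V 0)" and ?b = "integral {0..t} g - (V t - V 0)"
    have eq: "integral {0..t} (\<lambda>t. (1/2) *\<^sub>R f t + (1/2) *\<^sub>R g t) - (V t - V 0)
      = (1/2) *\<^sub>R (integral {0..t} f - (V t - V 0)) + (1/2) *\<^sub>R (integral {0..t} g - (V t - V 0))"
      unfolding i by (rule midpoint_diff)
    have "norm ((1/2) *\<^sub>R ?a + (1/2) *\<^sub>R ?b) \<le> norm ((1/2) *\<^sub>R ?a) + norm ((1/2) *\<^sub>R ?b)"
      by (rule norm_triangle_ineq)
    moreover have "norm ((1/2) *\<^sub>R ?a) = norm ?a / 2" "norm ((1/2) *\<^sub>R ?b) = norm ?b / 2" by simp_all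
    moreover have "norm ?a \<le> d" using f t unfolding \<K>_def by blast
    moreover have "norm ?b \<le> d" using g t unfolding \<K>_def by blast
    ultimately show "norm (integral {0..t} (\<lambda>t. (1/2) *\<^sub>R f t + (1/2) *\<^sub>R g t) - (V t - V 0)) \<le> d"
      unfolding eq by linarith
  qed
  have ne: "\<K> d \<noteq> {}" if d: "d > 0" for d
  proof -
    define W where "W t = V (max 0 (min T t))" for t
    have W: "norm (W t - W s) \<le> c * \<bar>t - s\<bar>" for s t
    proof -
      have "norm (W t - W s) \<le> c * \<bar>max 0 (min T t) - max 0 (min T s)\<bar>"
        unfolding W_def using T by (intro lip) auto
      also have "\<dots> \<le> c * \<bar>t - s\<bar>" using c by (intro mult_left_mono) auto
      finally show ?thesis .
    qed
    define h where "h = d / (2 * c + 1)"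
    have h: "h > 0" "2 * c * h \<le> d" using d c by (auto simp: h_def field_simps)
    have contW: "continuous_on UNIV W"
      by (rule lipschitz_on_continuous_on[of c]) (auto simp: lipschitz_on_def dist_norm W c)
    have "(\<lambda>s. (1 / h) *\<^sub>R (W (s + h) - W s)) \<in> \<K> d"
      unfolding \<K>_def
    proof (intro CollectI conjI allI ballI)
      show "continuous_on {0..T} (\<lambda>s. (1 / h) *\<^sub>R (W (s + h) - W s))"
        by (intro continuous_intros continuous_on_compose2[OF contW]) auto
      show "norm ((1 / h) *\<^sub>R (W (s + h) - W s)) \<le> c" for s
        using W[of "s + h" s] h(1) by (simp add: divide_le_eq)
      fix t assume t: "t \<in> {0..T}"
      have "W t = V t" "W 0 = V 0" using t T by (auto simp: W_def)
      then show "norm (integral {0..t} (\<lambda>s. (1 / h) *\<^sub>R (W (s + h) - W s)) - (V t - V 0)) \<le> d"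
        using steklov_average[OF W c h(1), of t] t h(2) by auto
    qed
    then show ?thesis by blast
  qed
  define J where "J f = (L2_norm T f)\<^sup>2" for f :: "real \<Rightarrow> real^'m"
  have J0: "0 \<le> J f" for f by (simp add: J_def)
  define m where "m d = Inf (J ` \<K> d)" for d
  have bdd: "bdd_below (J ` \<K> d)" for d using J0 by (intro bdd_belowI[of _ 0]) auto
  have mle: "m d \<le> J f" if "f \<in> \<K> d" for f d
    unfolding m_def using that by (intro cInf_lower bdd) auto
  have m0: "m d \<le> c\<^sup>2 * T" if "d > 0" for d
  proof -
    obtain f where f: "f \<in> \<K> d" using ne[OF \<open>d > 0\<close>] by blast
    have "J f = integral {0..T} (\<lambda>t. (norm (f t))\<^sup>2)" unfolding J_def by (rule L2_norm_power2[OF Kc[OF f]])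
    also have "\<dots> \<le> integral {0..T} (\<lambda>t. c\<^sup>2)"
      using f unfolding \<K>_def by (intro integral_le controls_sq[OF Kc[OF f]] integrable_continuous_real)
        (auto intro: power_mono)
    also have "\<dots> = c\<^sup>2 * T" using T by simp
    finally show ?thesis using mle[OF f] by linarith
  qed
  define d where "d n = 1 / real (Suc n)" for n
  have d0: "d n > 0" for n by (simp add: d_def)
  have dmono: "d j \<le> d i" if "i \<le> j" for i j using that by (simp add: d_def frac_le)
  have dlim: "d \<longlonglongrightarrow> 0" unfolding d_def by (rule LIMSEQ_Suc[OF lim_1_over_n])
  have "\<exists>f\<in>\<K> (d n). J f \<le> m (d n) + d n" for n
  proof -
    have "Inf (J ` \<K> (d n)) < m (d n) + d n" using d0 by (simp add: m_def)
    then obtain x where "x \<in> J ` \<K> (d n)" "x < m (d n) + d n"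
      using cInf_less_iff[OF _ bdd] ne[OF d0] by (metis image_is_empty)
    then show ?thesis by (auto intro: less_imp_le)
  qed
  then obtain f where f: "\<And>n. f n \<in> \<K> (d n)" "\<And>n. J (f n) \<le> m (d n) + d n" by metis
  have mmono: "m (d i) \<le> m (d j)" if "i \<le> j" for i j
    unfolding m_def
    by (rule cInf_superset_mono[OF _ bdd image_mono[OF Kmono[OF dmono[OF that]]]]) (use ne[OF d0] in simp)
  have "convergent (\<lambda>n. m (d n))"
  proof (rule Bseq_mono_convergent)
    have "0 \<le> m (d n)" for n
      unfolding m_def using ne[OF d0] J0 by (intro cInf_greatest) auto
    then show "Bseq (\<lambda>n. m (d n))" using m0[OF d0] by (intro BseqI'[where K="c\<^sup>2 * T"]) auto
  qed (use mmono in blast)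
  then have Cm: "Cauchy (\<lambda>n. m (d n))" by (rule convergent_Cauchy)
  have cauchy: "\<exists>N. \<forall>i\<ge>N. \<forall>j\<ge>N. L2_norm T (\<lambda>t. f i t - f j t) < e" if e: "e > 0" for e
  proof -
    obtain N1 where N1: "\<And>i j. i \<ge> N1 \<Longrightarrow> j \<ge> N1 \<Longrightarrow> \<bar>m (d i) - m (d j)\<bar> < e\<^sup>2 / 4"
      using CauchyD[OF Cm, of "e\<^sup>2 / 4"] e by auto
    obtain N2 where N2: "\<And>n. n \<ge> N2 \<Longrightarrow> d n < e\<^sup>2 / 8"
    proof -
      obtain N where N: "\<forall>n\<ge>N. norm (d n - 0) < e\<^sup>2 / 8"
        using LIMSEQ_D[OF dlim, of "e\<^sup>2 / 8"] e by auto
      have "d n < e\<^sup>2 / 8" if "n \<ge> N" for n using N that by fastforce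
      then show ?thesis by (rule that)
    qed
    have *: "L2_norm T (\<lambda>t. f i t - f j t) < e" if ij: "max N1 N2 \<le> i" "i \<le> j" for i j
    proof -
      have fj: "f j \<in> \<K> (d i)" using f(1)[of j] Kmono[OF dmono[OF ij(2)]] by blast
      define x where "x = J (\<lambda>t. (1/2) *\<^sub>R f i t + (1/2) *\<^sub>R f j t)"
      have x: "m (d i) \<le> x" unfolding x_def by (rule mle[OF mid[OF f(1) fj]])
      have "(L2_norm T (\<lambda>t. f i t - f j t))\<^sup>2 = 2 * J (f i) + 2 * J (f j) - 4 * x"
        unfolding J_def x_def by (rule L2_parallelogram[OF Kc[OF f(1)] Kc[OF f(1)]])
      also have "\<dots> \<le> 2 * (m (d i) + d i) + 2 * (m (d j) + d j) - 4 * m (d i)"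
        using x
        by (intro diff_mono add_mono mult_left_mono f(2)) simp_all
      also have "\<dots> < e\<^sup>2"
      proof -
        have "m (d j) - m (d i) < e\<^sup>2 / 4" using N1[of i j] ij by linarith
        moreover have "d i < e\<^sup>2 / 8" using N2 ij by simp
        ultimately show ?thesis using dmono[OF ij(2)] by argo
      qed
      finally show ?thesis using e by (simp add: power_less_imp_less_base)
    qed
    have "L2_norm T (\<lambda>t. f i t - f j t) < e" if "max N1 N2 \<le> i" "max N1 N2 \<le> j" for i j
      using *[of i j] *[of j i] that L2_norm_minus_commute[of T "f i" "f j"] by (cases "i \<le> j") auto
    then show ?thesis by blast
  qed
  have fc: "f n \<in> controls T" for n by (rule Kc[OF f(1)])
  have fbd: "norm (f n t) \<le> c" for n t using f(1)[of n] unfolding \<K>_def by blast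
  obtain v \<kappa> where v: "v \<in> borel_measurable (lebesgue_on {0..T})" "\<And>t. norm (v t) \<le> c" "strict_mono (\<kappa> :: nat \<Rightarrow> nat)"
    and lim: "(\<lambda>i. integral {0..T} (\<lambda>t. norm (f (\<kappa> i) t - v t))) \<longlonglongrightarrow> 0"
    by (rule bounded_L2_Cauchy_converges[OF T fc fbd cauchy], assumption, rule that, assumption+)
  have vc: "v \<in> controls T" by (rule controls_bounded[OF v(1,2)])
  show ?thesis
  proof (rule that[OF vc v(2)])
    fix e :: real assume "e > 0"
    then obtain N where "\<forall>n\<ge>N. norm (integral {0..T} (\<lambda>t. norm (f (\<kappa> n) t - v t)) - 0) < e"
      using LIMSEQ_D[OF lim] by blast
    then have "\<bar>integral {0..T} (\<lambda>t. norm (f (\<kappa> N) t - v t))\<bar> < e"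
      unfolding diff_zero real_norm_def by blast
    then have "integral {0..T} (\<lambda>t. norm (f (\<kappa> N) t - v t)) < e"
      by (rule le_less_trans[OF abs_ge_self])
    then show "\<exists>g. continuous_on {0..T} g \<and> integral {0..T} (\<lambda>t. norm (g t - v t)) < e"
      using f(1)[of "\<kappa> N"] unfolding \<K>_def by blast
  next
    fix t assume t: "t \<in> {0..T}"
    have vi: "v integrable_on {0..t}"
      using abs_integrable_sub[OF controls_abs_integrable[OF vc], of 0 t] t by (auto intro: abs_int_integrable)
    have "norm (integral {0..t} (f (\<kappa> i)) - integral {0..t} v) \<le> integral {0..T} (\<lambda>t. norm (f (\<kappa> i) t - v t))" for i
    proof -
      note n = controls_norm_integrable[OF controls_diff[OF fc vc]]
      have nt: "(\<lambda>t. norm (f (\<kappa> i) t - v t)) integrable_on {0..t}"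
        using integrable_on_subinterval[OF n, of 0 t] t by auto
      have "integral {0..t} (f (\<kappa> i)) - integral {0..t} v = integral {0..t} (\<lambda>s. f (\<kappa> i) s - v s)"
        by (rule integral_diff[OF intK[OF f(1) t] vi, symmetric])
      also have "norm \<dots> \<le> integral {0..t} (\<lambda>t. norm (f (\<kappa> i) t - v t))"
        by (intro integral_norm_bound_integral integrable_diff intK[OF f(1) t] vi nt) auto
      also have "\<dots> \<le> integral {0..T} (\<lambda>t. norm (f (\<kappa> i) t - v t))"
        using t by (intro integral_subset_le nt n) auto
      finally show ?thesis .
    qed
    then have "(\<lambda>i. integral {0..t} (f (\<kappa> i)) - integral {0..t} v) \<longlonglongrightarrow> 0"
      by (intro Lim_null_comparison[OF _ lim] always_eventually) simp
    then have l1: "(\<lambda>i. integral {0..t} (f (\<kappa> i))) \<longlonglongrightarrow> integral {0..t} v" by (simp add: LIM_zero_iff)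
    have dk: "(\<lambda>i. d (\<kappa> i)) \<longlonglongrightarrow> 0" using LIMSEQ_subseq_LIMSEQ[OF dlim v(3)] by (simp add: o_def)
    have nle: "\<forall>i. norm (integral {0..t} (f (\<kappa> i)) - (V t - V 0)) \<le> d (\<kappa> i)"
      using f(1) t unfolding \<K>_def by blast
    have "(\<lambda>i. integral {0..t} (f (\<kappa> i)) - (V t - V 0)) \<longlonglongrightarrow> 0"
      by (rule Lim_null_comparison[OF always_eventually[OF nle] dk])
    then have "(\<lambda>i. integral {0..t} (f (\<kappa> i))) \<longlonglongrightarrow> V t - V 0" by (simp only: LIM_zero_iff)
    with l1 show "integral {0..t} v = V t - V 0" by (rule LIMSEQ_unique)
  qed
qed

section \<open>Reparametrization by arc length\<close>

text \<open>Freezing the state at the left end of an interval: this compares the increment of a trajectory with the velocity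
defined by the increment of the primitive of its control.\<close>

lemma frozen_velocity_integral:
  fixes F :: "'m::finite \<Rightarrow> real^'n \<Rightarrow> real^'n"
  assumes ab: "a \<le> b" and v: "v absolutely_integrable_on {a..b}"
    and vel: "(\<lambda>s. velocity F (v s) (z s)) integrable_on {a..b}"
    and K: "\<And>s. s \<in> {a..b} \<Longrightarrow> norm (velocity F (v s) (z s) - velocity F (v s) (z a)) \<le> K * norm (v s) * \<rho>"
  shows "norm (integral {a..b} (\<lambda>s. velocity F (v s) (z s)) - velocity F (integral {a..b} v) (z a))
           \<le> K * \<rho> * integral {a..b} (\<lambda>s. norm (v s))"
proof -
  have iv: "v integrable_on {a..b}" by (rule abs_int_integrable[OF v])
  have fr: "((\<lambda>s. velocity F (v s) (z a)) has_integral velocity F (integral {a..b} v) (z a)) {a..b}"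
    using has_integral_linear[OF integrable_integral[OF iv] bounded_linear_velocity, of F "z a"] by (simp add: o_def)
  have "integral {a..b} (\<lambda>s. velocity F (v s) (z s)) - velocity F (integral {a..b} v) (z a)
      = integral {a..b} (\<lambda>s. velocity F (v s) (z s) - velocity F (v s) (z a))"
    using integral_diff[OF vel has_integral_integrable[OF fr]] integral_unique[OF fr] by simp
  also have "norm \<dots> \<le> integral {a..b} (\<lambda>s. K * \<rho> * norm (v s))"
  proof (rule integral_norm_bound_integral)
    show "(\<lambda>s. velocity F (v s) (z s) - velocity F (v s) (z a)) integrable_on {a..b}"
      using vel fr by (intro integrable_diff) auto
    show "(\<lambda>s. K * \<rho> * norm (v s)) integrable_on {a..b}"
      by (intro integrable_on_mult_right abs_int_norm_integrable[OF v])
    show "norm (velocity F (v s) (z s) - velocity F (v s) (z a)) \<le> K * \<rho> * norm (v s)" if "s \<in> {a..b}" for s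
      using K[OF that] by (simp add: mult_ac)
  qed
  finally show ?thesis by simp
qed

lemma trajectory_diff_eq_integral:
  assumes C1: "C1_frame F DF" and v: "v \<in> controls T" and q: "trajectory F T x v q" and st: "0 \<le> s" "s \<le> t" "t \<le> T"
  shows "q t - q s = integral {s..t} (\<lambda>\<tau>. velocity F (v \<tau>) (q \<tau>))"
proof -
  have "(\<lambda>\<tau>. velocity F (v \<tau>) (q \<tau>)) integrable_on {0..T}"
    by (intro abs_int_integrable velocity_abs_integrable v trajectory_continuous[OF q] C1_frame_cont[OF C1])
  from integral_diff_Icc[OF this st] show ?thesis
    using trajectory_eq_integral[OF q, of s] trajectory_eq_integral[OF q, of t] st by simp
qed

text \<open>Arc length itself may fail to be an admissible change of time, as it is constant where $v$ vanishes; a small multiple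
of $t$ is added to it and the sum \<open>s(t)\<close> is rescaled to take values in $[0, r]$. The strict inequality on the length leaves room for that.
In the new time the primitive $V$ of $v$ is $c$-Lipschitz, so it is the primitive of a control $w$ bounded by $c$.
The reparametrized curve is the trajectory of $w$ for the following reason: over an interval of length \<open>\<ell>\<close>, both its increment and the integral of the velocity of $w$ are within $O($\<open>\<ell>\<close>$^2)$ of the velocity defined by the common
increment of $V$, so that their difference is constant.\<close>

lemma arclength_reparametrization:
  fixes F :: "'m::finite \<Rightarrow> real^'n \<Rightarrow> real^'n"
  assumes C1: "C1_frame F DF" and S: "0 < S" and v: "v \<in> controls S" and q: "trajectory F S 0 v q"
    and r: "0 < r" and c: "0 < c" and len: "traj_length S v < c * r"
  obtains w y where "w \<in> controls r" "\<And>t. norm (w t) \<le> c" "trajectory F r 0 w y" "y r = q S"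
proof -
  let ?nv = "\<lambda>s. norm (v s)"
  have nv: "?nv integrable_on {0..S}" by (rule controls_norm_integrable[OF v])
  \<comment> \<open>the weight of t that makes the new time run exactly to r\<close>
  define \<eta> where "\<eta> = (c * r - traj_length S v) / S"
  have eta: "\<eta> > 0" using len S by (simp add: \<eta>_def)
  define s where "s t = (integral {0..t} ?nv + \<eta> * t) / c" for t
  define V where "V t = integral {0..t} v" for t
  have V_diff: "norm (V t2 - V t1) \<le> integral {t1..t2} ?nv" and nv_le: "integral {t1..t2} ?nv \<le> c * (s t2 - s t1)"
    and s_mono: "s t1 + \<eta> * (t2 - t1) / c \<le> s t2"
    if t: "0 \<le> t1" "t1 \<le> t2" "t2 \<le> S" for t1 t2
  proof -
    have "V t2 - V t1 = integral {t1..t2} v"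
      unfolding V_def by (rule integral_diff_Icc[OF abs_int_integrable[OF controls_abs_integrable[OF v]] t])
    then show "norm (V t2 - V t1) \<le> integral {t1..t2} ?nv"
      using t abs_integrable_sub[OF controls_abs_integrable[OF v], of t1 t2]
      by (simp add: integral_norm_bound_integral abs_int_integrable abs_int_norm_integrable)
    have d: "c * (s t2 - s t1) = integral {t1..t2} ?nv + \<eta> * (t2 - t1)"
      using integral_diff_Icc[OF nv t] c by (simp add: s_def field_simps)
    then show "integral {t1..t2} ?nv \<le> c * (s t2 - s t1)" using eta t by simp
    have "0 \<le> integral {t1..t2} ?nv"
      using t integrable_on_subinterval[OF nv, of t1 t2] by (intro integral_nonneg) auto
    then have "\<eta> * (t2 - t1) \<le> c * (s t2 - s t1)" using d by simp
    then show "s t1 + \<eta> * (t2 - t1) / c \<le> s t2" using c by (simp add: field_simps)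
  qed
  have s0: "s 0 = 0" by (simp add: s_def)
  have sS: "s S = r" using S c by (simp add: s_def \<eta>_def traj_length_def)
  have s_less: "s t1 < s t2" if "0 \<le> t1" "t1 < t2" "t2 \<le> S" for t1 t2
  proof -
    have "0 < \<eta> * (t2 - t1) / c" using eta c that by simp
    then show ?thesis using s_mono[of t1 t2] that by linarith
  qed
  have conts: "continuous_on {0..S} s"
    unfolding s_def using c by (intro continuous_intros indefinite_integral_continuous_1[OF nv]) auto
  have "\<exists>t\<in>{0..S}. s t = x" if "x \<in> {0..r}" for x
    using IVT'[of s 0 x S] that s0 sS S conts by auto
  then obtain \<theta> where th: "\<And>x. x \<in> {0..r} \<Longrightarrow> \<theta> x \<in> {0..S}" "\<And>x. x \<in> {0..r} \<Longrightarrow> s (\<theta> x) = x" by metis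
  have th_mono: "\<theta> x1 \<le> \<theta> x2" if "x1 \<in> {0..r}" "x2 \<in> {0..r}" "x1 \<le> x2" for x1 x2
  proof (rule ccontr)
    assume "\<not> \<theta> x1 \<le> \<theta> x2"
    then have "s (\<theta> x2) < s (\<theta> x1)" using th(1)[OF that(1)] th(1)[OF that(2)] by (intro s_less) auto
    then show False using th(2)[OF that(1)] th(2)[OF that(2)] that(3) by simp
  qed
  have th0: "\<theta> 0 = 0"
    using s_less[of 0 "\<theta> 0"] th(1)[of 0] th(2)[of 0] s0 r by force
  have thr: "\<theta> r = S"
    using s_less[of "\<theta> r" S] th(1)[of r] th(2)[of r] sS r by force
  have nv_th: "integral {\<theta> x1..\<theta> x2} ?nv \<le> c * (x2 - x1)" if "x1 \<in> {0..r}" "x2 \<in> {0..r}" "x1 \<le> x2" for x1 x2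
    using nv_le[of "\<theta> x1" "\<theta> x2"] th(1)[OF that(1)] th(1)[OF that(2)] th(2)[OF that(1)] th(2)[OF that(2)] th_mono[OF that] by simp
  have V_th: "norm (V (\<theta> x2) - V (\<theta> x1)) \<le> c * (x2 - x1)" if "x1 \<in> {0..r}" "x2 \<in> {0..r}" "x1 \<le> x2" for x1 x2
    using V_diff[of "\<theta> x1" "\<theta> x2"] nv_th[OF that] th(1)[OF that(1)] th(1)[OF that(2)] th_mono[OF that] by simp
  have V_lip: "norm (V (\<theta> t) - V (\<theta> s)) \<le> c * \<bar>t - s\<bar>" if "s \<in> {0..r}" "t \<in> {0..r}" for s t
    using V_th[of s t] V_th[of t s] that by (cases "s \<le> t") (auto simp: norm_minus_commute)
  obtain w where w: "w \<in> controls r" "\<And>t. norm (w t) \<le> c"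
    "\<And>t. t \<in> {0..r} \<Longrightarrow> integral {0..t} w = V (\<theta> t) - V (\<theta> 0)"
    by (rule lipschitz_density[of r c "\<lambda>x. V (\<theta> x)", OF less_imp_le[OF r] less_imp_le[OF c] V_lip],
        assumption, assumption, rule that, assumption+)
  have w_diff: "integral {x1..x2} w = V (\<theta> x2) - V (\<theta> x1)" if "0 \<le> x1" "x1 \<le> x2" "x2 \<le> r" for x1 x2
    using integral_diff_Icc[OF abs_int_integrable[OF controls_abs_integrable[OF w(1)]] that] w(3)[of x1] w(3)[of x2] that by simp
  obtain R where R: "0 \<le> R" "\<And>t. t \<in> {0..S} \<Longrightarrow> norm (q t) \<le> R" using trajectory_bounded[OF q] by blast
  obtain K B where G: "lipschitz_frame (cutoff R F) K B" using cutoff_lipschitz_frame[OF C1 R(1)] by blast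
  have K0: "0 \<le> K" and B0: "0 \<le> B" using G by (auto simp: lipschitz_frame_def)
  have lipF: "norm (velocity F a x - velocity F a x') \<le> K * norm a * norm (x - x')"
    if "norm x \<le> R" "norm x' \<le> R" for a x x'
    using G velocity_cutoff_eq[OF that(1), of F a] velocity_cutoff_eq[OF that(2), of F a]
    unfolding lipschitz_frame_def by metis
  have bdF: "norm (velocity F a x) \<le> B * norm a" if "norm x \<le> R" for a x
    using G velocity_cutoff_eq[OF that, of F a] unfolding lipschitz_frame_def by metis
  define y where "y x = q (\<theta> x)" for x
  have yR: "norm (y x) \<le> R" if "x \<in> {0..r}" for x using R(2) th(1)[OF that] by (simp add: y_def)
  have q_vel: "(\<lambda>\<tau>. velocity F (v \<tau>) (q \<tau>)) integrable_on {t1..t2}" if "0 \<le> t1" "t2 \<le> S" for t1 t2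
    by (rule abs_int_integrable, rule abs_integrable_sub[OF velocity_abs_integrable[OF v trajectory_continuous[OF q] C1_frame_cont[OF C1]]])
       (use that in auto)
  have q_lip: "norm (q t2 - q t1) \<le> B * integral {t1..t2} ?nv" if t: "0 \<le> t1" "t1 \<le> t2" "t2 \<le> S" for t1 t2
  proof -
    have "norm (q t2 - q t1) \<le> integral {t1..t2} (\<lambda>\<tau>. B * norm (v \<tau>))"
      unfolding trajectory_diff_eq_integral[OF C1 v q t]
    proof (rule integral_norm_bound_integral)
      show "(\<lambda>\<tau>. B * norm (v \<tau>)) integrable_on {t1..t2}"
        using t by (intro integrable_on_mult_right integrable_on_subinterval[OF nv]) auto
      show "norm (velocity F (v \<tau>) (q \<tau>)) \<le> B * norm (v \<tau>)" if "\<tau> \<in> {t1..t2}" for \<tau>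
        using that t by (intro bdF R(2)) auto
    qed (use q_vel t in auto)
    then show ?thesis by simp
  qed
  have y_lip: "norm (y x2 - y x1) \<le> B * c * (x2 - x1)" if x: "x1 \<in> {0..r}" "x2 \<in> {0..r}" "x1 \<le> x2" for x1 x2
  proof -
    have "norm (y x2 - y x1) \<le> B * integral {\<theta> x1..\<theta> x2} ?nv"
      unfolding y_def using th(1)[OF x(1)] th(1)[OF x(2)] th_mono[OF x] by (intro q_lip) auto
    also have "\<dots> \<le> B * (c * (x2 - x1))" by (intro mult_left_mono nv_th x B0)
    finally show ?thesis by (simp add: mult.assoc)
  qed
  have conty: "continuous_on {0..r} y"
  proof (rule lipschitz_on_continuous_on[of "B * c"], rule lipschitz_onI)
    show "dist (y x1) (y x2) \<le> B * c * dist x1 x2" if "x1 \<in> {0..r}" "x2 \<in> {0..r}" for x1 x2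
      using y_lip[of x1 x2] y_lip[of x2 x1] that
      by (cases "x1 \<le> x2") (auto simp: dist_norm norm_minus_commute)
  qed (use B0 c in auto)
  define I where "I x = integral {0..x} (\<lambda>s. velocity F (w s) (y s))" for x
  have y_vel_abs: "(\<lambda>s. velocity F (w s) (y s)) absolutely_integrable_on {0..r}"
    by (rule velocity_abs_integrable[OF w(1) conty C1_frame_cont[OF C1]])
  have inc: "norm ((y x2 - I x2) - (y x1 - I x1)) \<le> 2 * K * B * c\<^sup>2 * (x2 - x1)\<^sup>2"
    if x: "0 \<le> x1" "x1 \<le> x2" "x2 \<le> r" for x1 x2
  proof -
    let ?\<rho> = "B * c * (x2 - x1)"
    have xx: "x1 \<in> {0..r}" "x2 \<in> {0..r}" using x by auto
    have tt: "0 \<le> \<theta> x1" "\<theta> x1 \<le> \<theta> x2" "\<theta> x2 \<le> S" using th(1)[OF xx(1)] th(1)[OF xx(2)] th_mono[OF xx x(2)] by auto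
    have \<rho>0: "0 \<le> ?\<rho>" using B0 c x by simp
    have 1: "norm (integral {\<theta> x1..\<theta> x2} (\<lambda>s. velocity F (v s) (q s)) - velocity F (integral {\<theta> x1..\<theta> x2} v) (q (\<theta> x1)))
        \<le> K * ?\<rho> * integral {\<theta> x1..\<theta> x2} ?nv"
    proof (rule frozen_velocity_integral[OF tt(2)])
      show "v absolutely_integrable_on {\<theta> x1..\<theta> x2}" using abs_integrable_sub[OF controls_abs_integrable[OF v]] tt by auto
      show "(\<lambda>s. velocity F (v s) (q s)) integrable_on {\<theta> x1..\<theta> x2}" using q_vel tt by auto
      fix t assume t: "t \<in> {\<theta> x1..\<theta> x2}"
      have "norm (q t - q (\<theta> x1)) \<le> B * integral {\<theta> x1..t} ?nv" using t tt by (intro q_lip) auto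
      also have "\<dots> \<le> B * integral {\<theta> x1..\<theta> x2} ?nv"
        using t tt B0 by (intro mult_left_mono integral_subset_le integrable_on_subinterval[OF nv]) auto
      also have "\<dots> \<le> B * (c * (x2 - x1))" by (intro mult_left_mono nv_th xx x B0)
      finally have "norm (q t - q (\<theta> x1)) \<le> ?\<rho>" by (simp add: mult.assoc)
      moreover have "norm (velocity F (v t) (q t) - velocity F (v t) (q (\<theta> x1))) \<le> K * norm (v t) * norm (q t - q (\<theta> x1))"
        using t tt by (intro lipF R(2)) auto
      ultimately show "norm (velocity F (v t) (q t) - velocity F (v t) (q (\<theta> x1))) \<le> K * norm (v t) * ?\<rho>"
        using K0 by (meson mult_left_mono mult_nonneg_nonneg norm_ge_zero order_trans)
    qed
    have 2: "norm (integral {x1..x2} (\<lambda>s. velocity F (w s) (y s)) - velocity F (integral {x1..x2} w) (y x1))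
        \<le> K * ?\<rho> * integral {x1..x2} (\<lambda>s. norm (w s))"
    proof (rule frozen_velocity_integral[OF x(2)])
      show "w absolutely_integrable_on {x1..x2}" using abs_integrable_sub[OF controls_abs_integrable[OF w(1)]] x by auto
      show "(\<lambda>s. velocity F (w s) (y s)) integrable_on {x1..x2}"
        using abs_int_integrable[OF abs_integrable_sub[OF y_vel_abs]] x by auto
      fix t assume t: "t \<in> {x1..x2}"
      have "norm (y t - y x1) \<le> B * c * (t - x1)" using t x by (intro y_lip) auto
      also have "\<dots> \<le> ?\<rho>" using t B0 c by (intro mult_left_mono) auto
      finally have "norm (y t - y x1) \<le> ?\<rho>" .
      moreover have "norm (velocity F (w t) (y t) - velocity F (w t) (y x1)) \<le> K * norm (w t) * norm (y t - y x1)"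
        using t x by (intro lipF yR) auto
      ultimately show "norm (velocity F (w t) (y t) - velocity F (w t) (y x1)) \<le> K * norm (w t) * ?\<rho>"
        using K0 by (meson mult_left_mono mult_nonneg_nonneg norm_ge_zero order_trans)
    qed
    have "integral {x1..x2} (\<lambda>s. norm (w s)) \<le> integral {x1..x2} (\<lambda>s. c)"
    proof (rule integral_le)
      show "(\<lambda>s. norm (w s)) integrable_on {x1..x2}"
        using x abs_int_norm_integrable[OF abs_integrable_sub[OF controls_abs_integrable[OF w(1)]]] by simp
      show "(\<lambda>s. c) integrable_on {x1..x2}" by (rule integrable_continuous_real) simp
    qed (rule w(2))
    then have nw: "integral {x1..x2} (\<lambda>s. norm (w s)) \<le> c * (x2 - x1)" using x by (simp add: mult.commute)
    have Ii: "I x2 - I x1 = integral {x1..x2} (\<lambda>s. velocity F (w s) (y s))"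
      unfolding I_def by (rule integral_diff_Icc[OF abs_int_integrable[OF y_vel_abs] x])
    have vi: "integral {\<theta> x1..\<theta> x2} v = integral {x1..x2} w"
      unfolding w_diff[OF x] V_def
      by (rule integral_diff_Icc[OF abs_int_integrable[OF controls_abs_integrable[OF v]] tt, symmetric])
    have "(y x2 - I x2) - (y x1 - I x1) = (integral {\<theta> x1..\<theta> x2} (\<lambda>s. velocity F (v s) (q s)) - velocity F (integral {\<theta> x1..\<theta> x2} v) (q (\<theta> x1)))
       - (integral {x1..x2} (\<lambda>s. velocity F (w s) (y s)) - velocity F (integral {x1..x2} w) (y x1))"
      using trajectory_diff_eq_integral[OF C1 v q tt] Ii unfolding vi by (simp add: y_def algebra_simps)
    also have "norm \<dots> \<le> K * ?\<rho> * integral {\<theta> x1..\<theta> x2} ?nv + K * ?\<rho> * integral {x1..x2} (\<lambda>s. norm (w s))"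
      by (rule order_trans[OF norm_triangle_ineq4 add_mono[OF 1 2]])
    also have "\<dots> \<le> K * ?\<rho> * (c * (x2 - x1)) + K * ?\<rho> * (c * (x2 - x1))"
      using K0 \<rho>0 by (intro add_mono mult_left_mono nv_th xx x nw) auto
    also have "\<dots> = 2 * K * B * c\<^sup>2 * (x2 - x1)\<^sup>2" by (simp add: power2_eq_square algebra_simps)
    finally show ?thesis .
  qed
  define M where "M = 2 * K * B * c\<^sup>2"
  have M0: "0 \<le> M" using K0 B0 by (simp add: M_def)
  have yI: "y X = I X" if X: "X \<in> {0..r}" for X
  proof -
    have "y X - I X = y 0 - I 0"
    proof (rule constant_if_increments_negligible[where N="\<lambda>t. t" and h="\<lambda>x. y x - I x"])
      fix e :: real assume e: "e > 0"
      have "norm ((y t - I t) - (y s - I s)) \<le> e * (t - s)"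
        if st: "0 \<le> s" "s \<le> t" "t \<le> X" "t - s < e / (M + 1)" for s t
      proof -
        have "M * (t - s) \<le> (M + 1) * (e / (M + 1))" using st M0 by (intro mult_mono) auto
        also have "\<dots> = e" using M0 by simp
        finally have "M * (t - s) * (t - s) \<le> e * (t - s)" using st by (intro mult_right_mono) auto
        moreover have "norm ((y t - I t) - (y s - I s)) \<le> M * (t - s)\<^sup>2"
          using inc[OF st(1,2)] st X by (simp add: M_def)
        ultimately show ?thesis by (simp add: power2_eq_square)
      qed
      then show "\<exists>d>0. \<forall>s t. 0 \<le> s \<longrightarrow> s \<le> t \<longrightarrow> t \<le> X \<longrightarrow> t - s < d \<longrightarrow> norm ((y t - I t) - (y s - I s)) \<le> e * (t - s)"
        using e M0 by (intro exI[of _ "e / (M + 1)"]) auto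
    qed (use X in auto)
    moreover have "y 0 = 0" using trajectory_start[OF q] S by (simp add: y_def th0)
    moreover have "I 0 = 0" by (simp add: I_def)
    ultimately show ?thesis by simp
  qed
  have "trajectory F r 0 w y"
    unfolding trajectory_def
  proof
    fix t assume t: "t \<in> {0..r}"
    have "(\<lambda>s. velocity F (w s) (y s)) integrable_on {0..t}"
      using abs_int_integrable[OF abs_integrable_sub[OF y_vel_abs, of 0 t]] t by auto
    then show "((\<lambda>s. velocity F (w s) (y s)) has_integral (y t - 0)) {0..t}"
      using yI[OF t] by (simp add: I_def integrable_integral)
  qed
  moreover have "y r = q S" by (simp add: y_def thr)
  ultimately show ?thesis using w(1,2) that by blast
qed

section \<open>Weak convergence of controls\<close>

lemma mult_half_quotient: "0 \<le> x \<Longrightarrow> (x + 1) * (e / (2 * (x + 1))) = e / 2" for x e :: real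
  by (simp add: divide_simps)

text \<open>Bounded functions $g$ with a uniformly small primitive have a small integral against any given continuous function: on each
interval of a fine subdivision the latter is almost constant.\<close>

lemma weakly_small_integral:
  fixes f :: "real \<Rightarrow> 'b::euclidean_space" and prod :: "'a::euclidean_space \<Rightarrow> 'b \<Rightarrow> 'c::euclidean_space"
  assumes bil: "bounded_bilinear prod" and T: "0 \<le> T" and f: "continuous_on {0..T} f" and e: "e > 0" and M: "0 \<le> M"
  shows "\<exists>\<rho>>0. \<forall>g t. g absolutely_integrable_on {0..T} \<longrightarrow> (\<forall>s\<in>{0..T}. norm (g s) \<le> M) \<longrightarrow>
      (\<forall>s\<in>{0..T}. norm (integral {0..s} g) \<le> \<rho>) \<longrightarrow> t \<in> {0..T} \<longrightarrow>
      norm (integral {0..t} (\<lambda>s. prod (g s) (f s))) \<le> e"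
proof -
  interpret bounded_bilinear prod by (rule bil)
  obtain K where K: "K > 0" "\<And>a b. norm (prod a b) \<le> norm a * norm b * K" using pos_bounded by blast
  have "bounded (f ` {0..T})" by (intro compact_imp_bounded compact_continuous_image f) auto
  then obtain B where B: "B > 0" "\<And>s. s \<in> {0..T} \<Longrightarrow> norm (f s) \<le> B" unfolding bounded_pos by auto
  define \<eta> where "\<eta> = e / (2 * (M * K * T + 1))"
  have MKT: "0 \<le> M * K * T" using M K T by simp
  have eta: "\<eta> > 0" using e MKT by (simp add: \<eta>_def)
  obtain d where d: "d > 0" "\<And>s t. s \<in> {0..T} \<Longrightarrow> t \<in> {0..T} \<Longrightarrow> dist t s < d \<Longrightarrow> dist (f t) (f s) < \<eta>"
    using compact_uniformly_continuous[OF f] eta unfolding uniformly_continuous_on_def by (metis compact_Icc)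
  obtain n :: nat where n: "T \<le> real n * (d / 2)"
    using d real_arch_simple[of "T / (d/2)"] by (auto simp: field_simps)
  define \<rho> where "\<rho> = e / (2 * (2 * B * K * n + 1))"
  have nn: "0 \<le> 2 * B * K * n" using B K by simp
  have rho: "\<rho> > 0" using e nn by (simp add: \<rho>_def)
  show ?thesis
  proof (intro exI[of _ \<rho>] conjI allI impI rho)
    fix g :: "real \<Rightarrow> 'a" and t assume g: "g absolutely_integrable_on {0..T}" and gM': "\<forall>s\<in>{0..T}. norm (g s) \<le> M"
      and small': "\<forall>s\<in>{0..T}. norm (integral {0..s} g) \<le> \<rho>" and t: "t \<in> {0..T}"
    note gM = bspec[OF gM'] and small = bspec[OF small']
    let ?P = "\<lambda>s. prod (g s) (f s)"
    have P: "?P absolutely_integrable_on {0..T}" by (rule abs_int_bilinear_continuous2[OF bil f g])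
    have "norm (integral {0..t} ?P) \<le> real k * (2 * \<rho> * B * K) + M * \<eta> * K * t"
      if "t \<in> {0..T}" "t \<le> real k * (d / 2)" for k t
      using that
    proof (induction k arbitrary: t)
      case 0
      then have "t = 0" by simp
      then show ?case by simp
    next
      case (Suc k)
      define s where "s = max 0 (t - d/2)"
      have "t - d/2 \<le> real k * (d/2)" "0 \<le> real k * (d/2)"
        using Suc.prems(2) d(1) by (simp_all add: algebra_simps)
      then have s: "0 \<le> s" "s \<le> t" "s \<le> T" "t - s < d" "s \<le> real k * (d/2)" "t \<le> T"
        using Suc.prems(1) d(1) unfolding s_def atLeastAtMost_iff by linarith+
      have gi: "g integrable_on {s..t}" using abs_int_integrable[OF abs_integrable_sub[OF g]] s by auto
      have Pi: "?P integrable_on {s..t}" using abs_int_integrable[OF abs_integrable_sub[OF P]] s by auto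
      have h1: "((\<lambda>\<tau>. prod (g \<tau>) (f s)) has_integral prod (integral {s..t} g) (f s)) {s..t}"
        using has_integral_linear[OF integrable_integral[OF gi] bounded_linear_left, of "f s"] by (simp add: o_def)
      have h2: "((\<lambda>\<tau>. prod (g \<tau>) (f \<tau>) - prod (g \<tau>) (f s)) has_integral integral {s..t} ?P - prod (integral {s..t} g) (f s)) {s..t}"
        by (intro has_integral_diff h1 integrable_integral Pi)
      have "norm (integral {s..t} (\<lambda>\<tau>. prod (g \<tau>) (f \<tau>) - prod (g \<tau>) (f s))) \<le> integral {s..t} (\<lambda>\<tau>. M * \<eta> * K)"
      proof (rule integral_norm_bound_integral)
        show "(\<lambda>\<tau>. prod (g \<tau>) (f \<tau>) - prod (g \<tau>) (f s)) integrable_on {s..t}" using h2 by blast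
        show "(\<lambda>\<tau>. M * \<eta> * K) integrable_on {s..t}" by (rule integrable_continuous_real) simp
        fix \<tau> assume tau: "\<tau> \<in> {s..t}"
        have "norm (prod (g \<tau>) (f \<tau>) - prod (g \<tau>) (f s)) \<le> norm (g \<tau>) * norm (f \<tau> - f s) * K"
          using K(2)[of "g \<tau>" "f \<tau> - f s"] by (simp add: diff_right)
        also have "\<dots> \<le> M * \<eta> * K"
        proof (intro mult_right_mono mult_mono)
          show "norm (g \<tau>) \<le> M" using tau s by (intro gM) auto
          show "norm (f \<tau> - f s) \<le> \<eta>" using d(2)[of s \<tau>] tau s by (force simp: dist_norm)
        qed (use M K in auto)
        finally show "norm (prod (g \<tau>) (f \<tau>) - prod (g \<tau>) (f s)) \<le> M * \<eta> * K" .
      qed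
      then have n1: "norm (integral {s..t} ?P - prod (integral {s..t} g) (f s)) \<le> M * \<eta> * K * (t - s)"
        using h2 s by (simp add: integral_unique mult_ac)
      have "norm (integral {s..t} g) \<le> 2 * \<rho>"
      proof -
        have "integral {s..t} g = integral {0..t} g - integral {0..s} g"
          using integral_diff_Icc[OF abs_int_integrable[OF g] s(1,2,6)] by simp
        then show ?thesis
          using small[of t] small[of s] s norm_triangle_ineq4[of "integral {0..t} g" "integral {0..s} g"] by auto
      qed
      then have n2: "norm (prod (integral {s..t} g) (f s)) \<le> 2 * \<rho> * B * K"
        using K(1) B(2)[of s] s rho by (intro order_trans[OF K(2)] mult_right_mono mult_mono) auto
      have "integral {0..t} ?P = integral {0..s} ?P + (integral {s..t} ?P - prod (integral {s..t} g) (f s)) + prod (integral {s..t} g) (f s)"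
        using integral_diff_Icc[OF abs_int_integrable[OF P] s(1,2,6)] by (simp add: algebra_simps)
      then have "norm (integral {0..t} ?P) \<le> norm (integral {0..s} ?P) + norm (integral {s..t} ?P - prod (integral {s..t} g) (f s)) + norm (prod (integral {s..t} g) (f s))"
        by (metis (no_types, lifting) norm_triangle_le norm_triangle_ineq add_right_mono)
      also have "\<dots> \<le> (real k * (2 * \<rho> * B * K) + M * \<eta> * K * s) + M * \<eta> * K * (t - s) + 2 * \<rho> * B * K"
        using Suc.IH[of s] s n1 n2 by (intro add_mono) auto
      finally show ?case by (simp add: algebra_simps)
    qed
    from this[OF t, of n] have "norm (integral {0..t} ?P) \<le> real n * (2 * \<rho> * B * K) + M * \<eta> * K * t"
      using n t by auto
    also have "\<dots> \<le> e / 2 + e / 2"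
    proof (rule add_mono)
      have "real n * (2 * \<rho> * B * K) = (2 * B * K * n) * \<rho>" by simp
      also have "\<dots> \<le> (2 * B * K * n + 1) * \<rho>" using rho by simp
      also have "\<dots> = e / 2" unfolding \<rho>_def by (rule mult_half_quotient[OF nn])
      finally show "real n * (2 * \<rho> * B * K) \<le> e / 2" .
      have "M * \<eta> * K * t \<le> M * \<eta> * K * T" using t M eta K by (intro mult_left_mono) auto
      also have "\<dots> \<le> (M * K * T + 1) * \<eta>" using eta by (simp add: algebra_simps)
      also have "\<dots> = e / 2" unfolding \<eta>_def by (rule mult_half_quotient[OF MKT])
      finally show "M * \<eta> * K * t \<le> e / 2" .
    qed
    finally show "norm (integral {0..t} ?P) \<le> e" by simp
  qed
qed

lemma weakly_small_velocity:
  fixes F :: "'m::finite \<Rightarrow> real^'n \<Rightarrow> real^'n"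
  assumes T: "0 \<le> T" and F: "\<And>i. continuous_on UNIV (F i)" and q: "continuous_on {0..T} q" and e: "e > 0" and M: "0 \<le> M"
  shows "\<exists>\<rho>>0. \<forall>g t. g \<in> controls T \<longrightarrow> (\<forall>s. norm (g s) \<le> M) \<longrightarrow>
      (\<forall>s\<in>{0..T}. norm (integral {0..s} g) \<le> \<rho>) \<longrightarrow> t \<in> {0..T} \<longrightarrow>
      norm (integral {0..t} (\<lambda>s. velocity F (g s) (q s))) \<le> e"
proof -
  define e' where "e' = e / CARD('m)"
  have e': "e' > 0" using e by (simp add: e'_def)
  let ?p = "\<lambda>i (a::real^'m) b. (a $ i) *\<^sub>R (b::real^'n)"
  have bil: "bounded_bilinear (?p i)" for i
    by (rule bounded_bilinear.comp1[OF bounded_bilinear_scaleR bounded_linear_vec_nth])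
  have cont: "continuous_on {0..T} (\<lambda>s. F i (q s))" for i
    using continuous_on_compose2[OF F q] by simp
  define small where "small i \<rho> \<longleftrightarrow> (\<forall>g t. g \<in> controls T \<longrightarrow> (\<forall>s. norm (g s) \<le> M) \<longrightarrow>
      (\<forall>s\<in>{0..T}. norm (integral {0..s} g) \<le> \<rho>) \<longrightarrow> t \<in> {0..T} \<longrightarrow>
      norm (integral {0..t} (\<lambda>s. ?p i (g s) (F i (q s)))) \<le> e')" for i \<rho>
  have "\<exists>\<rho>>0. small i \<rho>" for i
  proof -
    obtain \<rho> where r: "\<rho> > 0" and s: "\<forall>g t. g absolutely_integrable_on {0..T} \<longrightarrow> (\<forall>s\<in>{0..T}. norm (g s) \<le> M) \<longrightarrow>
      (\<forall>s\<in>{0..T}. norm (integral {0..s} g) \<le> \<rho>) \<longrightarrow> t \<in> {0..T} \<longrightarrow>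
      norm (integral {0..t} (\<lambda>s. ?p i (g s) (F i (q s)))) \<le> e'"
      using weakly_small_integral[OF bil[of i] T cont[of i] e' M] by (elim exE conjE)
    show ?thesis unfolding small_def
      by (intro exI[of _ \<rho>] conjI allI impI r, rule s[rule_format]) (auto intro: controls_abs_integrable)
  qed
  then obtain \<rho>' where rho': "\<And>i. \<rho>' i > 0" and small: "\<And>i. small i (\<rho>' i)"
    by metis
  define \<rho> where "\<rho> = Min (range \<rho>')"
  have rho: "\<rho> > 0" "\<And>i. \<rho> \<le> \<rho>' i" unfolding \<rho>_def using rho' by (auto simp: Min_gr_iff)
  show ?thesis
  proof (intro exI[of _ \<rho>] conjI allI impI rho(1))
    fix g :: "real \<Rightarrow> real^'m" and t
    assume g: "g \<in> controls T" and gM: "\<forall>s. norm (g s) \<le> M"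
      and sm: "\<forall>s\<in>{0..T}. norm (integral {0..s} g) \<le> \<rho>" and t: "t \<in> {0..T}"
    have i1: "norm (integral {0..t} (\<lambda>s. ?p i (g s) (F i (q s)))) \<le> e'" for i
      using small[of i, unfolded small_def] g gM order_trans[OF bspec[OF sm] rho(2)[of i]] t by blast
    have int: "(\<lambda>s. ?p i (g s) (F i (q s))) integrable_on {0..t}" for i
      by (rule abs_int_integrable, rule abs_integrable_sub[OF abs_int_bilinear_continuous2[OF bil cont controls_abs_integrable[OF g]]])
         (use t in auto)
    have "integral {0..t} (\<lambda>s. velocity F (g s) (q s)) = (\<Sum>i\<in>UNIV. integral {0..t} (\<lambda>s. ?p i (g s) (F i (q s))))"
      unfolding velocity_def by (rule integral_sum) (auto intro: int)
    also have "norm \<dots> \<le> (\<Sum>i\<in>(UNIV::'m set). e')" by (rule sum_norm_le) (rule i1)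
    also have "\<dots> = e" by (simp add: e'_def)
    finally show "norm (integral {0..t} (\<lambda>s. velocity F (g s) (q s))) \<le> e" .
  qed
qed

text \<open>Continuity of the end-point mapping for the weak convergence of controls, expressed by the uniform convergence of
their primitives.\<close>

lemma weak_convergence_end_point:
  fixes F :: "'m::finite \<Rightarrow> real^'n \<Rightarrow> real^'n"
  assumes C1: "C1_frame F DF" and T: "0 \<le> T" and v: "v \<in> controls T" "\<And>t. norm (v t) \<le> 1"
    and q: "trajectory F T 0 v q" and e: "e > 0"
  obtains \<rho> where "\<rho> > 0" "\<And>w p. w \<in> controls T \<Longrightarrow> (\<And>s. norm (w s) \<le> 2) \<Longrightarrow> trajectory F T 0 w p \<Longrightarrow>
      (\<And>s. s \<in> {0..T} \<Longrightarrow> norm (integral {0..s} w - integral {0..s} v) \<le> \<rho>) \<Longrightarrow> norm (p T - q T) \<le> e"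
proof -
  obtain R0 where R0: "0 \<le> R0" "\<And>t. t \<in> {0..T} \<Longrightarrow> norm (q t) \<le> R0" using trajectory_bounded[OF q] by blast
  define R where "R = R0 + 1"
  define G where "G = cutoff R F"
  obtain K B where G: "lipschitz_frame G K B"
    unfolding G_def by (rule cutoff_lipschitz_frame[OF C1, of R]) (use R0(1) in \<open>auto simp: R_def\<close>)
  have K0: "0 \<le> K" using G by (simp add: lipschitz_frame_def)
  have qG: "trajectory G T 0 v q"
    unfolding G_def by (subst trajectory_cutoff) (use q R0 in \<open>force simp: R_def\<close>)+
  define E where "E = exp (K * (2 * T))"
  have E: "E > 0" by (simp add: E_def)
  define a where "a = min 1 e / E"
  have a: "a > 0" using e E by (simp add: a_def)
  have cG: "continuous_on UNIV (G i)" for i using G by (simp add: lipschitz_frame_def)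
  obtain \<rho> where rho: "\<rho> > 0" and small: "\<forall>g t. g \<in> controls T \<longrightarrow> (\<forall>s. norm (g s) \<le> 3) \<longrightarrow>
      (\<forall>s\<in>{0..T}. norm (integral {0..s} g) \<le> \<rho>) \<longrightarrow> t \<in> {0..T} \<longrightarrow>
      norm (integral {0..t} (\<lambda>s. velocity G (g s) (q s))) \<le> a"
    using weakly_small_velocity[of T G q a 3] T cG trajectory_continuous[OF q] a by auto
  show ?thesis
  proof (rule that[OF rho])
    fix w p assume w: "w \<in> controls T" "\<And>s. norm (w s) \<le> 2" and p: "trajectory F T 0 w p"
      and close: "\<And>s. s \<in> {0..T} \<Longrightarrow> norm (integral {0..s} w - integral {0..s} v) \<le> \<rho>"
    obtain p' where p': "trajectory G T 0 w p'" using lipschitz_frame_trajectory_exists[OF G w(1) T] by blast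
    have int: "c integrable_on {0..t}" if "c \<in> controls T" "t \<in> {0..T}" for c :: "real \<Rightarrow> real^'m" and t
      using abs_int_integrable[OF abs_integrable_sub[OF controls_abs_integrable[OF that(1)], of 0 t]] that(2) by auto
    have sm: "norm (integral {0..t} (\<lambda>s. velocity G (w s - v s) (q s))) \<le> a" if "t \<in> {0..T}" for t
    proof -
      have "norm (w s - v s) \<le> 3" for s
        using norm_triangle_ineq4[of "w s" "v s"] w(2)[of s] v(2)[of s] by linarith
      moreover have "norm (integral {0..s} (\<lambda>s. w s - v s)) \<le> \<rho>" if "s \<in> {0..T}" for s
        using close[OF that] by (simp add: integral_diff[OF int[OF w(1) that] int[OF v(1) that]])
      ultimately show ?thesis using small controls_diff[OF w(1) v(1)] that by blast
    qed
    have "integral {0..T} (\<lambda>s. norm (w s)) \<le> integral {0..T} (\<lambda>s. 2)"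
      by (intro integral_le controls_norm_integrable w integrable_continuous_real continuous_on_const)
    then have "K * integral {0..T} (\<lambda>s. norm (w s)) \<le> K * (2 * T)"
      using K0 T by (intro mult_left_mono) auto
    then have "a * exp (K * integral {0..T} (\<lambda>s. norm (w s))) \<le> a * E"
      using a by (simp add: E_def)
    also have "\<dots> = min 1 e" using E by (simp add: a_def)
    finally have ae: "a * exp (K * integral {0..T} (\<lambda>s. norm (w s))) \<le> min 1 e" .
    have near: "norm (p' t - q t) \<le> min 1 e" if "t \<in> {0..T}" for t
      using trajectory_stability[OF G w(1) v(1) p' qG sm that] ae by linarith
    have "norm (p' t) \<le> R" if t: "t \<in> {0..T}" for t
      using near[OF t] R0(2)[OF t] norm_triangle_ineq[of "p' t - q t" "q t"] by (simp add: R_def)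
    then have "trajectory F T 0 w p'" using p' unfolding G_def by (subst (asm) trajectory_cutoff) auto
    then have "p T = p' T" using trajectory_unique[OF C1 w(1) w(1) _ p, of p' T] T by simp
    then show "norm (p T - q T) \<le> e" using near[of T] T by simp
  qed
qed

lemma weakly_small_inner:
  fixes v :: "real \<Rightarrow> real^'m"
  assumes T: "0 \<le> T" and v: "v \<in> controls T"
    and dense: "\<And>e. e > 0 \<Longrightarrow> \<exists>g. continuous_on {0..T} g \<and> integral {0..T} (\<lambda>t. norm (g t - v t)) < e"
    and e: "e > 0" and M: "0 \<le> M"
  obtains \<rho> where "\<rho> > 0" "\<And>g. g \<in> controls T \<Longrightarrow> (\<And>s. norm (g s) \<le> M) \<Longrightarrow>
      (\<And>s. s \<in> {0..T} \<Longrightarrow> norm (integral {0..s} g) \<le> \<rho>) \<Longrightarrow> \<bar>integral {0..T} (\<lambda>s. g s \<bullet> v s)\<bar> \<le> e"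
proof -
  obtain c where c: "continuous_on {0..T} c" "integral {0..T} (\<lambda>t. norm (c t - v t)) < e / (2 * (M + 1))"
    using dense[of "e / (2 * (M + 1))"] e M by auto
  have cc: "c \<in> controls T" by (rule controls_continuous[OF c(1)])
  obtain \<rho> where rho: "\<rho> > 0" and small: "\<forall>g t. g absolutely_integrable_on {0..T} \<longrightarrow> (\<forall>s\<in>{0..T}. norm (g s) \<le> M) \<longrightarrow>
      (\<forall>s\<in>{0..T}. norm (integral {0..s} g) \<le> \<rho>) \<longrightarrow> t \<in> {0..T} \<longrightarrow>
      norm (integral {0..t} (\<lambda>s. g s \<bullet> c s)) \<le> e / 2"
    using weakly_small_integral[OF bounded_bilinear_inner T c(1) half_gt_zero[OF e] M] by blast
  show ?thesis
  proof (rule that[OF rho])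
    fix g :: "real \<Rightarrow> real^'m"
    assume g: "g \<in> controls T" and gM: "\<And>s. norm (g s) \<le> M"
      and sm: "\<And>s. s \<in> {0..T} \<Longrightarrow> norm (integral {0..s} g) \<le> \<rho>"
    note i1 = abs_int_integrable[OF controls_inner_abs_integrable[OF g cc]]
    note i2 = abs_int_integrable[OF controls_inner_abs_integrable[OF g v]]
    have "norm (integral {0..T} (\<lambda>s. g s \<bullet> c s - g s \<bullet> v s)) \<le> integral {0..T} (\<lambda>s. M * norm (c s - v s))"
    proof (rule integral_norm_bound_integral)
      show "(\<lambda>s. g s \<bullet> c s - g s \<bullet> v s) integrable_on {0..T}" by (rule integrable_diff[OF i1 i2])
      show "(\<lambda>s. M * norm (c s - v s)) integrable_on {0..T}"
        by (intro integrable_on_mult_right controls_norm_integrable controls_diff cc v)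
      fix s
      have "norm (g s \<bullet> c s - g s \<bullet> v s) \<le> norm (g s) * norm (c s - v s)"
        using Cauchy_Schwarz_ineq2[of "g s" "c s - v s"] by (simp add: inner_diff_right)
      also have "\<dots> \<le> M * norm (c s - v s)" by (intro mult_right_mono gM) simp
      finally show "norm (g s \<bullet> c s - g s \<bullet> v s) \<le> M * norm (c s - v s)" .
    qed
    also have "\<dots> = M * integral {0..T} (\<lambda>s. norm (c s - v s))" by simp
    also have "\<dots> \<le> M * (e / (2 * (M + 1)))" using c(2) M by (intro mult_left_mono) auto
    also have "\<dots> \<le> e / 2"
    proof -
      have "M * (e / (2 * (M + 1))) \<le> (M + 1) * (e / (2 * (M + 1)))" using M e by (intro mult_right_mono) auto
      also have "\<dots> = e / 2" by (rule mult_half_quotient[OF M])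
      finally show ?thesis .
    qed
    finally have "\<bar>integral {0..T} (\<lambda>s. g s \<bullet> c s) - integral {0..T} (\<lambda>s. g s \<bullet> v s)\<bar> \<le> e / 2"
      by (simp add: integral_diff[OF i1 i2])
    moreover have "\<bar>integral {0..T} (\<lambda>s. g s \<bullet> c s)\<bar> \<le> e / 2"
      using small[rule_format, OF controls_abs_integrable[OF g] gM sm, of T] T by simp
    ultimately show "\<bar>integral {0..T} (\<lambda>s. g s \<bullet> v s)\<bar> \<le> e" by linarith
  qed
qed

text \<open>By the theorem of Arzela and Ascoli, a subsequence of the primitives converges uniformly; the limit is $1$-Lipschitz and
thus has a density bounded by $1$.\<close>

lemma controls_weak_compactness:
  fixes w :: "nat \<Rightarrow> real \<Rightarrow> real^'m"
  assumes T: "0 \<le> T" and w: "\<And>k. w k \<in> controls T" and bd: "\<And>k s. norm (w k s) \<le> 1 + 1 / real (Suc k)"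
  obtains v \<kappa> where "v \<in> controls T" "\<And>t. norm (v t) \<le> 1" "strict_mono (\<kappa> :: nat \<Rightarrow> nat)"
    "\<And>e. e > 0 \<Longrightarrow> \<exists>g. continuous_on {0..T} g \<and> integral {0..T} (\<lambda>t. norm (g t - v t)) < e"
    "\<And>e. e > 0 \<Longrightarrow> \<exists>N. \<forall>n\<ge>N. \<forall>s\<in>{0..T}. norm (integral {0..s} (w (\<kappa> n)) - integral {0..s} v) < e"
proof -
  define W where "W k t = integral {0..t} (w k)" for k t
  have int: "w k integrable_on {s..t}" if "0 \<le> s" "t \<le> T" for k s t
    using abs_int_integrable[OF abs_integrable_sub[OF controls_abs_integrable[OF w] that]] .
  have W_lip1: "norm (W k t - W k s) \<le> (1 + 1 / real (Suc k)) * (t - s)" if "0 \<le> s" "s \<le> t" "t \<le> T" for k s t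
  proof -
    have "W k t - W k s = integral {s..t} (w k)"
      unfolding W_def using integral_diff_Icc[OF int[of 0 T] that] T by simp
    also have "norm \<dots> \<le> integral {s..t} (\<lambda>s. 1 + 1 / real (Suc k))"
      using that by (intro integral_norm_bound_integral int bd integrable_continuous_real continuous_on_const)
    also have "\<dots> = (1 + 1 / real (Suc k)) * (t - s)" using that by (simp add: mult.commute)
    finally show ?thesis .
  qed
  have W_lip: "norm (W k t - W k s) \<le> (1 + 1 / real (Suc k)) * \<bar>t - s\<bar>" if "s \<in> {0..T}" "t \<in> {0..T}" for k s t
    using W_lip1[of s t k] W_lip1[of t s k] that by (cases "s \<le> t") (auto simp: norm_minus_commute)
  have two: "1 + 1 / real (Suc k) \<le> 2" for k by simp
  have W0: "W k 0 = 0" for k by (simp add: W_def)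
  have W_lip2: "norm (W k t - W k s) \<le> 2 * \<bar>t - s\<bar>" if "s \<in> {0..T}" "t \<in> {0..T}" for k s t
    using order_trans[OF W_lip[OF that] mult_right_mono[OF two]] by simp
  obtain V \<kappa> where k: "strict_mono (\<kappa> :: nat \<Rightarrow> nat)"
    and conv: "\<And>e. 0 < e \<Longrightarrow> \<exists>N. \<forall>n x. n \<ge> N \<and> x \<in> {0..T} \<longrightarrow> norm (W (\<kappa> n) x - V x) < e"
  proof (rule Arzela_Ascoli[of "{0..T}" W "2 * T"])
    show "norm (W n x) \<le> 2 * T" if "x \<in> {0..T}" for n x
      using W_lip2[of 0 x n] that T by (simp add: W0)
    show "\<exists>d. 0 < d \<and> (\<forall>n y. y \<in> {0..T} \<and> norm (x - y) < d \<longrightarrow> norm (W n x - W n y) < e)"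
      if "x \<in> {0..T}" "0 < e" for x e
    proof (intro exI[of _ "e / 2"] conjI allI impI)
      show "norm (W n x - W n y) < e" if "y \<in> {0..T} \<and> norm (x - y) < e / 2" for n y
        using W_lip2[of y x n] \<open>x \<in> {0..T}\<close> that by auto
    qed (use that in simp)
  qed (auto intro: that)
  have pt: "(\<lambda>n. W (\<kappa> n) x) \<longlonglongrightarrow> V x" if "x \<in> {0..T}" for x
    by (rule LIMSEQ_I) (use conv that in blast)
  have V_lip: "norm (V t - V s) \<le> 1 * \<bar>t - s\<bar>" if st: "s \<in> {0..T}" "t \<in> {0..T}" for s t
  proof (rule LIMSEQ_le)
    show "(\<lambda>n. norm (W (\<kappa> n) t - W (\<kappa> n) s)) \<longlonglongrightarrow> norm (V t - V s)"
      by (intro tendsto_intros pt st)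
    have "(\<lambda>n. 1 / real (Suc (\<kappa> n))) \<longlonglongrightarrow> 0"
      using LIMSEQ_subseq_LIMSEQ[OF LIMSEQ_Suc[OF lim_1_over_n] k] by (simp add: o_def)
    then have "(\<lambda>n. (1 + 1 / real (Suc (\<kappa> n))) * \<bar>t - s\<bar>) \<longlonglongrightarrow> (1 + 0) * \<bar>t - s\<bar>"
      by (intro tendsto_intros)
    then show "(\<lambda>n. (1 + 1 / real (Suc (\<kappa> n))) * \<bar>t - s\<bar>) \<longlonglongrightarrow> 1 * \<bar>t - s\<bar>" by simp
    show "\<exists>N. \<forall>n\<ge>N. norm (W (\<kappa> n) t - W (\<kappa> n) s) \<le> (1 + 1 / real (Suc (\<kappa> n))) * \<bar>t - s\<bar>"
      using W_lip[OF st] by blast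
  qed
  have V0: "V 0 = 0" using LIMSEQ_unique[OF pt[of 0]] T by (simp add: W0)
  obtain v where v: "v \<in> controls T" "\<And>t. norm (v t) \<le> 1"
    and prim: "\<And>t. t \<in> {0..T} \<Longrightarrow> integral {0..t} v = V t - V 0"
    and dense: "\<And>e. e > 0 \<Longrightarrow> \<exists>g. continuous_on {0..T} g \<and> integral {0..T} (\<lambda>t. norm (g t - v t)) < e"
    by (rule lipschitz_density[of T 1 V, OF T zero_le_one V_lip], assumption, assumption, rule that, assumption+)
  show ?thesis
  proof (rule that[OF v k dense])
    show "\<exists>N. \<forall>n\<ge>N. \<forall>s\<in>{0..T}. norm (integral {0..s} (w (\<kappa> n)) - integral {0..s} v) < e" if "e > 0" for e
      using conv[OF that] prim V0 unfolding W_def by fastforce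
  qed
qed

section \<open>Almost minimizing controls\<close>

lemma energy_le_of_speed_le:
  assumes T: "0 \<le> T" and w: "w \<in> controls T" and bd: "\<And>t. norm (w t) \<le> 1 + \<epsilon>" and eps: "0 \<le> \<epsilon>" "\<epsilon> \<le> 1"
  shows "(L2_norm T w)\<^sup>2 \<le> (1 + 3 * \<epsilon>) * T"
proof -
  have "(L2_norm T w)\<^sup>2 = integral {0..T} (\<lambda>t. (norm (w t))\<^sup>2)" by (rule L2_norm_power2[OF w])
  also have "\<dots> \<le> integral {0..T} (\<lambda>t. (1 + \<epsilon>)\<^sup>2)"
    using bd by (intro integral_le controls_sq w integrable_continuous_real continuous_on_const power_mono) auto
  also have "\<dots> = (1 + \<epsilon>)\<^sup>2 * T" using T by (simp add: mult.commute)
  also have "\<dots> \<le> (1 + 3 * \<epsilon>) * T"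
  proof -
    have "\<epsilon> * \<epsilon> \<le> \<epsilon> * 1" using eps by (intro mult_left_mono) auto
    then have "(1 + \<epsilon>)\<^sup>2 \<le> 1 + 3 * \<epsilon>" by (simp add: power2_eq_square algebra_simps)
    then show ?thesis using T by (intro mult_right_mono) auto
  qed
  finally show ?thesis .
qed

text \<open>Otherwise there is a sequence of controls $w_k$ with speed bounds tending to $1$ and end-points tending to $A$ that stays away
from $u$. A weak limit $v$ of it is admissible and leads to $A$, so $v = u$ by uniqueness. Since $\|w_k\|^2$ is at most
$(1 + \varepsilon_k)^2 r$ with \<open>\<epsilon>\<^sub>k \<rightarrow> 0\<close> and $\|u\|^2 \ge r$, expanding $\|w_k - v\|^2$ shows that the convergence is strong.\<close>

lemma near_minimizers_converge:
  fixes F :: "'m::finite \<Rightarrow> real^'n \<Rightarrow> real^'n"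
  assumes C1: "C1_frame F DF" and r: "0 < r"
    and complete: "\<And>v. v \<in> controls r \<Longrightarrow> (\<forall>t. norm (v t) \<le> 1) \<Longrightarrow> \<exists>q. trajectory F r 0 v q"
    and u: "u \<in> controls r" and energy: "r \<le> (L2_norm r u)\<^sup>2"
    and uniq: "\<And>v q. v \<in> controls r \<Longrightarrow> (\<forall>t. norm (v t) \<le> 1) \<Longrightarrow> trajectory F r 0 v q \<Longrightarrow> q r = A
        \<Longrightarrow> AE t in lebesgue_on {0..r}. v t = u t"
    and d: "\<delta> > 0"
  shows "\<exists>\<kappa>>0. \<forall>w q. w \<in> controls r \<longrightarrow> (\<forall>t. norm (w t) \<le> 1 + \<kappa>) \<longrightarrow> trajectory F r 0 w q \<longrightarrow>
           norm (q r - A) < \<kappa> \<longrightarrow> L2_norm r (\<lambda>t. w t - u t) < \<delta>"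
proof (rule ccontr)
  assume neg: "\<not> ?thesis"
  have r0: "0 \<le> r" using r by simp
  define escapes where "escapes k w q \<longleftrightarrow> w \<in> controls r \<and> (\<forall>t. norm (w t) \<le> 1 + 1 / real (Suc k)) \<and>
      trajectory F r 0 w q \<and> norm (q r - A) < 1 / real (Suc k) \<and> \<not> L2_norm r (\<lambda>t. w t - u t) < \<delta>" for k w q
  have "\<exists>w q. escapes k w q" for k
  proof -
    have "0 < 1 / real (Suc k)" by simp
    with neg show ?thesis unfolding escapes_def by blast
  qed
  then obtain w q where escapes: "\<And>k. escapes k (w k) (q k)" by metis
  have w: "\<And>k. w k \<in> controls r" and bd: "\<And>k t. norm (w k t) \<le> 1 + 1 / real (Suc k)"
    and q: "\<And>k. trajectory F r 0 (w k) (q k)" and qA: "\<And>k. norm (q k r - A) < 1 / real (Suc k)"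
    and far: "\<And>k. \<not> L2_norm r (\<lambda>t. w k t - u t) < \<delta>"
    using escapes unfolding escapes_def by blast+
  obtain v \<kappa> where v: "v \<in> controls r" "\<And>t. norm (v t) \<le> 1" and k: "strict_mono (\<kappa> :: nat \<Rightarrow> nat)"
    and dense: "\<And>e. e > 0 \<Longrightarrow> \<exists>g. continuous_on {0..r} g \<and> integral {0..r} (\<lambda>t. norm (g t - v t)) < e"
    and conv: "\<And>e. e > 0 \<Longrightarrow> \<exists>N. \<forall>n\<ge>N. \<forall>s\<in>{0..r}. norm (integral {0..s} (w (\<kappa> n)) - integral {0..s} v) < e"
    by (rule controls_weak_compactness[OF r0 w bd], rule that, assumption+)
  have kn: "n \<le> \<kappa> n" for n by (rule seq_suble[OF k])
  have inv: "1 / real (Suc (\<kappa> n)) \<le> 1 / real (Suc n)" for n using kn[of n] by (simp add: frac_le)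
  obtain z where z: "trajectory F r 0 v z" using complete v by blast
  have "norm (z r - A) \<le> 0"
  proof (rule field_le_epsilon)
    fix e :: real assume e: "e > 0"
    obtain \<rho> where rho: "\<rho> > 0" and close: "\<And>x p. x \<in> controls r \<Longrightarrow> (\<And>s. norm (x s) \<le> 2) \<Longrightarrow> trajectory F r 0 x p \<Longrightarrow>
      (\<And>s. s \<in> {0..r} \<Longrightarrow> norm (integral {0..s} x - integral {0..s} v) \<le> \<rho>) \<Longrightarrow> norm (p r - z r) \<le> e / 2"
      using weak_convergence_end_point[OF C1 r0 v z half_gt_zero[OF e]] by blast
    obtain N where N: "\<forall>n\<ge>N. \<forall>s\<in>{0..r}. norm (integral {0..s} (w (\<kappa> n)) - integral {0..s} v) < \<rho>"
      using conv[OF rho] by blast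
    obtain M :: nat where M: "1 / real (Suc M) < e / 2" using nat_approx_posE[OF half_gt_zero[OF e]] by blast
    let ?n = "max N M"
    have "norm (q (\<kappa> ?n) r - z r) \<le> e / 2"
    proof (rule close[OF w _ q])
      show "norm (w (\<kappa> ?n) s) \<le> 2" for s
      proof -
        have "1 / real (Suc (\<kappa> ?n)) \<le> 1" by simp
        then show ?thesis using bd[of "\<kappa> ?n" s] by linarith
      qed
      show "norm (integral {0..s} (w (\<kappa> ?n)) - integral {0..s} v) \<le> \<rho>" if "s \<in> {0..r}" for s
        using N that by (simp add: less_imp_le)
    qed
    moreover have "norm (q (\<kappa> ?n) r - A) < e / 2"
    proof -
      have "1 / real (Suc ?n) \<le> 1 / real (Suc M)" by (simp add: frac_le)
      then show ?thesis using qA[of "\<kappa> ?n"] inv[of ?n] M by linarith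
    qed
    moreover have "norm (z r - A) \<le> norm (q (\<kappa> ?n) r - z r) + norm (q (\<kappa> ?n) r - A)"
      using norm_triangle_ineq4[of "q (\<kappa> ?n) r - A" "q (\<kappa> ?n) r - z r"] by simp
    ultimately show "norm (z r - A) \<le> 0 + e" by simp
  qed
  then have "z r = A" by simp
  then have ae: "AE t in lebesgue_on {0..r}. v t = u t" using uniq v z by blast
  have vu: "L2_norm r (\<lambda>t. v t - u t) = 0"
  proof -
    have "integral {0..r} (\<lambda>t. (norm (v t - u t))\<^sup>2) = integral {0..r} (\<lambda>t. 0::real)"
    proof (rule integral_eq_AE)
      show "AE t in lebesgue_on {0..r}. (norm (v t - u t))\<^sup>2 = 0" using ae by auto
      show "(\<lambda>t. (norm (v t - u t))\<^sup>2) absolutely_integrable_on {0..r}"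
        using controls_sq[OF controls_diff[OF v(1) u]] by (intro nonnegative_absolutely_integrable_1) auto
    qed auto
    then show ?thesis by (simp add: L2_norm_def)
  qed
  have "L2_norm r u \<le> L2_norm r v + L2_norm r (\<lambda>t. u t - v t)"
    using L2_norm_triangle[OF v(1) controls_diff[OF u v(1)]] by simp
  then have uv: "L2_norm r u \<le> L2_norm r v" using vu L2_norm_minus_commute[of r v u] by simp
  then have "(L2_norm r u)\<^sup>2 \<le> (L2_norm r v)\<^sup>2" by (intro power_mono L2_norm_nonneg u)
  then have energy_v: "r \<le> (L2_norm r v)\<^sup>2" using energy by linarith
  have d2: "\<delta>\<^sup>2 / 8 > 0" using d by simp
  obtain \<rho> where rho: "\<rho> > 0" and small: "\<And>g. g \<in> controls r \<Longrightarrow> (\<And>s. norm (g s) \<le> 3) \<Longrightarrow>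
      (\<And>s. s \<in> {0..r} \<Longrightarrow> norm (integral {0..s} g) \<le> \<rho>) \<Longrightarrow> \<bar>integral {0..r} (\<lambda>s. g s \<bullet> v s)\<bar> \<le> \<delta>\<^sup>2 / 8"
    by (rule weakly_small_inner[OF r0 v(1) dense d2 zero_le_numeral[of "num.Bit1 num.One"]], assumption) blast
  obtain N where N: "\<forall>n\<ge>N. \<forall>s\<in>{0..r}. norm (integral {0..s} (w (\<kappa> n)) - integral {0..s} v) < \<rho>"
    using conv[OF rho] by blast
  obtain M :: nat where M: "1 / real (Suc M) < \<delta>\<^sup>2 / (8 * r)"
    by (rule nat_approx_posE[of "\<delta>\<^sup>2 / (8 * r)"]) (use d r in auto)
  define n where "n = \<kappa> (max N M)"
  define \<epsilon> where "\<epsilon> = 1 / real (Suc n)"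
  have eps: "0 < \<epsilon>" "\<epsilon> \<le> 1" by (auto simp: \<epsilon>_def)
  have eps_r: "3 * \<epsilon> * r < 3 * (\<delta>\<^sup>2 / 8)"
  proof -
    have "\<epsilon> \<le> 1 / real (Suc (max N M))" unfolding \<epsilon>_def n_def by (rule inv)
    also have "\<dots> \<le> 1 / real (Suc M)" by (simp add: frac_le)
    finally have "\<epsilon> < \<delta>\<^sup>2 / (8 * r)" using M by linarith
    then show ?thesis using r by (simp add: field_simps)
  qed
  have int: "c integrable_on {0..t}" if "c \<in> controls r" "t \<in> {0..r}" for c :: "real \<Rightarrow> real^'m" and t
    using abs_int_integrable[OF abs_integrable_sub[OF controls_abs_integrable[OF that(1)], of 0 t]] that(2) by auto
  note wv = controls_diff[OF w[of n] v(1)]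
  have ip: "\<bar>integral {0..r} (\<lambda>s. (w n s - v s) \<bullet> v s)\<bar> \<le> \<delta>\<^sup>2 / 8"
  proof (rule small[OF wv])
    show "norm (w n s - v s) \<le> 3" for s
      using norm_triangle_ineq4[of "w n s" "v s"] bd[of n s] v(2)[of s] eps unfolding \<epsilon>_def by linarith
    show "norm (integral {0..s} (\<lambda>s. w n s - v s)) \<le> \<rho>" if "s \<in> {0..r}" for s
    proof -
      have "integral {0..s} (\<lambda>s. w n s - v s) = integral {0..s} (w n) - integral {0..s} v"
        by (rule integral_diff[OF int[OF w[of n] that] int[OF v(1) that]])
      then show ?thesis using N that by (simp add: less_imp_le n_def)
    qed
  qed
  have "(L2_norm r (w n))\<^sup>2 \<le> (1 + 3 * \<epsilon>) * r"
    by (rule energy_le_of_speed_le[OF r0 w bd[of n, folded \<epsilon>_def] less_imp_le[OF eps(1)] eps(2)])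
  then have wn: "(L2_norm r (w n))\<^sup>2 \<le> r + 3 * \<epsilon> * r" by (simp add: algebra_simps)
  have "(L2_norm r (\<lambda>t. w n t - v t))\<^sup>2
      = (L2_norm r (w n))\<^sup>2 - (L2_norm r v)\<^sup>2 - 2 * integral {0..r} (\<lambda>s. (w n s - v s) \<bullet> v s)"
  proof -
    have eq: "(norm (w n t - v t))\<^sup>2 = (norm (w n t))\<^sup>2 - (norm (v t))\<^sup>2 - 2 * ((w n t - v t) \<bullet> v t)" for t
      by (simp add: power2_norm_eq_inner inner_diff_left inner_diff_right inner_commute algebra_simps)
    show ?thesis
      unfolding L2_norm_power2[OF wv] L2_norm_power2[OF w] L2_norm_power2[OF v(1)] eq
      using controls_sq[OF w[of n]] controls_sq[OF v(1)] abs_int_integrable[OF controls_inner_abs_integrable[OF wv v(1)]]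
      by (simp add: integral_diff integrable_diff integrable_on_mult_right)
  qed
  also have "\<dots> \<le> 3 * \<epsilon> * r + 2 * (\<delta>\<^sup>2 / 8)" using wn energy_v ip by linarith
  also have "\<dots> < \<delta>\<^sup>2" using eps_r d2 by linarith
  finally have "L2_norm r (\<lambda>t. w n t - v t) < \<delta>" using d by (simp add: power_less_imp_less_base)
  moreover have "L2_norm r (\<lambda>t. w n t - u t) \<le> L2_norm r (\<lambda>t. w n t - v t) + L2_norm r (\<lambda>t. v t - u t)"
    using L2_norm_triangle[OF wv controls_diff[OF v(1) u]] by simp
  ultimately show False using vu far[of n] by simp
qed

section \<open>Covectors of a strictly abnormal control\<close>

text \<open>A covector $(a, b)$ with $b \ne 0$ can be scaled to a normal extended adjoint vector, which is not a multiple of an abnormal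
one; if $b = 0$ it is an abnormal extended adjoint vector. Uniqueness excludes the former and makes the latter proportional
to the given one, whose value at the final time is \<open>\<psi>\<close>.\<close>

lemma strict_abnormality_covectors:
  fixes F :: "'m::finite \<Rightarrow> real^'n \<Rightarrow> real^'n"
  assumes C1: "C1_frame F DF" and u: "u \<in> controls T" and g: "trajectory F T 0 u \<gamma>" and T: "0 \<le> T"
    and strict: "strictly_abnormal F T u \<gamma>"
    and adj: "\<And>a. \<exists>p. adjoint_curve DF T u \<gamma> p \<and> p T = a \<and>
       (\<forall>h\<in>controls T. a \<bullet> D h = integral {0..T} (\<lambda>s. p s \<bullet> velocity F (h s) (\<gamma> s)))"
  obtains \<psi> where "\<And>a b. (a, b) \<noteq> 0 \<Longrightarrow> (\<And>h. h \<in> controls T \<Longrightarrow> a \<bullet> D h + 2 * b * integral {0..T} (\<lambda>s. u s \<bullet> h s) = 0) \<Longrightarrow>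
      b = 0 \<and> (\<exists>c. a = c *\<^sub>R \<psi>)"
proof -
  obtain p0 where p0: "extended_adjoint F T u \<gamma> p0 0"
    and unique: "\<And>p \<nu> p' \<nu>'. extended_adjoint F T u \<gamma> p \<nu> \<Longrightarrow> extended_adjoint F T u \<gamma> p' \<nu>' \<Longrightarrow>
        \<exists>c. (\<forall>t\<in>{0..T}. p' t = c *\<^sub>R p t) \<and> \<nu>' = c * \<nu>"
    using strict unfolding strictly_abnormal_def by blast
  show ?thesis
  proof (rule that[of "p0 T"])
    fix a :: "real^'n" and b :: real
    assume nz: "(a, b) \<noteq> 0"
      and ann: "\<And>h. h \<in> controls T \<Longrightarrow> a \<bullet> D h + 2 * b * integral {0..T} (\<lambda>s. u s \<bullet> h s) = 0"
    have b0: "b = 0"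
    proof (rule ccontr)
      assume b: "b \<noteq> 0"
      \<comment> \<open>scaled so that the multiplier of the energy becomes -1/2\<close>
      define k where "k = - 1 / (2 * b)"
      obtain p where p: "adjoint_curve DF T u \<gamma> p" "p T = k *\<^sub>R a"
        and pD: "\<And>h. h \<in> controls T \<Longrightarrow> (k *\<^sub>R a) \<bullet> D h = integral {0..T} (\<lambda>s. p s \<bullet> velocity F (h s) (\<gamma> s))"
        using adj[of "k *\<^sub>R a"] by blast
      have "extended_adjoint F T u \<gamma> p (-1/2)"
      proof (rule annihilator_extended_adjoint[OF C1 u g T p(1)])
        fix h :: "real \<Rightarrow> real^'m" assume h: "h \<in> controls T"
        have "a \<bullet> D h = - (2 * b * integral {0..T} (\<lambda>s. u s \<bullet> h s))" using ann[OF h] by linarith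
        then have "k * (a \<bullet> D h) = integral {0..T} (\<lambda>s. u s \<bullet> h s)" using b by (simp add: k_def)
        then show "integral {0..T} (\<lambda>s. p s \<bullet> velocity F (h s) (\<gamma> s)) + 2 * (-1/2) * integral {0..T} (\<lambda>s. u s \<bullet> h s) = 0"
          using pD[OF h] by simp
      qed auto
      from unique[OF p0 this] show False by auto
    qed
    then have a: "a \<noteq> 0" using nz by (auto simp: zero_prod_def)
    obtain p where p: "adjoint_curve DF T u \<gamma> p" "p T = a"
      and pD: "\<And>h. h \<in> controls T \<Longrightarrow> a \<bullet> D h = integral {0..T} (\<lambda>s. p s \<bullet> velocity F (h s) (\<gamma> s))"
      using adj[of a] by blast
    have "extended_adjoint F T u \<gamma> p 0"
    proof (rule annihilator_extended_adjoint[OF C1 u g T p(1)])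
      show "integral {0..T} (\<lambda>s. p s \<bullet> velocity F (h s) (\<gamma> s)) + 2 * 0 * integral {0..T} (\<lambda>s. u s \<bullet> h s) = 0"
        if "h \<in> controls T" for h
        using pD[OF that] ann[OF that] b0 by simp
    qed (use p a in auto)
    from unique[OF p0 this] obtain c where "\<forall>t\<in>{0..T}. p t = c *\<^sub>R p0 t" by blast
    then have "a = c *\<^sub>R p0 T" using p(2) T by auto
    then show "b = 0 \<and> (\<exists>c. a = c *\<^sub>R p0 T)" using b0 by blast
  qed
qed

section \<open>Decreasing the energy\<close>

text \<open>The solution is the fixed point of the contraction \<open>x \<mapsto> x - \<Theta> x + z\<close> of the ball.\<close>

lemma near_identity_covers:
  fixes \<Theta> :: "'a::euclidean_space \<Rightarrow> 'a"
  assumes r: "0 < \<rho>" and near: "\<And>x y. x \<in> cball 0 \<rho> \<Longrightarrow> y \<in> cball 0 \<rho> \<Longrightarrow> norm (\<Theta> x - \<Theta> y - (x - y)) \<le> norm (x - y) / 2"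
    and z: "norm (z - \<Theta> 0) \<le> \<rho> / 2"
  obtains x where "x \<in> cball 0 \<rho>" "\<Theta> x = z"
proof -
  define f where "f x = x - \<Theta> x + z" for x
  have lip: "norm (f x - f y) \<le> norm (x - y) / 2" if "x \<in> cball 0 \<rho>" "y \<in> cball 0 \<rho>" for x y
  proof -
    have "f x - f y = - (\<Theta> x - \<Theta> y - (x - y))" by (simp add: f_def)
    then show ?thesis using near[OF that] by (metis norm_minus_cancel)
  qed
  have "\<exists>!x\<in>cball 0 \<rho>. f x = x"
  proof (rule Banach_fix)
    show "f ` cball 0 \<rho> \<subseteq> cball 0 \<rho>"
    proof safe
      fix x :: 'a assume x: "x \<in> cball 0 \<rho>"
      have "norm (f x) \<le> norm (f x - f 0) + norm (f 0)" using norm_triangle_ineq[of "f x - f 0" "f 0"] by simp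
      also have "norm (f x - f 0) \<le> \<rho> / 2" using lip[OF x, of 0] x r by simp
      also have "norm (f 0) \<le> \<rho> / 2" using z by (simp add: f_def)
      finally show "f x \<in> cball 0 \<rho>" by simp
    qed
    show "dist (f x) (f y) \<le> 1/2 * dist x y" if "x \<in> cball 0 \<rho>" "y \<in> cball 0 \<rho>" for x y
      using lip[OF that] by (simp add: dist_norm)
  qed (use r in \<open>auto simp: complete_eq_closed\<close>)
  then obtain x where "x \<in> cball 0 \<rho>" "f x = x" by blast
  then show ?thesis using that by (simp add: f_def)
qed

lemma L2_derivative_sum:
  assumes D: "has_L2_derivative T Dom E D u" and I: "finite I" and h: "\<And>i. i \<in> I \<Longrightarrow> h i \<in> controls T"
  shows "D (\<lambda>t. \<Sum>i\<in>I. c i *\<^sub>R h i t) = (\<Sum>i\<in>I. c i *\<^sub>R D (h i))"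
proof -
  have add: "D (\<lambda>t. v t + w t) = D v + D w" if "v \<in> controls T" "w \<in> controls T" for v w
    using D that unfolding has_L2_derivative_def by blast
  have scale: "D (\<lambda>t. c *\<^sub>R v t) = c *\<^sub>R D v" if "v \<in> controls T" for c v
    using D that unfolding has_L2_derivative_def by blast
  from I h show ?thesis
  proof (induction I rule: finite_induct)
    case empty
    show ?case using scale[OF controls_zero, of 0] by simp
  next
    case (insert i I)
    have "(\<lambda>t. \<Sum>i\<in>I. c i *\<^sub>R h i t) \<in> controls T" "(\<lambda>t. c i *\<^sub>R h i t) \<in> controls T"
      using insert by (auto intro!: controls_sum controls_scaleR)
    then show ?case using insert add scale by simp
  qed
qed

text \<open>The left-hand side is the absolute value of the integral of $(v + w - 2u) \bullet (v - w)$.\<close>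

lemma L2_energy_strict_derivative:
  assumes v: "v \<in> controls T" and w: "w \<in> controls T" and u: "u \<in> controls T"
  shows "\<bar>(L2_norm T v)\<^sup>2 - (L2_norm T w)\<^sup>2 - 2 * integral {0..T} (\<lambda>t. u t \<bullet> (v t - w t))\<bar>
     \<le> (L2_norm T (\<lambda>t. v t - u t) + L2_norm T (\<lambda>t. w t - u t)) * L2_norm T (\<lambda>t. v t - w t)"
proof -
  note vw = controls_diff[OF v w] and vu = controls_diff[OF v u] and wu = controls_diff[OF w u]
  let ?s = "\<lambda>t. (v t - u t) + (w t - u t)"
  have s: "?s \<in> controls T" by (rule controls_add[OF vu wu])
  have eq: "?s t \<bullet> (v t - w t) = (norm (v t))\<^sup>2 - (norm (w t))\<^sup>2 - 2 * (u t \<bullet> (v t - w t))" for t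
    unfolding power2_norm_eq_inner inner_diff_left inner_diff_right inner_add_left
    using inner_commute[of "w t" "v t"] by argo
  have "integral {0..T} (\<lambda>t. ?s t \<bullet> (v t - w t))
     = (L2_norm T v)\<^sup>2 - (L2_norm T w)\<^sup>2 - 2 * integral {0..T} (\<lambda>t. u t \<bullet> (v t - w t))"
    unfolding eq L2_norm_power2[OF v] L2_norm_power2[OF w]
    using controls_sq[OF v] controls_sq[OF w] abs_int_integrable[OF controls_inner_abs_integrable[OF u vw]]
    by (simp add: integral_diff integrable_diff integrable_on_mult_right)
  moreover have "norm (integral {0..T} (\<lambda>t. ?s t \<bullet> (v t - w t))) \<le> integral {0..T} (\<lambda>t. norm (?s t) * norm (v t - w t))"
    by (intro integral_norm_bound_integral abs_int_integrable controls_inner_abs_integrable controls_mult_abs_integrable s vw)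
       (simp add: Cauchy_Schwarz_ineq2)
  moreover have "\<dots> \<le> L2_norm T ?s * L2_norm T (\<lambda>t. v t - w t)" by (rule integral_norm_mult_le[OF s vw])
  moreover have "\<dots> \<le> (L2_norm T (\<lambda>t. v t - u t) + L2_norm T (\<lambda>t. w t - u t)) * L2_norm T (\<lambda>t. v t - w t)"
    by (intro mult_right_mono L2_norm_triangle vu wu L2_norm_nonneg vw)
  ultimately show ?thesis by simp
qed

lemma C1_curve_strict_at_start:
  fixes \<sigma> :: "real \<Rightarrow> 'a::real_normed_vector"
  assumes der: "\<forall>\<tau>\<in>{0<..1}. (\<sigma> has_vector_derivative \<sigma>' \<tau>) (at \<tau> within {0<..1})"
    and lim: "(\<sigma>' \<longlongrightarrow> L) (at_right 0)" and e: "e > 0"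
  obtains \<tau>0 where "0 < \<tau>0" "\<tau>0 \<le> 1"
    "\<And>s t. s \<in> {0<..<\<tau>0} \<Longrightarrow> t \<in> {0<..<\<tau>0} \<Longrightarrow> norm (\<sigma> s - \<sigma> t - (s - t) *\<^sub>R L) \<le> e * \<bar>s - t\<bar>"
proof -
  have "\<forall>\<^sub>F \<tau> in at_right 0. dist (\<sigma>' \<tau>) L < e" using lim e by (rule tendstoD)
  then obtain b where b: "b > 0" "\<And>\<tau>. 0 < \<tau> \<Longrightarrow> \<tau> < b \<Longrightarrow> dist (\<sigma>' \<tau>) L < e"
    unfolding eventually_at_right_field by blast
  \<comment> \<open>beyond 1 the curve is not defined\<close>
  define \<tau>0 where "\<tau>0 = min 1 b"
  have t0: "0 < \<tau>0" "\<tau>0 \<le> 1" "\<tau>0 \<le> b" using b(1) by (auto simp: \<tau>0_def)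
  show ?thesis
  proof (rule that[OF t0(1,2)])
    fix s t assume st: "s \<in> {0<..<\<tau>0}" "t \<in> {0<..<\<tau>0}"
    have "norm ((\<sigma> s - s *\<^sub>R L) - (\<sigma> t - t *\<^sub>R L)) \<le> e * norm (s - t)"
    proof (rule differentiable_bound[of "{0<..<\<tau>0}" _ "\<lambda>\<tau> h. h *\<^sub>R (\<sigma>' \<tau> - L)"])
      fix \<tau> assume tau: "\<tau> \<in> {0<..<\<tau>0}"
      have "(\<sigma> has_vector_derivative \<sigma>' \<tau>) (at \<tau> within {0<..<\<tau>0})"
        by (rule has_vector_derivative_within_subset[OF bspec[OF der]]) (use tau t0 in auto)
      then have "(\<sigma> has_derivative (\<lambda>h. h *\<^sub>R \<sigma>' \<tau>)) (at \<tau> within {0<..<\<tau>0})" by (simp add: has_vector_derivative_def)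
      then have "((\<lambda>\<tau>. \<sigma> \<tau> - \<tau> *\<^sub>R L) has_derivative (\<lambda>h. h *\<^sub>R \<sigma>' \<tau> - h *\<^sub>R L)) (at \<tau> within {0<..<\<tau>0})"
        by (intro has_derivative_diff has_derivative_scaleR_left has_derivative_ident)
      then show "((\<lambda>\<tau>. \<sigma> \<tau> - \<tau> *\<^sub>R L) has_derivative (\<lambda>h. h *\<^sub>R (\<sigma>' \<tau> - L))) (at \<tau> within {0<..<\<tau>0})"
        by (simp add: scaleR_diff_right)
      show "onorm (\<lambda>h. h *\<^sub>R (\<sigma>' \<tau> - L)) \<le> e"
      proof (rule onorm_le)
        fix h :: real
        have "norm (\<sigma>' \<tau> - L) \<le> e" using b(2)[of \<tau>] tau t0 by (simp add: dist_norm)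
        then have "norm (\<sigma>' \<tau> - L) * norm h \<le> e * norm h" by (rule mult_right_mono) simp
        then show "norm (h *\<^sub>R (\<sigma>' \<tau> - L)) \<le> e * norm h" by (simp add: mult.commute)
      qed
    qed (use st in auto)
    then show "norm (\<sigma> s - \<sigma> t - (s - t) *\<^sub>R L) \<le> e * \<bar>s - t\<bar>"
      by (simp add: scaleR_diff_left algebra_simps)
  qed
qed

text \<open>By assumption \<open>onto\<close> the differential of \<open>(v, s) \<mapsto> (E(v) - \<sigma>(s), C(v))\<close> has a linear right inverse \<open>x \<mapsto> (H x, S x)\<close>.
Strict differentiability makes \<open>x \<mapsto> (E(w + H x) - \<sigma>(\<tau> + S x), C(w + H x))\<close> a map close to the identity up to a translation, on a ball whose
radius \<open>\<rho>\<close> depends on \<open>\<tau>\<close> but not on $w$. Its image contains a ball around its value $(0, C(w))$ at $0$, and in particular a point \<open>(0, c - \<rho>/4)\<close>.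
The order of the quantifiers matters: \<open>\<xi>\<close>, which says how close to $c$ the energy of $w$ has to be, may depend on \<open>\<tau>\<close>, but
\<open>\<delta>\<close> may not.\<close>

lemma perturb_to_smaller_energy:
  fixes F :: "'m::finite \<Rightarrow> real^'n \<Rightarrow> real^'n" and \<sigma> :: "real \<Rightarrow> real^'n"
  assumes u: "u \<in> controls T"
    and D: "has_L2_derivative T (end_point_dom F T) (end_point F T) D u"
    and strict: "strict_L2_derivative T (end_point_dom F T) (end_point F T) D u"
    and der: "\<forall>\<tau>\<in>{0<..1}. (\<sigma> has_vector_derivative \<sigma>' \<tau>) (at \<tau> within {0<..1})"
    and lim: "(\<sigma>' \<longlongrightarrow> L) (at_right 0)"
    and onto: "\<And>x::(real^'n) \<times> real. \<exists>h\<in>controls T. \<exists>s. (D h - s *\<^sub>R L, 2 * integral {0..T} (\<lambda>t. u t \<bullet> h t)) = x"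
  obtains \<delta> \<tau>0 where "0 < \<delta>" "0 < \<tau>0" "\<tau>0 \<le> 1"
    "\<And>\<tau>. 0 < \<tau> \<Longrightarrow> \<tau> < \<tau>0 \<Longrightarrow> \<exists>\<xi>>0. \<forall>w\<in>controls T. L2_norm T (\<lambda>t. w t - u t) < \<delta> \<longrightarrow> end_point F T w = \<sigma> \<tau> \<longrightarrow>
       \<bar>(L2_norm T w)\<^sup>2 - c\<bar> \<le> \<xi> \<longrightarrow>
       (\<exists>v\<in>end_point_dom F T. \<exists>s\<in>{0<..1}. end_point F T v = \<sigma> s \<and> (L2_norm T v)\<^sup>2 < c)"
proof -
  obtain hh where hh: "\<And>x. hh x \<in> controls T"
    "\<And>x::(real^'n) \<times> real. \<exists>s. (D (hh x) - s *\<^sub>R L, 2 * integral {0..T} (\<lambda>t. u t \<bullet> hh x t)) = x"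
    using onto by metis
  then obtain ss where ss: "\<And>x::(real^'n) \<times> real. (D (hh x) - ss x *\<^sub>R L, 2 * integral {0..T} (\<lambda>t. u t \<bullet> hh x t)) = x"
    by metis
  let ?B = "Basis :: ((real^'n) \<times> real) set"
  define H where "H x t = (\<Sum>b\<in>?B. (x \<bullet> b) *\<^sub>R hh b t)" for x t
  define S where "S x = (\<Sum>b\<in>?B. (x \<bullet> b) * ss b)" for x
  define CH where "CH = (\<Sum>b\<in>?B. L2_norm T (hh b))"
  define CS where "CS = (\<Sum>b\<in>?B. \<bar>ss b\<bar>)"
  have CH0: "0 \<le> CH" unfolding CH_def by (intro sum_nonneg L2_norm_nonneg hh)
  have CS0: "0 \<le> CS" unfolding CS_def by (intro sum_nonneg) simp
  have Hc: "H x \<in> controls T" for x unfolding H_def by (intro controls_sum controls_scaleR hh) simp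
  have Hdiff: "(\<lambda>t. H x t - H y t) = H (x - y)" for x y
    by (simp add: H_def fun_eq_iff inner_diff_left scaleR_diff_left sum_subtractf)
  have Sdiff: "S x - S y = S (x - y)" for x y
    by (simp add: S_def inner_diff_left left_diff_distrib sum_subtractf)
  have HL: "L2_norm T (H x) \<le> CH * norm x" for x
  proof -
    have "L2_norm T (H x) \<le> (\<Sum>b\<in>?B. L2_norm T (\<lambda>t. (x \<bullet> b) *\<^sub>R hh b t))"
      unfolding H_def by (intro L2_norm_sum controls_scaleR hh) simp
    also have "\<dots> \<le> (\<Sum>b\<in>?B. norm x * L2_norm T (hh b))"
      unfolding L2_norm_scaleR by (intro sum_mono mult_right_mono L2_norm_nonneg hh) (auto simp: Basis_le_norm)
    finally show ?thesis by (simp add: CH_def sum_distrib_left mult.commute)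
  qed
  have SL: "\<bar>S x\<bar> \<le> CS * norm x" for x
  proof -
    have "\<bar>S x\<bar> \<le> (\<Sum>b\<in>?B. \<bar>(x \<bullet> b) * ss b\<bar>)" unfolding S_def by (rule sum_abs)
    also have "\<dots> \<le> (\<Sum>b\<in>?B. norm x * \<bar>ss b\<bar>)"
      unfolding abs_mult by (intro sum_mono mult_right_mono) (auto simp: Basis_le_norm)
    finally show ?thesis by (simp add: CS_def sum_distrib_left mult.commute)
  qed
  have right_inverse: "(D (H x) - S x *\<^sub>R L, 2 * integral {0..T} (\<lambda>t. u t \<bullet> H x t)) = x" for x
  proof -
    have int: "(\<lambda>t. u t \<bullet> hh b t) integrable_on {0..T}" for b
      by (intro abs_int_integrable controls_inner_abs_integrable u hh)
    have "D (H x) - S x *\<^sub>R L = (\<Sum>b\<in>?B. (x \<bullet> b) *\<^sub>R (D (hh b) - ss b *\<^sub>R L))"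
      unfolding H_def S_def
      by (simp add: L2_derivative_sum[OF D] hh scaleR_sum_left scaleR_diff_right sum_subtractf)
    moreover have "2 * integral {0..T} (\<lambda>t. u t \<bullet> H x t) = (\<Sum>b\<in>?B. (x \<bullet> b) *\<^sub>R (2 * integral {0..T} (\<lambda>t. u t \<bullet> hh b t)))"
      unfolding H_def inner_sum_right inner_scaleR_right
      by (subst integral_sum) (auto intro!: integrable_on_mult_right int simp: sum_distrib_left mult_ac)
    ultimately have "(D (H x) - S x *\<^sub>R L, 2 * integral {0..T} (\<lambda>t. u t \<bullet> H x t))
       = (\<Sum>b\<in>?B. (x \<bullet> b) *\<^sub>R (D (hh b) - ss b *\<^sub>R L, 2 * integral {0..T} (\<lambda>t. u t \<bullet> hh b t)))"
      by (simp add: sum_prod scaleR_prod_def)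
    also have "\<dots> = x" unfolding ss by (rule euclidean_representation)
    finally show ?thesis .
  qed
  define \<epsilon> where "\<epsilon> = 1 / (2 * (2 * CH + CS + 1))"
  have eps: "\<epsilon> > 0" using CH0 CS0 by (simp add: \<epsilon>_def)
  have eps2: "\<epsilon> * (2 * CH + CS) \<le> 1 / 2" using CH0 CS0 by (simp add: \<epsilon>_def divide_le_eq)
  obtain \<delta>1 where d1: "\<delta>1 > 0" and E: "\<forall>v\<in>controls T. \<forall>w\<in>controls T.
        L2_norm T (\<lambda>t. v t - u t) < \<delta>1 \<longrightarrow> L2_norm T (\<lambda>t. w t - u t) < \<delta>1 \<longrightarrow>
        v \<in> end_point_dom F T \<and>
        norm (end_point F T v - end_point F T w - D (\<lambda>t. v t - w t)) \<le> \<epsilon> * L2_norm T (\<lambda>t. v t - w t)"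
    using strict[unfolded strict_L2_derivative_def, rule_format, OF eps] by (elim exE conjE)
  obtain \<tau>0 where t0: "0 < \<tau>0" "\<tau>0 \<le> 1"
    and curve: "\<And>s t. s \<in> {0<..<\<tau>0} \<Longrightarrow> t \<in> {0<..<\<tau>0} \<Longrightarrow> norm (\<sigma> s - \<sigma> t - (s - t) *\<^sub>R L) \<le> \<epsilon> * \<bar>s - t\<bar>"
    using C1_curve_strict_at_start[OF der lim eps] by blast
  define \<delta> where "\<delta> = min \<delta>1 (\<epsilon> / 2)"
  have d0: "\<delta> > 0" "\<delta> \<le> \<delta>1" "2 * \<delta> \<le> \<epsilon>" using d1 eps by (auto simp: \<delta>_def)
  show ?thesis
  proof (rule that[of "\<delta> / 2" \<tau>0])
    fix \<tau> assume tau: "0 < \<tau>" "\<tau> < \<tau>0"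
    \<comment> \<open>the perturbed parameter must stay in (0, \<tau>0), on both sides of \<tau>\<close>
    define \<mu> where "\<mu> = min \<tau> (\<tau>0 - \<tau>)"
    have mu: "0 < \<mu>" "\<mu> \<le> \<tau>" "\<mu> \<le> \<tau>0 - \<tau>" using tau by (auto simp: \<mu>_def)
    define \<rho> where "\<rho> = min (\<delta> / (2 * (CH + 1))) (\<mu> / (CS + 1))"
    have rho: "\<rho> > 0" using d0 mu CH0 CS0 by (simp add: \<rho>_def)
    have CHr: "CH * \<rho> < \<delta> / 2"
    proof -
      have "CH * \<rho> < (CH + 1) * \<rho>" using rho by simp
      also have "\<dots> \<le> (CH + 1) * (\<delta> / (2 * (CH + 1)))" using CH0 by (intro mult_left_mono) (auto simp: \<rho>_def)
      also have "\<dots> = \<delta> / 2" by (rule mult_half_quotient[OF CH0])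
      finally show ?thesis .
    qed
    have CSr: "CS * \<rho> < \<mu>"
    proof -
      have "CS * \<rho> < (CS + 1) * \<rho>" using rho by simp
      also have "\<dots> \<le> (CS + 1) * (\<mu> / (CS + 1))" using CS0 by (intro mult_left_mono) (auto simp: \<rho>_def)
      also have "\<dots> = \<mu>" using CS0 by simp
      finally show ?thesis .
    qed
    show "\<exists>\<xi>>0. \<forall>w\<in>controls T. L2_norm T (\<lambda>t. w t - u t) < \<delta> / 2 \<longrightarrow> end_point F T w = \<sigma> \<tau> \<longrightarrow>
       \<bar>(L2_norm T w)\<^sup>2 - c\<bar> \<le> \<xi> \<longrightarrow>
       (\<exists>v\<in>end_point_dom F T. \<exists>s\<in>{0<..1}. end_point F T v = \<sigma> s \<and> (L2_norm T v)\<^sup>2 < c)"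
    proof (intro exI[of _ "\<rho> / 4"] conjI ballI impI)
      fix w assume w: "w \<in> controls T" and wu: "L2_norm T (\<lambda>t. w t - u t) < \<delta> / 2"
        and Ew: "end_point F T w = \<sigma> \<tau>" and Cw: "\<bar>(L2_norm T w)\<^sup>2 - c\<bar> \<le> \<rho> / 4"
      define V where "V x t = w t + H x t" for x t
      have Vc: "V x \<in> controls T" for x unfolding V_def by (rule controls_add[OF w Hc])
      have Vdiff: "(\<lambda>t. V x t - V y t) = H (x - y)" for x y
        unfolding Hdiff[symmetric] by (simp add: V_def fun_eq_iff)
      have Vu: "L2_norm T (\<lambda>t. V x t - u t) < \<delta>" if "x \<in> cball 0 \<rho>" for x
      proof -
        have "(\<lambda>t. V x t - u t) = (\<lambda>t. (w t - u t) + H x t)" by (simp add: V_def fun_eq_iff)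
        then have "L2_norm T (\<lambda>t. V x t - u t) \<le> L2_norm T (\<lambda>t. w t - u t) + L2_norm T (H x)"
          using L2_norm_triangle[OF controls_diff[OF w u] Hc] by simp
        also have "L2_norm T (H x) \<le> CH * \<rho>"
          using order_trans[OF HL mult_left_mono[OF _ CH0]] that by simp
        finally show ?thesis using wu CHr by linarith
      qed
      have s_in: "\<tau> + S x \<in> {0<..<\<tau>0}" if "x \<in> cball 0 \<rho>" for x
      proof -
        have "\<bar>S x\<bar> \<le> CS * \<rho>" using order_trans[OF SL mult_left_mono[OF _ CS0]] that by simp
        then have "\<bar>S x\<bar> < \<mu>" using CSr by linarith
        then show ?thesis using mu by auto
      qed
      define \<Theta> where "\<Theta> x = (end_point F T (V x) - \<sigma> (\<tau> + S x), (L2_norm T (V x))\<^sup>2)" for x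
      have near: "norm (\<Theta> x - \<Theta> y - (x - y)) \<le> norm (x - y) / 2"
        if x: "x \<in> cball 0 \<rho>" and y: "y \<in> cball 0 \<rho>" for x y
      proof -
        let ?z = "x - y"
        let ?e1 = "end_point F T (V x) - end_point F T (V y) - D (H ?z)"
        let ?e2 = "\<sigma> (\<tau> + S x) - \<sigma> (\<tau> + S y) - S ?z *\<^sub>R L"
        let ?e3 = "(L2_norm T (V x))\<^sup>2 - (L2_norm T (V y))\<^sup>2 - 2 * integral {0..T} (\<lambda>t. u t \<bullet> H ?z t)"
        have "\<Theta> x - \<Theta> y - ?z = \<Theta> x - \<Theta> y - (D (H ?z) - S ?z *\<^sub>R L, 2 * integral {0..T} (\<lambda>t. u t \<bullet> H ?z t))"
          by (simp only: right_inverse)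
        also have "\<dots> = (?e1 - ?e2, ?e3)" by (simp add: \<Theta>_def algebra_simps)
        finally have eq: "\<Theta> x - \<Theta> y - ?z = (?e1 - ?e2, ?e3)" .
        have Vxu: "L2_norm T (\<lambda>t. V x t - u t) < \<delta>" and Vyu: "L2_norm T (\<lambda>t. V y t - u t) < \<delta>" by (rule Vu[OF x], rule Vu[OF y])
        have "norm ?e1 \<le> \<epsilon> * L2_norm T (H ?z)"
          using bspec[OF bspec[OF E Vc[of x]] Vc[of y]] Vxu Vyu d0(2) by (simp add: Vdiff)
        also have "\<dots> \<le> \<epsilon> * (CH * norm ?z)" using eps HL by (intro mult_left_mono) auto
        finally have n1: "norm ?e1 \<le> \<epsilon> * (CH * norm ?z)" .
        have "norm ?e2 \<le> \<epsilon> * \<bar>S ?z\<bar>" using curve[OF s_in[OF x] s_in[OF y]] by (simp add: Sdiff)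
        also have "\<dots> \<le> \<epsilon> * (CS * norm ?z)" using eps SL by (intro mult_left_mono) auto
        finally have n2: "norm ?e2 \<le> \<epsilon> * (CS * norm ?z)" .
        have "norm ?e3 \<le> (L2_norm T (\<lambda>t. V x t - u t) + L2_norm T (\<lambda>t. V y t - u t)) * L2_norm T (H ?z)"
          using L2_energy_strict_derivative[OF Vc[of x] Vc[of y] u] unfolding fun_cong[OF Vdiff] Vdiff real_norm_def .
        also have "\<dots> \<le> \<epsilon> * (CH * norm ?z)"
          using Vxu Vyu d0(3) HL[of ?z] eps by (intro mult_mono L2_norm_nonneg Hc) auto
        finally have n3: "norm ?e3 \<le> \<epsilon> * (CH * norm ?z)" .
        have "norm (?e1 - ?e2, ?e3) \<le> norm (?e1 - ?e2) + norm ?e3" by (rule norm_Pair_le)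
        also have "\<dots> \<le> norm ?e1 + norm ?e2 + norm ?e3" by (intro add_right_mono norm_triangle_ineq4)
        also have "\<dots> \<le> \<epsilon> * (CH * norm ?z) + \<epsilon> * (CS * norm ?z) + \<epsilon> * (CH * norm ?z)"
          by (intro add_mono n1 n2 n3)
        also have "\<dots> = \<epsilon> * (2 * CH + CS) * norm ?z" by (simp add: algebra_simps)
        also have "\<dots> \<le> 1 / 2 * norm ?z" by (intro mult_right_mono eps2) simp
        finally show ?thesis unfolding eq by simp
      qed
      have V0: "V 0 = w" by (simp add: V_def H_def fun_eq_iff)
      have S0: "S 0 = 0" by (simp add: S_def)
      have "(0, c - \<rho> / 4) - \<Theta> 0 = (0, c - \<rho> / 4 - (L2_norm T w)\<^sup>2)"
        by (simp add: \<Theta>_def V0 S0 Ew)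
      then have "norm ((0, c - \<rho> / 4) - \<Theta> 0) = \<bar>c - \<rho> / 4 - (L2_norm T w)\<^sup>2\<bar>" by (simp add: norm_Pair)
      also have "\<dots> \<le> \<rho> / 2" using Cw rho unfolding abs_le_iff by linarith
      finally obtain x where x: "x \<in> cball 0 \<rho>" "\<Theta> x = (0, c - \<rho> / 4)"
        using near_identity_covers[OF rho near] by blast
      have "V x \<in> end_point_dom F T"
        using bspec[OF bspec[OF E Vc[of x]] Vc[of x]] Vu[OF x(1)] d0(2) by simp
      moreover have "end_point F T (V x) = \<sigma> (\<tau> + S x)" "(L2_norm T (V x))\<^sup>2 < c"
        using x(2) rho by (auto simp: \<Theta>_def)
      moreover have "\<tau> + S x \<in> {0<..1}" using s_in[OF x(1)] t0 by auto
      ultimately show "\<exists>v\<in>end_point_dom F T. \<exists>s\<in>{0<..1}. end_point F T v = \<sigma> s \<and> (L2_norm T v)\<^sup>2 < c" by blast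
    qed (use rho in simp)
  qed (use d0 t0 in auto)
qed

section \<open>Velocities of curves on the sphere\<close>

lemma sr_dist_le:
  assumes "0 < T" "w \<in> controls T" "trajectory F T x w q"
  shows "sr_dist F x (q T) \<le> ereal (traj_length T w)"
  unfolding sr_dist_def using assms by (intro Inf_lower) blast

text \<open>The length of $w$ is at least $r$ and at most \<open>\<surd>r\<close> times its norm.\<close>

lemma sphere_energy_ge:
  assumes r: "0 < r" and w: "w \<in> controls r" and q: "trajectory F r 0 w q" and S: "q r \<in> sr_sphere F 0 r"
  shows "r \<le> (L2_norm r w)\<^sup>2"
proof -
  have "r \<le> traj_length r w" using sr_dist_le[OF r w q] S by (simp add: sr_sphere_def)
  also have "\<dots> \<le> sqrt r * L2_norm r w" unfolding traj_length_def using integral_norm_le_L2[OF w] r by simp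
  finally have "r\<^sup>2 \<le> (sqrt r * L2_norm r w)\<^sup>2" using r by (intro power_mono) auto
  then have "r * r \<le> r * (L2_norm r w)\<^sup>2" using r by (simp add: power_mult_distrib power2_eq_square[of r])
  then show ?thesis using r by simp
qed

lemma sphere_almost_minimizer:
  fixes F :: "'m::finite \<Rightarrow> real^'n \<Rightarrow> real^'n"
  assumes C1: "C1_frame F DF" and r: "0 < r" and S: "y \<in> sr_sphere F 0 r" and c: "1 < c"
  obtains w q where "w \<in> controls r" "\<And>t. norm (w t) \<le> c" "trajectory F r 0 w q" "q r = y"
proof -
  have "sr_dist F 0 y < ereal (c * r)" using S r c by (simp add: sr_sphere_def)
  then obtain T v z where T: "0 < T" "v \<in> controls T" "trajectory F T 0 v z" "z T = y" "traj_length T v < c * r"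
    unfolding sr_dist_def Inf_less_iff by auto
  obtain w q where "w \<in> controls r" "\<And>t. norm (w t) \<le> c" "trajectory F r 0 w q" "q r = z T"
    by (rule arclength_reparametrization[OF C1 T(1,2,3) r _ T(5)]) (use c in auto)
  then show ?thesis using that T(4) by blast
qed

text \<open>If \<open>L\<close> is not in the image, it is not orthogonal to \<open>\<psi>\<close>, since the image of $dE(u)$ contains the orthogonal complement of
\<open>\<psi>\<close>. This makes \<open>(v, s) \<mapsto> (E(v) - \<sigma>(s), C(v))\<close> a submersion, and an almost minimizing control leading to a point \<open>\<sigma> \<tau>\<close> of the curve is
perturbed into one that leads to the sphere with too small an energy.\<close>

theorem theorem5p2:
  fixes F :: "'m::finite \<Rightarrow> real^'n \<Rightarrow> real^'n"
    and r :: real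
    and u :: "real \<Rightarrow> real^'m"
    and \<gamma> :: "real \<Rightarrow> real^'n"
    and A :: "real^'n"
    and \<sigma> \<sigma>' :: "real \<Rightarrow> real^'n"
    and L :: "real^'n"
  assumes "CARD('n) \<ge> 3"
    and "sub_riemannian_frame F"
    and "0 < r"
    and "\<forall>v. admissible r v \<longrightarrow> (\<exists>q. trajectory F r 0 v q)"
    \<comment> \<open>the minimizing geodesic, of length r, and its control\<close>
    and "admissible r u"
    and "trajectory F r 0 u \<gamma>"
    and "minimizing F r u \<gamma>"
    and "traj_length r u = r"
    and "A = \<gamma> r"
    and "strictly_abnormal F r u \<gamma>"
    and "\<forall>v q. admissible r v \<and> trajectory F r 0 v q \<and> minimizing F r v q \<and> q r = A \<longrightarrow>
           (AE t in lebesgue_on {0..r}. v t = u t)"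
    \<comment> \<open>the curve on the sphere\<close>
    and "\<forall>\<tau>\<in>{0<..1}. (\<sigma> has_vector_derivative \<sigma>' \<tau>) (at \<tau> within {0<..1})"
    and "continuous_on {0<..1} \<sigma>'"
    and "\<forall>\<tau>\<in>{0<..1}. \<sigma> \<tau> \<in> sr_sphere F 0 r"
    and "(\<sigma> \<longlongrightarrow> A) (at_right 0)"
    and "(\<sigma>' \<longlongrightarrow> L) (at_right 0)"
  shows "L \<in> dE F r u ` controls r"
proof (rule ccontr)
  assume notin: "L \<notin> dE F r u ` controls r"
  note r = assms(3) and g = assms(6) and sphere = assms(14)
  have r0: "0 \<le> r" using r by simp
  define DF where "DF i x = frechet_derivative (F i) (at x)" for i x
  have C1: "C1_frame F DF"
    unfolding DF_def using assms(2) by (intro smooth_C1_frame) (auto simp: sub_riemannian_frame_def)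
  have u: "u \<in> controls r" using assms(5) by (simp add: admissible_def)
  have g0: "\<gamma> 0 = 0" by (rule trajectory_start[OF g r0])
  have distA: "sr_dist F 0 A = ereal r" using assms(7,8,9) g0 by (simp add: minimizing_def)
  obtain D where D: "has_L2_derivative r (end_point_dom F r) (end_point F r) D u"
    and strict: "strict_L2_derivative r (end_point_dom F r) (end_point F r) D u"
    and adj: "\<And>a. \<exists>p. adjoint_curve DF r u \<gamma> p \<and> p r = a \<and>
       (\<forall>h\<in>controls r. a \<bullet> D h = integral {0..r} (\<lambda>s. p s \<bullet> velocity F (h s) (\<gamma> s)))"
    by (rule end_point_strict_derivative[OF C1 u g r0], rule that, assumption+)
  have add: "D (\<lambda>t. v t + w t) = D v + D w" if "v \<in> controls r" "w \<in> controls r" for v w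
    using D that unfolding has_L2_derivative_def by blast
  have scale: "D (\<lambda>t. c *\<^sub>R v t) = c *\<^sub>R D v" if "v \<in> controls r" for c v
    using D that unfolding has_L2_derivative_def by blast
  have D0: "D (\<lambda>t. 0) = 0" using scale[OF controls_zero, of 0] by simp
  have LD: "L \<notin> D ` controls r" using notin dE_eq[OF D] by (auto simp: image_iff)
  obtain \<psi> where \<psi>: "\<And>a b. (a, b) \<noteq> 0 \<Longrightarrow> (\<And>h. h \<in> controls r \<Longrightarrow> a \<bullet> D h + 2 * b * integral {0..r} (\<lambda>s. u s \<bullet> h s) = 0) \<Longrightarrow>
      b = 0 \<and> (\<exists>c. a = c *\<^sub>R \<psi>)"
    using strict_abnormality_covectors[OF C1 u g r0 assms(10) adj] by blast
  have int: "(\<lambda>t. u t \<bullet> h t) integrable_on {0..r}" if "h \<in> controls r" for h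
    by (intro abs_int_integrable controls_inner_abs_integrable u that)
  have \<psi>L: "\<psi> \<bullet> L \<noteq> 0"
  proof -
    have sub: "subspace (D ` controls r)"
      unfolding subspace_def
    proof (intro conjI ballI allI)
      show "0 \<in> D ` controls r" using D0 controls_zero by (metis image_eqI)
      show "x + y \<in> D ` controls r" if "x \<in> D ` controls r" "y \<in> D ` controls r" for x y
        using that by (auto simp: add[symmetric] intro!: imageI controls_add)
      show "c *\<^sub>R x \<in> D ` controls r" if "x \<in> D ` controls r" for c x
        using that by (auto simp: scale[symmetric] intro!: imageI controls_scaleR)
    qed
    obtain y z where y: "y \<in> span (D ` controls r)" and z: "\<And>w. w \<in> span (D ` controls r) \<Longrightarrow> orthogonal z w" and L: "L = y + z"
      using orthogonal_subspace_decomp_exists by metis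
    have y': "y \<in> D ` controls r" using y sub span_eq_iff by blast
    have z0: "z \<noteq> 0" using LD y' L by auto
    have zL: "z \<bullet> L = z \<bullet> z" using z[OF y] L by (simp add: orthogonal_def inner_add_right)
    have "z \<bullet> D h + 2 * 0 * integral {0..r} (\<lambda>s. u s \<bullet> h s) = 0" if "h \<in> controls r" for h
      using z[OF span_base] that by (simp add: orthogonal_def)
    then obtain c where "z = c *\<^sub>R \<psi>" using \<psi>[of z 0] z0 by (auto simp: zero_prod_def)
    then show ?thesis using zL z0 by auto
  qed
  \<comment> \<open>the differential of (v, s) \<mapsto> (E v - \<sigma> s, C v)\<close>
  define J where "J h s = (D h - s *\<^sub>R L, 2 * integral {0..r} (\<lambda>t. u t \<bullet> h t))" for h s
  define X where "X = {J h s | h s. h \<in> controls r}"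
  have "X = UNIV"
  proof (rule ccontr)
    assume "X \<noteq> UNIV"
    have subX: "subspace X"
      unfolding subspace_def
    proof (intro conjI ballI allI)
      have "J (\<lambda>t. 0) 0 = 0" by (simp add: J_def D0 zero_prod_def)
      then show "0 \<in> X" unfolding X_def using controls_zero by (metis (mono_tags, lifting) mem_Collect_eq)
    next
      fix x y assume "x \<in> X" "y \<in> X"
      then obtain h s h' s' where x: "x = J h s" "h \<in> controls r" and y: "y = J h' s'" "h' \<in> controls r"
        unfolding X_def by blast
      have "x + y = J (\<lambda>t. h t + h' t) (s + s')"
        using int[OF x(2)] int[OF y(2)]
        by (simp add: x y J_def add inner_add_right integral_add scaleR_add_left algebra_simps)
      then show "x + y \<in> X" unfolding X_def using controls_add[OF x(2) y(2)] by blast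
    next
      fix c x assume "x \<in> X"
      then obtain h s where x: "x = J h s" "h \<in> controls r" unfolding X_def by blast
      have "c *\<^sub>R x = J (\<lambda>t. c *\<^sub>R h t) (c * s)"
        by (simp add: x J_def scale scaleR_diff_right scaleR_prod_def)
      then show "c *\<^sub>R x \<in> X" unfolding X_def using controls_scaleR[OF x(2)] by blast
    qed
    have "span X \<noteq> UNIV" using \<open>X \<noteq> UNIV\<close> subX span_eq_iff by metis
    then have "dim X < DIM((real^'n) \<times> real)" using dim_eq_full dim_subset_UNIV le_neq_implies_less by metis
    then obtain ab where ab: "ab \<noteq> 0" "\<And>y. y \<in> span X \<Longrightarrow> orthogonal ab y"
      using orthogonal_to_subspace_exists by metis
    obtain a b where ab': "ab = (a, b)" by fastforce
    have ann: "a \<bullet> (D h - s *\<^sub>R L) + b * (2 * integral {0..r} (\<lambda>t. u t \<bullet> h t)) = 0" if "h \<in> controls r" for h s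
    proof -
      have "J h s \<in> span X" using that unfolding X_def by (intro span_base) blast
      from ab(2)[OF this] show ?thesis by (simp add: ab' J_def orthogonal_def)
    qed
    have "a \<bullet> D h + 2 * b * integral {0..r} (\<lambda>s. u s \<bullet> h s) = 0" if "h \<in> controls r" for h
      using ann[OF that, of 0] by simp
    then obtain c where b: "b = 0" and c: "a = c *\<^sub>R \<psi>" using \<psi> ab ab' by blast
    have "a \<bullet> L = 0" using ann[OF controls_zero, of 1] by (simp add: D0)
    moreover have "c \<noteq> 0" using b c ab ab' by (auto simp: zero_prod_def)
    ultimately show False using \<psi>L c by simp
  qed
  have onto: "\<exists>h\<in>controls r. \<exists>s. (D h - s *\<^sub>R L, 2 * integral {0..r} (\<lambda>t. u t \<bullet> h t)) = x" for x
  proof -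
    have "x \<in> X" using \<open>X = UNIV\<close> by simp
    then obtain h s where "x = J h s" "h \<in> controls r" unfolding X_def by blast
    then show ?thesis unfolding J_def by blast
  qed
  obtain \<delta> \<tau>0 where d: "0 < \<delta>" and t0: "0 < \<tau>0" "\<tau>0 \<le> 1"
    and perturb: "\<And>\<tau>. 0 < \<tau> \<Longrightarrow> \<tau> < \<tau>0 \<Longrightarrow> \<exists>\<xi>>0. \<forall>w\<in>controls r. L2_norm r (\<lambda>t. w t - u t) < \<delta> \<longrightarrow> end_point F r w = \<sigma> \<tau> \<longrightarrow>
       \<bar>(L2_norm r w)\<^sup>2 - r\<bar> \<le> \<xi> \<longrightarrow>
       (\<exists>v\<in>end_point_dom F r. \<exists>s\<in>{0<..1}. end_point F r v = \<sigma> s \<and> (L2_norm r v)\<^sup>2 < r)"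
    by (rule perturb_to_smaller_energy[OF u D strict assms(12,16) onto], rule that, assumption+)
  have adm: "admissible r v" if "v \<in> controls r" "\<forall>t. norm (v t) \<le> 1" for v :: "real \<Rightarrow> real^'m"
    using that by (simp add: admissible_def)
  have uniq: "AE t in lebesgue_on {0..r}. v t = u t"
    if v: "v \<in> controls r" "\<forall>t. norm (v t) \<le> 1" and q: "trajectory F r 0 v q" and qA: "q r = A" for v q
  proof -
    have "traj_length r v \<le> integral {0..r} (\<lambda>t. 1)"
      unfolding traj_length_def using v
      by (intro integral_le controls_norm_integrable integrable_continuous_real continuous_on_const) auto
    then have "traj_length r v \<le> r" using r by simp
    moreover have "ereal r \<le> ereal (traj_length r v)" using sr_dist_le[OF r v(1) q] qA distA by simp
    ultimately have "minimizing F r v q"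
      using q qA distA trajectory_start[OF q r0] by (simp add: minimizing_def)
    then show ?thesis using assms(11) adm[OF v] q qA by blast
  qed
  have "A \<in> sr_sphere F 0 r" using distA by (simp add: sr_sphere_def)
  then have energy: "r \<le> (L2_norm r u)\<^sup>2" using sphere_energy_ge[OF r u g] assms(9) by simp
  have complete: "\<exists>q. trajectory F r 0 v q" if "v \<in> controls r" "\<forall>t. norm (v t) \<le> 1" for v :: "real \<Rightarrow> real^'m"
    using assms(4) adm[OF that] by blast
  \<comment> \<open>\<delta> was fixed before \<tau>, so that \<tau> can now be chosen small enough for near minimizers to be \<delta>-close to u\<close>
  have "\<exists>\<kappa>>0. \<forall>w q. w \<in> controls r \<longrightarrow> (\<forall>t. norm (w t) \<le> 1 + \<kappa>) \<longrightarrow> trajectory F r 0 w q \<longrightarrow>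
           norm (q r - A) < \<kappa> \<longrightarrow> L2_norm r (\<lambda>t. w t - u t) < \<delta>"
  proof (rule near_minimizers_converge[OF C1 r _ u energy _ d])
    show "\<exists>q. trajectory F r 0 v q" if "v \<in> controls r" "\<forall>t. norm (v t) \<le> 1" for v
      by (rule complete[OF that])
    show "AE t in lebesgue_on {0..r}. v t = u t"
      if "v \<in> controls r" "\<forall>t. norm (v t) \<le> 1" "trajectory F r 0 v q" "q r = A" for v q
      by (rule uniq[OF that])
  qed
  then obtain \<kappa> where k: "\<kappa> > 0" and close: "\<forall>w q. w \<in> controls r \<longrightarrow> (\<forall>t. norm (w t) \<le> 1 + \<kappa>) \<longrightarrow> trajectory F r 0 w q \<longrightarrow>
           norm (q r - A) < \<kappa> \<longrightarrow> L2_norm r (\<lambda>t. w t - u t) < \<delta>"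
    by (elim exE conjE)
  have "\<forall>\<^sub>F \<tau> in at_right 0. dist (\<sigma> \<tau>) A < \<kappa>" using assms(15) k by (rule tendstoD)
  then obtain \<tau>1 where t1: "\<tau>1 > 0" "\<And>\<tau>. 0 < \<tau> \<Longrightarrow> \<tau> < \<tau>1 \<Longrightarrow> dist (\<sigma> \<tau>) A < \<kappa>"
    unfolding eventually_at_right_field by blast
  define \<tau> where "\<tau> = min \<tau>0 \<tau>1 / 2"
  have tau: "0 < \<tau>" "\<tau> < \<tau>0" "\<tau> < \<tau>1" using t0 t1 by (auto simp: \<tau>_def)
  obtain \<xi> where xi: "\<xi> > 0" and reach: "\<forall>w\<in>controls r. L2_norm r (\<lambda>t. w t - u t) < \<delta> \<longrightarrow> end_point F r w = \<sigma> \<tau> \<longrightarrow>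
       \<bar>(L2_norm r w)\<^sup>2 - r\<bar> \<le> \<xi> \<longrightarrow>
       (\<exists>v\<in>end_point_dom F r. \<exists>s\<in>{0<..1}. end_point F r v = \<sigma> s \<and> (L2_norm r v)\<^sup>2 < r)"
    using perturb[OF tau(1,2)] by blast
  \<comment> \<open>the energy exceeds r by at most 3 \<epsilon> r\<close>
  define \<epsilon> where "\<epsilon> = min \<kappa> (min 1 (\<xi> / (3 * r)))"
  have eps: "0 < \<epsilon>" "\<epsilon> \<le> \<kappa>" "\<epsilon> \<le> 1" "\<epsilon> \<le> \<xi> / (3 * r)" using k xi r by (auto simp: \<epsilon>_def)
  have in1: "\<tau> \<in> {0<..1}" using tau t0 by auto
  obtain w q where w: "w \<in> controls r" "\<And>t. norm (w t) \<le> 1 + \<epsilon>" and q: "trajectory F r 0 w q" and qs: "q r = \<sigma> \<tau>"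
    using sphere_almost_minimizer[OF C1 r, of "\<sigma> \<tau>" "1 + \<epsilon>"] sphere in1 eps by auto
  have "norm (w t) \<le> 1 + \<kappa>" for t using w(2)[of t] eps by linarith
  moreover have "norm (q r - A) < \<kappa>" using t1(2)[OF tau(1,3)] by (simp add: qs dist_norm)
  ultimately have wu: "L2_norm r (\<lambda>t. w t - u t) < \<delta>" using close w(1) q by blast
  have Ew: "end_point F r w = \<sigma> \<tau>" using end_point_eq[OF C1 w(1) q r0] qs by simp
  have "r \<le> (L2_norm r w)\<^sup>2" using sphere_energy_ge[OF r w(1) q] qs sphere in1 by simp
  moreover have "(L2_norm r w)\<^sup>2 \<le> r + \<xi>"
  proof -
    have "(L2_norm r w)\<^sup>2 \<le> (1 + 3 * \<epsilon>) * r"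
      by (rule energy_le_of_speed_le[OF r0 w less_imp_le[OF eps(1)] eps(3)])
    also have "\<dots> \<le> r + \<xi>" using eps(4) r by (simp add: field_simps)
    finally show ?thesis .
  qed
  ultimately have "\<bar>(L2_norm r w)\<^sup>2 - r\<bar> \<le> \<xi>" by simp
  then obtain v s where v: "v \<in> end_point_dom F r" and s: "s \<in> {0<..1}" and Ev: "end_point F r v = \<sigma> s"
    and less: "(L2_norm r v)\<^sup>2 < r"
    using reach w(1) wu Ew by blast
  obtain z where vc: "v \<in> controls r" and z: "trajectory F r 0 v z" using v by (auto simp: end_point_dom_def)
  have "z r = \<sigma> s" using end_point_eq[OF C1 vc z r0] Ev by simp
  then have "r \<le> (L2_norm r v)\<^sup>2" using sphere_energy_ge[OF r vc z] sphere s by simp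
  with less show False by simp
qed

end
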